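(* Let $\Delta$ be a pure simplicial complex on $[n]$ and let $\mathbb{F}$ be a field with $\mathrm{char}(\mathbb{F}) = 0$. Then $A_{\Delta} = R_{\Delta} / (y_i - x_i \mid i \in \{1, \ldots, n\})$, and $y_1 - x_1, \ldots, y_n - x_n$ is an $R_{\Delta}$-regular sequence of linear forms.
   Context: A simplicial complex $\Delta$ on $[n]=\{1,\dots,n\}$ is a nonempty collection of subsets of $[n]$ closed under inclusion; $\mathcal{F}(\Delta)$ is the set of its inclusion-maximal elements (facets). $\dim F=|F|-1$ and $\Delta$ is pure if all facets have the same dimension. The Stanley--Reisner ideal is $I_\Delta=(\prod_{i\in F}x_i : F\subseteq [n],\, F\notin\Delta)\subseteq\mathbb{F}[x_1,\dots,x_n]$. The algebra $R_\Delta$. Let $\Delta$ be pure of dimension $d-1$, $S=\mathbb{F}[x_1,\dots,x_n,y_1,\dots,y_n]$, $I_\Gamma=I_\Delta S+(x_iy_i: i\in[n])$, $\mathbb{F}[\Gamma]=S/I_\Gamma$ (Cohen--Macaulay of dimension $n$) and $\omega=\mathrm{Ext}^n_S(\mathbb{F}[\Gamma],S(-2n))$ its canonical module. Then $R_\Delta:=\mathbb{F}[\Gamma]\ltimes\omega(n-d-1)$ (Nagata idealization: $A\ltimes M=A\oplus M$ with $(a_1,m_1)(a_2,m_2)=(a_1a_2,a_1m_2+a_2m_1)$, graded by $(A\ltimes M)_j=A_j\oplus M_j$; $M(a)_j=M_{a+j}$). It is presented as $$R_\Delta=\frac{S[z_F : F\in\mathcal{F}(\Delta)]}{I_\Gamma+(x_iz_F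 : i\notin F)+(\mathbf{y}^{F_1\setminus F_2}z_{F_1}-\mathbf{y}^{F_2\setminus F_1}z_{F_2} : F_1\ne F_2)+(z_F)^2},$$ with $F,F_1,F_2$ ranging over $\mathcal{F}(\Delta)$ and $\mathbf{y}^{G}=\prod_{i\in G}y_i$. The algebra $A_\Delta$. Let $f_\Delta=\sum_{F\in\mathcal{F}(\Delta)}z_F\prod_{i\in F}x_i\in\mathbb{F}[x_i,z_F\mid i\in[n],F\in\mathcal{F}(\Delta)]$. $A_\Delta$ is the graded Artinian Gorenstein algebra associated with $f_\Delta$ via Macaulay's inverse system: $A_\Delta=Q/\mathrm{Ann}_Q(f_\Delta)$, where $Q$ is a polynomial ring with variables indexed by $\{x_i\}\cup\{z_F\}$ (denoted again $x_i,z_F$) acting on polynomials by partial differentiation, and $\mathrm{Ann}_Q(f_\Delta)$ is the ideal of operators annihilating $f_\Delta$. The equality in the claim is the isomorphism of graded algebras matching the classes of $x_i$ and $z_F$. *)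

theory Defs
  imports
    "HOL-Library.Poly_Mapping"
    "HOL-Algebra.Algebra"
    "HOL-Algebra.Algebraic_Closure_Type"
    "Jordan_Normal_Form.Matrix"
begin

section \<open>Simplicial complexes\<close>

definition simplicial_complex :: "nat \<Rightarrow> nat set set \<Rightarrow> bool" where
  "simplicial_complex n \<Delta> \<longleftrightarrow>
     \<Delta> \<noteq> {} \<and> (\<forall>F\<in>\<Delta>. F \<subseteq> {1..n}) \<and> (\<forall>F\<in>\<Delta>. \<forall>G. G \<subseteq> F \<longrightarrow> G \<in> \<Delta>)"

definition facets :: "nat set set \<Rightarrow> nat set set" where
  "facets \<Delta> = {F \<in> \<Delta>. \<forall>G\<in>\<Delta>. F \<subseteq> G \<longrightarrow> G = F}"

definition face_dim :: "nat set \<Rightarrow> int" where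
  "face_dim F = int (card F) - 1"

definition pure_complex :: "nat set set \<Rightarrow> bool" where
  "pure_complex \<Delta> \<longleftrightarrow> (\<forall>F\<in>facets \<Delta>. \<forall>G\<in>facets \<Delta>. face_dim F = face_dim G)"

definition complex_dim :: "nat set set \<Rightarrow> int" where
  "complex_dim \<Delta> = Max (face_dim ` \<Delta>)"


section \<open>Polynomials\<close>

datatype var = Xv nat | Yv nat | Zv "nat set"

text \<open>All polynomials live in one type, with infinitely many variables; the polynomial rings in
  finitely many variables are carriers inside it.\<close>

type_synonym 'k mpoly = "(var \<Rightarrow>\<^sub>0 nat) \<Rightarrow>\<^sub>0 'k"

definition pvar :: "var \<Rightarrow> 'k::comm_ring_1 mpoly" where
  "pvar v = Poly_Mapping.single (Poly_Mapping.single v 1) 1"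

definition pconst :: "'k::comm_ring_1 \<Rightarrow> 'k mpoly" where
  "pconst c = Poly_Mapping.single 0 c"

definition pvars :: "'k::comm_ring_1 mpoly \<Rightarrow> var set" where
  "pvars p = (\<Union>m \<in> Poly_Mapping.keys p. Poly_Mapping.keys m)"

definition mon_degree :: "(var \<Rightarrow>\<^sub>0 nat) \<Rightarrow> nat" where
  "mon_degree m = (\<Sum>v\<in>Poly_Mapping.keys m. Poly_Mapping.lookup m v)"

text \<open>The zero polynomial is homogeneous of every degree; in negative degrees it is the only
  homogeneous polynomial.\<close>

definition homog :: "int \<Rightarrow> 'k::comm_ring_1 mpoly \<Rightarrow> bool" where
  "homog e p \<longleftrightarrow> (\<forall>m\<in>Poly_Mapping.keys p. int (mon_degree m) = e)"

definition poly_ring :: "var set \<Rightarrow> 'k::comm_ring_1 mpoly ring" where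
  "poly_ring V = ring_of_type_algebra\<lparr>carrier := {p. pvars p \<subseteq> V}\<rparr>"

definition xvars :: "nat \<Rightarrow> var set" where "xvars n = Xv ` {1..n}"
definition yvars :: "nat \<Rightarrow> var set" where "yvars n = Yv ` {1..n}"
definition zvars :: "nat set set \<Rightarrow> var set" where "zvars \<Delta> = Zv ` facets \<Delta>"

definition ring_S :: "nat \<Rightarrow> 'k::comm_ring_1 mpoly ring" where
  "ring_S n = poly_ring (xvars n \<union> yvars n)"

definition ring_T :: "nat \<Rightarrow> nat set set \<Rightarrow> 'k::comm_ring_1 mpoly ring" where
  "ring_T n \<Delta> = poly_ring (xvars n \<union> yvars n \<union> zvars \<Delta>)"

definition ring_Q :: "nat \<Rightarrow> nat set set \<Rightarrow> 'k::comm_ring_1 mpoly ring" where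
  "ring_Q n \<Delta> = poly_ring (xvars n \<union> zvars \<Delta>)"

definition xmon :: "nat set \<Rightarrow> 'k::comm_ring_1 mpoly" where
  "xmon G = (\<Prod>i\<in>G. pvar (Xv i))"

definition ymon :: "nat set \<Rightarrow> 'k::comm_ring_1 mpoly" where
  "ymon G = (\<Prod>i\<in>G. pvar (Yv i))"


section \<open>The ring $\mathbb{F}[\Gamma]$\<close>

definition stanley_reisner_ideal :: "nat \<Rightarrow> nat set set \<Rightarrow> 'k::comm_ring_1 mpoly set" where
  "stanley_reisner_ideal n \<Delta> =
     Idl\<^bsub>poly_ring (xvars n)\<^esub> {xmon F | F. F \<subseteq> {1..n} \<and> F \<notin> \<Delta>}"

definition ideal_\<Gamma> :: "nat \<Rightarrow> nat set set \<Rightarrow> 'k::comm_ring_1 mpoly set" where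
  "ideal_\<Gamma> n \<Delta> =
     Idl\<^bsub>ring_S n\<^esub> (stanley_reisner_ideal n \<Delta> \<union> {pvar (Xv i) * pvar (Yv i) | i. i \<in> {1..n}})"

definition ring_\<Gamma> :: "nat \<Rightarrow> nat set set \<Rightarrow> 'k::comm_ring_1 mpoly set ring" where
  "ring_\<Gamma> n \<Delta> = ring_S n Quot ideal_\<Gamma> n \<Delta>"

definition class_\<Gamma> :: "nat \<Rightarrow> nat set set \<Rightarrow> 'k::comm_ring_1 mpoly \<Rightarrow> 'k mpoly set" where
  "class_\<Gamma> n \<Delta> p = ideal_\<Gamma> n \<Delta> +>\<^bsub>ring_S n\<^esub> p"


section \<open>Graded free resolutions and Ext\<close>

definition free_module :: "nat \<Rightarrow> nat \<Rightarrow> ('k::comm_ring_1 mpoly, 'k mpoly vec) module" where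
  "free_module n r = (module_vec TYPE('k mpoly) r)
     \<lparr>carrier := {v \<in> carrier_vec r. set\<^sub>v v \<subseteq> carrier (ring_S n)}\<rparr>"

text \<open>A record \<open>P\<close> encodes the complex of graded free $S$-modules with
  $P_i = \bigoplus_{j < \mathrm{rk}_i} S(-a_{ij})$, where $\mathrm{rk}_i$ is \<open>res_rank P i\<close> and
  $a_{ij}$ is \<open>res_deg P i j\<close>; \<open>res_diff P i\<close> is the matrix of $P_{i+1} \to P_i$.\<close>

record (overloaded) 'k resolution =
  res_rank :: "nat \<Rightarrow> nat"
  res_deg  :: "nat \<Rightarrow> nat \<Rightarrow> int"
  res_diff :: "nat \<Rightarrow> 'k mpoly mat"

text \<open>A graded free resolution of the cyclic module $S/I$ by finitely generated modules (not
  necessarily minimal, nor of finite length), with $P_0 = S$ and with the canonical projection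
  $S \to S/I$ as augmentation. Such resolutions exist since $S$ is Noetherian, and the Ext modules
  below do not depend, up to graded isomorphism, on the choice.\<close>

definition graded_free_resolution ::
    "nat \<Rightarrow> 'k::comm_ring_1 mpoly set \<Rightarrow> 'k resolution \<Rightarrow> bool" where
  "graded_free_resolution n I P \<longleftrightarrow>
     res_rank P 0 = 1 \<and> res_deg P 0 0 = 0 \<and>
     (\<forall>i. res_diff P i \<in> carrier_mat (res_rank P i) (res_rank P (Suc i)) \<and>
          elements_mat (res_diff P i) \<subseteq> carrier (ring_S n)) \<and>
     (\<forall>i. \<forall>j < res_rank P i. \<forall>k < res_rank P (Suc i).
          homog (res_deg P (Suc i) k - res_deg P i j) (res_diff P i $$ (j, k))) \<and>
     (\<lambda>v. res_diff P 0 *\<^sub>v v) ` carrier (free_module n (res_rank P 1)) =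
       {v \<in> carrier (free_module n 1). v $ 0 \<in> I} \<and>
     (\<forall>i. (\<lambda>v. res_diff P (Suc i) *\<^sub>v v) ` carrier (free_module n (res_rank P (Suc (Suc i)))) =
          {v \<in> carrier (free_module n (res_rank P (Suc i))).
             res_diff P i *\<^sub>v v = 0\<^sub>v (res_rank P i)})"

text \<open>A homomorphism $P_i \to S$ is given by the vector of its values on the basis, so that the
  differentials of $\mathrm{Hom}_S(P, S)$ are the transposed matrices.\<close>

definition cocycles :: "nat \<Rightarrow> 'k::comm_ring_1 resolution \<Rightarrow> nat \<Rightarrow> 'k mpoly vec set" where
  "cocycles n P i = {v \<in> carrier (free_module n (res_rank P i)).
     transpose_mat (res_diff P i) *\<^sub>v v = 0\<^sub>v (res_rank P (Suc i))}"

fun coboundaries :: "nat \<Rightarrow> 'k::comm_ring_1 resolution \<Rightarrow> nat \<Rightarrow> 'k mpoly vec set" where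
  "coboundaries n P 0 = {0\<^sub>v (res_rank P 0)}"
| "coboundaries n P (Suc i) =
     (\<lambda>w. transpose_mat (res_diff P i) *\<^sub>v w) ` carrier (free_module n (res_rank P i))"

text \<open>As for the library's module of vectors, the ring multiplication inherited by the record type
  of modules is irrelevant.\<close>

definition quotient_module :: "('a, 'b, 'c) module_scheme \<Rightarrow> 'b set \<Rightarrow> ('a, 'b set) module" where
  "quotient_module M N =
     \<lparr>carrier = a_rcosets\<^bsub>M\<^esub> N, monoid.mult = undefined, monoid.one = undefined,
      ring.zero = N, ring.add = set_add M,
      module.smult = (\<lambda>a A. \<Union>v\<in>A. N +>\<^bsub>M\<^esub> (a \<odot>\<^bsub>M\<^esub> v))\<rparr>"

definition cocycle_module ::
    "nat \<Rightarrow> 'k::comm_ring_1 resolution \<Rightarrow> nat \<Rightarrow> ('k mpoly, 'k mpoly vec) module" where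
  "cocycle_module n P i = (free_module n (res_rank P i))\<lparr>carrier := cocycles n P i\<rparr>"

text \<open>$\mathrm{Ext}^i_S(S/I, S(s))$, computed from a graded free resolution \<open>P\<close> of $S/I$. The twist
  $s$ only affects the grading: the elements of degree $e$ are the classes of the cocycles in
  $\bigoplus_j S(a_{ij} + s)_e$.\<close>

definition Ext_module ::
    "nat \<Rightarrow> 'k::comm_ring_1 resolution \<Rightarrow> nat \<Rightarrow> ('k mpoly, 'k mpoly vec set) module" where
  "Ext_module n P i = quotient_module (cocycle_module n P i) (coboundaries n P i)"

definition Ext_grade ::
    "nat \<Rightarrow> 'k::comm_ring_1 resolution \<Rightarrow> nat \<Rightarrow> int \<Rightarrow> int \<Rightarrow> 'k mpoly vec set set" where
  "Ext_grade n P i s e =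
     (\<lambda>v. coboundaries n P i +>\<^bsub>cocycle_module n P i\<^esub> v) `
       {v \<in> cocycles n P i. \<forall>j < res_rank P i. homog (res_deg P i j + s + e) (v $ j)}"

text \<open>A module over \<open>R\<close> annihilated by the ideal \<open>I\<close>, regarded as a module over \<open>R Quot I\<close>: a coset
  acts through its members, all of which act alike.\<close>

definition module_over_quotient ::
    "('a, 'b set, 'c) module_scheme \<Rightarrow> ('a set, 'b set) module" where
  "module_over_quotient M =
     \<lparr>carrier = carrier M, monoid.mult = monoid.mult M, monoid.one = monoid.one M,
      ring.zero = ring.zero M, ring.add = ring.add M,
      module.smult = (\<lambda>A m. \<Union>a\<in>A. a \<odot>\<^bsub>M\<^esub> m)\<rparr>"

text \<open>The canonical module $\omega = \mathrm{Ext}^n_S(\mathbb{F}[\Gamma], S(-2n))$ as a module over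
  $\mathbb{F}[\Gamma]$; here \<open>P\<close> is a graded free resolution of $\mathbb{F}[\Gamma]$ over $S$.\<close>

definition \<omega>_module ::
    "nat \<Rightarrow> 'k::comm_ring_1 resolution \<Rightarrow> ('k mpoly set, 'k mpoly vec set) module" where
  "\<omega>_module n P = module_over_quotient (Ext_module n P n)"

definition \<omega>_grade :: "nat \<Rightarrow> 'k::comm_ring_1 resolution \<Rightarrow> int \<Rightarrow> 'k mpoly vec set set" where
  "\<omega>_grade n P e = Ext_grade n P n (- 2 * int n) e"


section \<open>The ring $R_\Delta$\<close>

definition idealization ::
    "('a, 'c) ring_scheme \<Rightarrow> ('a, 'b, 'd) module_scheme \<Rightarrow> ('a \<times> 'b) ring" where
  "idealization A M =
     \<lparr>carrier = carrier A \<times> carrier M,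
      monoid.mult = (\<lambda>(a1, m1) (a2, m2).
        (a1 \<otimes>\<^bsub>A\<^esub> a2, (a1 \<odot>\<^bsub>M\<^esub> m2) \<oplus>\<^bsub>M\<^esub> (a2 \<odot>\<^bsub>M\<^esub> m1))),
      monoid.one = (\<one>\<^bsub>A\<^esub>, \<zero>\<^bsub>M\<^esub>),
      ring.zero = (\<zero>\<^bsub>A\<^esub>, \<zero>\<^bsub>M\<^esub>),
      ring.add = (\<lambda>(a1, m1) (a2, m2). (a1 \<oplus>\<^bsub>A\<^esub> a2, m1 \<oplus>\<^bsub>M\<^esub> m2))\<rparr>"

definition ring_R ::
    "nat \<Rightarrow> nat set set \<Rightarrow> 'k::comm_ring_1 resolution \<Rightarrow> ('k mpoly set \<times> 'k mpoly vec set) ring" where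
  "ring_R n \<Delta> P = idealization (ring_\<Gamma> n \<Delta>) (\<omega>_module n P)"

definition R_grade ::
    "nat \<Rightarrow> nat set set \<Rightarrow> 'k::comm_ring_1 resolution \<Rightarrow> int
      \<Rightarrow> ('k mpoly set \<times> 'k mpoly vec set) set" where
  "R_grade n \<Delta> P j =
     (let d = complex_dim \<Delta> + 1 in
      class_\<Gamma> n \<Delta> ` {p \<in> carrier (ring_S n). homog j p} \<times> \<omega>_grade n P (j + (int n - d - 1)))"

definition embed_R ::
    "nat \<Rightarrow> nat set set \<Rightarrow> 'k::comm_ring_1 resolution \<Rightarrow> 'k mpoly
      \<Rightarrow> 'k mpoly set \<times> 'k mpoly vec set" where
  "embed_R n \<Delta> P p = (class_\<Gamma> n \<Delta> p, \<zero>\<^bsub>\<omega>_module n P\<^esub>)"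

definition relations_R :: "nat \<Rightarrow> nat set set \<Rightarrow> 'k::comm_ring_1 mpoly set" where
  "relations_R n \<Delta> = Idl\<^bsub>ring_T n \<Delta>\<^esub>
     (ideal_\<Gamma> n \<Delta>
      \<union> {pvar (Xv i) * pvar (Zv F) | i F. F \<in> facets \<Delta> \<and> i \<in> {1..n} \<and> i \<notin> F}
      \<union> {ymon (F1 - F2) * pvar (Zv F1) - ymon (F2 - F1) * pvar (Zv F2) | F1 F2.
           F1 \<in> facets \<Delta> \<and> F2 \<in> facets \<Delta> \<and> F1 \<noteq> F2}
      \<union> {pvar (Zv F1) * pvar (Zv F2) | F1 F2. F1 \<in> facets \<Delta> \<and> F2 \<in> facets \<Delta>})"

text \<open>\<open>presentation_R n \<Delta> P \<pi>\<close>: the map \<open>\<pi>\<close> presents $R_\Delta$ as the quotient of $S[z_F]$ by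
  \<open>relations_R\<close>, as graded $\mathbb{F}[\Gamma]$-algebras, the $z_F$ being mapped to elements of the
  summand $\omega$. The element of $R_\Delta$ denoted $z_F$ is \<open>\<pi> (pvar (Zv F))\<close>.\<close>

definition presentation_R ::
    "nat \<Rightarrow> nat set set \<Rightarrow> 'k::comm_ring_1 resolution
      \<Rightarrow> ('k mpoly \<Rightarrow> 'k mpoly set \<times> 'k mpoly vec set) \<Rightarrow> bool" where
  "presentation_R n \<Delta> P \<pi> \<longleftrightarrow>
     \<pi> \<in> Ring.ring_hom (ring_T n \<Delta>) (ring_R n \<Delta> P) \<and>
     (\<forall>p \<in> carrier (ring_S n). \<pi> p = embed_R n \<Delta> P p) \<and>
     (\<forall>F \<in> facets \<Delta>. fst (\<pi> (pvar (Zv F))) = \<zero>\<^bsub>ring_\<Gamma> n \<Delta>\<^esub>) \<and>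
     \<pi> ` carrier (ring_T n \<Delta>) = carrier (ring_R n \<Delta> P) \<and>
     (\<forall>j. \<pi> ` {p \<in> carrier (ring_T n \<Delta>). homog j p} = R_grade n \<Delta> P j) \<and>
     a_kernel (ring_T n \<Delta>) (ring_R n \<Delta> P) \<pi> = relations_R n \<Delta>"

definition regular_sequence :: "('a, 'b) ring_scheme \<Rightarrow> 'a list \<Rightarrow> bool" where
  "regular_sequence R as \<longleftrightarrow>
     set as \<subseteq> carrier R \<and>
     (\<forall>i < length as. \<forall>r \<in> carrier R.
        as ! i \<otimes>\<^bsub>R\<^esub> r \<in> Idl\<^bsub>R\<^esub> (set (take i as)) \<longrightarrow> r \<in> Idl\<^bsub>R\<^esub> (set (take i as))) \<and>
     Idl\<^bsub>R\<^esub> (set as) \<noteq> carrier R"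

definition y_minus_x ::
    "nat \<Rightarrow> nat set set \<Rightarrow> 'k::comm_ring_1 resolution
      \<Rightarrow> ('k mpoly set \<times> 'k mpoly vec set) list" where
  "y_minus_x n \<Delta> P =
     map (\<lambda>i. embed_R n \<Delta> P (pvar (Yv i)) \<ominus>\<^bsub>ring_R n \<Delta> P\<^esub> embed_R n \<Delta> P (pvar (Xv i))) [1..<Suc n]"

definition ideal_yx ::
    "nat \<Rightarrow> nat set set \<Rightarrow> 'k::comm_ring_1 resolution
      \<Rightarrow> ('k mpoly set \<times> 'k mpoly vec set) set" where
  "ideal_yx n \<Delta> P = Idl\<^bsub>ring_R n \<Delta> P\<^esub> (set (y_minus_x n \<Delta> P))"

definition class_R_mod_yx ::
    "nat \<Rightarrow> nat set set \<Rightarrow> 'k::comm_ring_1 resolution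
      \<Rightarrow> 'k mpoly set \<times> 'k mpoly vec set \<Rightarrow> ('k mpoly set \<times> 'k mpoly vec set) set" where
  "class_R_mod_yx n \<Delta> P r = ideal_yx n \<Delta> P +>\<^bsub>ring_R n \<Delta> P\<^esub> r"


section \<open>The ring $A_\Delta$\<close>

definition partial_deriv :: "var \<Rightarrow> 'k::comm_ring_1 mpoly \<Rightarrow> 'k mpoly" where
  "partial_deriv v p =
     (\<Sum>m\<in>Poly_Mapping.keys p. Poly_Mapping.single (m - Poly_Mapping.single v 1)
                      (of_nat (Poly_Mapping.lookup m v) * Poly_Mapping.lookup p m))"

text \<open>The operator $\prod_v \partial_v^{m_v}$; the partial derivatives commute, so the order of
  folding is irrelevant.\<close>

definition monomial_operator :: "(var \<Rightarrow>\<^sub>0 nat) \<Rightarrow> 'k::comm_ring_1 mpoly \<Rightarrow> 'k mpoly" where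
  "monomial_operator m p =
     Finite_Set.fold (\<lambda>v. partial_deriv v ^^ Poly_Mapping.lookup m v) p (Poly_Mapping.keys m)"

definition apply_operator :: "'k::comm_ring_1 mpoly \<Rightarrow> 'k mpoly \<Rightarrow> 'k mpoly" where
  "apply_operator q p =
     (\<Sum>m\<in>Poly_Mapping.keys q. pconst (Poly_Mapping.lookup q m) * monomial_operator m p)"

definition f_\<Delta> :: "nat set set \<Rightarrow> 'k::comm_ring_1 mpoly" where
  "f_\<Delta> \<Delta> = (\<Sum>F\<in>facets \<Delta>. pvar (Zv F) * xmon F)"

definition Ann_Q :: "nat \<Rightarrow> nat set set \<Rightarrow> 'k::comm_ring_1 mpoly \<Rightarrow> 'k mpoly set" where
  "Ann_Q n \<Delta> f = {q \<in> carrier (ring_Q n \<Delta>). apply_operator q f = 0}"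

definition ring_A :: "nat \<Rightarrow> nat set set \<Rightarrow> 'k::comm_ring_1 mpoly set ring" where
  "ring_A n \<Delta> = ring_Q n \<Delta> Quot Ann_Q n \<Delta> (f_\<Delta> \<Delta>)"

definition class_A :: "nat \<Rightarrow> nat set set \<Rightarrow> 'k::comm_ring_1 mpoly \<Rightarrow> 'k mpoly set" where
  "class_A n \<Delta> q = Ann_Q n \<Delta> (f_\<Delta> \<Delta>) +>\<^bsub>ring_Q n \<Delta>\<^esub> q"

definition A_grade :: "nat \<Rightarrow> nat set set \<Rightarrow> int \<Rightarrow> 'k::comm_ring_1 mpoly set set" where
  "A_grade n \<Delta> j = class_A n \<Delta> ` {q \<in> carrier (ring_Q n \<Delta>). homog j q}"

end

theory Submission
  imports Defs "HOL-Library.Product_Plus"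
begin

text \<open>The variables $y_i$ and the canonical module are handled by one normal form for monomials of
  $S[z_F]$, and both claims are read off from it.

  The products $x_1 y_1, \dots, x_n y_n$ form a regular sequence of
  length \<open>n\<close> inside $I_\Gamma$. Let \<open>B\<close> be the ideal that they generate in $S$. By Rees's lemma,
  $\mathrm{Ext}^n_S(S/I_\Gamma, S) \cong (B : I_\Gamma)/B$, with degrees shifted by $2n$, which the
  twist $S(-2n)$ undoes. This holds for the cohomology of every graded free resolution, because
  multiplication by an element of $I_\Gamma$ is null-homotopic on it, and the transposed homotopies
  invert the connecting homomorphisms (\<open>ext_colon\<close>, \<open>ext_iso_exists\<close>). Modulo \<open>B\<close> the colon ideal is
  spanned by the multiples of the monomials $\mathbf{y}^{[n] \setminus F}$ with $F$ a facet
  (\<open>colon_monomial\<close>). Hence $z_F \mapsto \mathbf{y}^{[n] \setminus F}$ defines a surjection of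
  $S[z_F]$ onto $R_\Delta$; purity makes it homogeneous (\<open>pres_presentation\<close>).

  For $K \subseteq [n]$ replace $y_j$ by $x_j$ for $j \in K$, and replace
  $z_F$ by the image of $\mathbf{y}^{[n] \setminus F}$, recording the degree in the $z_F$. The ideal
  generated by the relations of $R_\Delta$ and the $y_j - x_j$ with $j \in K$ consists of the
  polynomials whose image has only monomials that vanish for an obvious reason: the degree in the
  $z_F$ is at least 2, or the monomial is divisible by $x_j^2$ with $j \in K$ or by $x_j y_j$ with
  $j \notin K$, or the degree in the $z_F$ is 0 and the indices of the $x_j$ dividing it form no face
  (\<open>rel_ideal_contains\<close>, \<open>rel_ideal_least\<close>).

  For $K = \emptyset$ this identifies the kernel of the surjection onto $R_\Delta$. For
  $K = \{1, \dots, i\}$ it shows that multiplication by $y_{i+1} - x_{i+1}$ is injective modulo the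
  previous elements, as a coefficient of $p$ at a monomial that does not vanish can be recovered from
  $(y_{i+1} - x_{i+1}) p$ (\<open>theta_regular\<close>). For $K = [n]$ the monomials that do not vanish are the
  $\mathbf{x}^G$ with $G \in \Delta$ in degree 0 and the $\mathbf{x}^{[n] \setminus H}$ in degree 1.
  For a polynomial $q$ in the $x_i$ and $z_F$, the coefficients of its image at them are exactly the
  coefficients of $q \cdot f_\Delta$ at $z_F \mathbf{x}^{F \setminus G}$ and at $\mathbf{x}^H$
  (\<open>annihilator_rel_ideal\<close>). So the quotient by all $y_i - x_i$ is $Q/\mathrm{Ann}_Q(f_\Delta)$.\<close>


section \<open>Polynomials as finite sums of monomials\<close>

abbreviation lkp :: "('a \<Rightarrow>\<^sub>0 'b::zero) \<Rightarrow> 'a \<Rightarrow> 'b" where "lkp \<equiv> Poly_Mapping.lookup"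
abbreviation kys :: "('a \<Rightarrow>\<^sub>0 'b::zero) \<Rightarrow> 'a set" where "kys \<equiv> Poly_Mapping.keys"
abbreviation sgl :: "'a \<Rightarrow> 'b \<Rightarrow> 'a \<Rightarrow>\<^sub>0 'b::zero" where "sgl \<equiv> Poly_Mapping.single"
abbreviation mono1 :: "'a \<Rightarrow> 'a \<Rightarrow>\<^sub>0 'b::comm_ring_1" where "mono1 m \<equiv> sgl m 1"

lemma in_kys: "m \<in> kys p \<longleftrightarrow> lkp p m \<noteq> 0"
  by (rule in_keys_iff)

lemma sum_of_terms: "p = (\<Sum>m\<in>kys p. sgl m (lkp p m))"
  by (rule poly_mapping_eqI) (auto simp: lookup_sum lookup_single when_def in_kys)

lemma term_induct [consumes 1, case_names zero single add]:
  fixes p :: "'a \<Rightarrow>\<^sub>0 'b::comm_monoid_add"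
  assumes "kys p \<subseteq> A" and "P 0" and "\<And>m c. m \<in> A \<Longrightarrow> P (sgl m c)"
    and "\<And>p q. P p \<Longrightarrow> P q \<Longrightarrow> P (p + q)"
  shows "P p"
proof -
  have "P (\<Sum>m\<in>B. sgl m (lkp p m))" if "finite B" "B \<subseteq> A" for B
    using that by (induction rule: finite_induct) (auto intro: assms)
  from this[of "kys p"] show ?thesis
    using assms(1) sum_of_terms[of p] by simp
qed

lemmas poly_induct [case_names zero single add] = term_induct[OF subset_UNIV]

lemma lookup_monomial_mult:
  fixes p :: "'a::cancel_comm_monoid_add \<Rightarrow>\<^sub>0 'b::comm_ring_1"
  shows "lkp (sgl a c * p) (a + u) = c * lkp p u"
proof -
  have "lkp (sgl a c * p) (a + u) = c * (\<Sum>q. lkp p q when a + u = a + q)"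
    by (simp add: lookup_mult lookup_single when_mult)
  also have "(\<Sum>q. lkp p q when a + u = a + q) = lkp p u"
    by simp
  finally show ?thesis .
qed

lemma lookup_monomial_mult_outside:
  fixes p :: "'a::cancel_comm_monoid_add \<Rightarrow>\<^sub>0 'b::comm_ring_1"
  assumes "\<And>u. v \<noteq> a + u"
  shows "lkp (sgl a c * p) v = 0"
  using assms by (simp add: lookup_mult lookup_single when_mult)

lemma keys_plus_sub: "kys p \<subseteq> U \<Longrightarrow> kys q \<subseteq> U \<Longrightarrow> kys (p + q) \<subseteq> U"
  using keys_add[of p q] by blast

lemma keys_uminus: "kys (- p) = kys (p :: 'a \<Rightarrow>\<^sub>0 'b::ab_group_add)"
  by (auto simp: in_kys)

lemma keys_minus_sub:
  "kys p \<subseteq> U \<Longrightarrow> kys q \<subseteq> U \<Longrightarrow> kys (p - q) \<subseteq> U" for p :: "'a \<Rightarrow>\<^sub>0 'b::ab_group_add"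
  by (auto simp: in_kys lookup_minus subset_iff) (metis diff_0_right)

lemma keys_sum_sub: "(\<And>i. i \<in> I \<Longrightarrow> kys (f i) \<subseteq> U) \<Longrightarrow> kys (sum f I) \<subseteq> U"
proof (induction I rule: infinite_finite_induct)
  case (insert x F)
  then show ?case using keys_plus_sub[of "f x" U "sum f F"] by simp
qed auto

lemma keys_mult_sub:
  assumes "kys p \<subseteq> A" "kys q \<subseteq> B" "\<And>a b. a \<in> A \<Longrightarrow> b \<in> B \<Longrightarrow> a + b \<in> U"
  shows "kys (p * q) \<subseteq> U"
  using keys_mult[of p q] assms by blast

lemma keys_sgl_sub: "(c \<noteq> 0 \<Longrightarrow> m \<in> U) \<Longrightarrow> kys (sgl m c) \<subseteq> U"
  by auto

subsection \<open>Restriction to a set of monomials\<close>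

definition restr :: "'a set \<Rightarrow> ('a \<Rightarrow>\<^sub>0 'b::zero) \<Rightarrow> 'a \<Rightarrow>\<^sub>0 'b" where
  "restr U p = Poly_Mapping.mapp (\<lambda>m c. if m \<in> U then c else 0) p"

lemma lookup_restr: "lkp (restr U p) m = (if m \<in> U then lkp p m else 0)"
  by (auto simp: restr_def lookup_mapp when_def in_kys)

lemma restr_add: "restr U (p + q) = restr U p + restr U q"
  by (rule poly_mapping_eqI) (simp add: lookup_restr lookup_add)

lemma restr_0 [simp]: "restr U 0 = 0"
  by (rule poly_mapping_eqI) (simp add: lookup_restr)

lemma restr_sum: "restr U (sum f I) = (\<Sum>i\<in>I. restr U (f i))"
  by (induction I rule: infinite_finite_induct) (auto simp: restr_add)

lemma keys_restr: "kys (restr U p) = kys p \<inter> U"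
  by (auto simp: in_kys lookup_restr split: if_splits)

lemma restr_single: "restr U (sgl m c) = (if m \<in> U then sgl m c else 0)"
  by (rule poly_mapping_eqI) (auto simp: lookup_restr lookup_single when_def)

lemma restr_ident: "kys p \<subseteq> U \<Longrightarrow> restr U p = p"
  by (rule poly_mapping_eqI) (auto simp: lookup_restr in_kys)

lemma restr_compl: "p = restr U p + restr (- U) p" for p :: "'a \<Rightarrow>\<^sub>0 'b::comm_monoid_add"
  by (rule poly_mapping_eqI) (auto simp: lookup_restr lookup_add)

subsection \<open>Pushing a polynomial forward along a map of monomials\<close>

definition push :: "('a \<Rightarrow> 'c) \<Rightarrow> ('a \<Rightarrow>\<^sub>0 'b::comm_ring_1) \<Rightarrow> 'c \<Rightarrow>\<^sub>0 'b" where
  "push N p = (\<Sum>m\<in>kys p. sgl (N m) (lkp p m))"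

lemma push_superset: "finite A \<Longrightarrow> kys p \<subseteq> A \<Longrightarrow> push N p = (\<Sum>m\<in>A. sgl (N m) (lkp p m))"
  unfolding push_def by (rule sum.mono_neutral_left) (auto simp: in_kys)

lemma push_add: "push N (p + q) = push N p + push N q"
proof -
  let ?A = "kys p \<union> kys q"
  have "kys (p + q) \<subseteq> ?A" by (rule keys_add)
  then have "push N (p + q) = (\<Sum>m\<in>?A. sgl (N m) (lkp (p + q) m))"
    by (intro push_superset) auto
  also have "\<dots> = push N p + push N q"
    using push_superset[of ?A p N] push_superset[of ?A q N]
    by (simp add: lookup_add single_add sum.distrib)
  finally show ?thesis .
qed

lemma push_0 [simp]: "push N 0 = 0"
  by (simp add: push_def)

lemma push_single [simp]: "push N (sgl m c) = sgl (N m) c"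
  by (cases "c = 0") (simp_all add: push_def)

lemma push_diff: "push N (p - q) = push N p - push N q"
proof -
  have "push N (p - q) + push N q = push N p"
    by (simp flip: push_add)
  then show ?thesis by (simp add: eq_diff_eq)
qed

lemma push_mult:
  fixes N :: "'a::comm_monoid_add \<Rightarrow> 'c::comm_monoid_add"
  assumes N: "\<And>a b. N (a + b) = N a + N b"
  shows "push N (p * q) = push N p * push N q"
proof (induction p rule: poly_induct)
  case (single m c)
  show ?case
    by (induction q rule: poly_induct)
       (auto simp: mult_single N distrib_left push_add)
qed (auto simp: distrib_right push_add)

lemma lookup_push: "lkp (push N p) u = (\<Sum>m | m \<in> kys p \<and> N m = u. lkp p m)"
  by (auto simp: push_def lookup_sum lookup_single when_def sum.If_cases Int_def intro!: sum.cong)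

lemma keys_push: "kys (push N p) \<subseteq> N ` kys p"
  unfolding push_def by (rule keys_sum_sub) (rule keys_sgl_sub, auto)

lemma push_push: "push M (push N p) = push (M \<circ> N) p"
  by (induction p rule: poly_induct) (auto simp: push_add)

lemma push_cong: "(\<And>m. m \<in> kys p \<Longrightarrow> N m = M m) \<Longrightarrow> push N p = push M p"
  by (auto simp: push_def)

lemma push_id: "(\<And>m. m \<in> kys p \<Longrightarrow> N m = m) \<Longrightarrow> push N p = p"
  using push_cong[of p N "\<lambda>m. m"] sum_of_terms[of p] by (simp add: push_def)

text \<open>If the monomials with the same image under \<open>N\<close> are congruent modulo \<open>B\<close>, and those with image
  in \<open>W\<close> vanish modulo \<open>B\<close>, then a polynomial is determined modulo \<open>B\<close> by the coefficients of
  its image outside \<open>W\<close>: collect its terms by their image and replace each by one representative.\<close>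

lemma push_reduction:
  fixes B :: "('a::cancel_comm_monoid_add \<Rightarrow>\<^sub>0 'b::comm_ring_1) set"
  assumes B0: "0 \<in> B" and Badd: "\<And>p q. p \<in> B \<Longrightarrow> q \<in> B \<Longrightarrow> p + q \<in> B"
    and Bc: "\<And>c p. p \<in> B \<Longrightarrow> sgl 0 c * p \<in> B"
    and same: "\<And>m m'. m \<in> A \<Longrightarrow> m' \<in> A \<Longrightarrow> N m = N m' \<Longrightarrow> N m \<notin> W \<Longrightarrow> mono1 m - mono1 m' \<in> B"
    and null: "\<And>m. m \<in> A \<Longrightarrow> N m \<in> W \<Longrightarrow> mono1 m \<in> B"
    and p: "kys p \<subseteq> A" "kys (push N p) \<subseteq> W"
  shows "p \<in> B"
proof -
  define \<rho> where "\<rho> u = (SOME m. m \<in> kys p \<and> N m = u)" for u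
  have \<rho>: "\<rho> (N m) \<in> kys p \<and> N (\<rho> (N m)) = N m" if "m \<in> kys p" for m
    unfolding \<rho>_def by (rule someI[of _ m]) (use that in auto)
  define g where "g m = (if N m \<in> W then 0 else sgl (\<rho> (N m)) (lkp p m))" for m
  have Bsum: "sum f I \<in> B" if "\<And>i. i \<in> I \<Longrightarrow> f i \<in> B" for f :: "'a \<Rightarrow> _" and I
    using that by (induction I rule: infinite_finite_induct) (auto intro: B0 Badd)
  have "sgl m (lkp p m) - g m \<in> B" if m: "m \<in> kys p" for m
  proof (cases "N m \<in> W")
    case True
    then show ?thesis
      using Bc[OF null[of m], of "lkp p m"] m p(1) by (auto simp: g_def mult_single)
  next
    case False
    have "mono1 m - mono1 (\<rho> (N m)) \<in> B"
      by (rule same) (use False \<rho>[OF m] m p(1) in auto)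
    from Bc[OF this, of "lkp p m"] show ?thesis
      using False by (simp add: g_def right_diff_distrib mult_single)
  qed
  then have 1: "(\<Sum>m\<in>kys p. sgl m (lkp p m) - g m) \<in> B"
    by (rule Bsum)
  have "(\<Sum>m\<in>kys p. g m) = (\<Sum>u\<in>N ` kys p. \<Sum>m | m \<in> kys p \<and> N m = u. g m)"
    by (rule sum.image_gen) simp
  also have "\<dots> = 0"
  proof (rule sum.neutral, rule ballI)
    fix u assume "u \<in> N ` kys p"
    show "(\<Sum>m | m \<in> kys p \<and> N m = u. g m) = 0"
    proof (cases "u \<in> W")
      case False
      have "(\<Sum>m | m \<in> kys p \<and> N m = u. g m) = (\<Sum>m | m \<in> kys p \<and> N m = u. sgl (\<rho> u) (lkp p m))"
        using False by (intro sum.cong) (auto simp: g_def)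
      also have "\<dots> = sgl (\<rho> u) (lkp (push N p) u)"
        unfolding lookup_push
        by (rule poly_mapping_eqI) (auto simp: lookup_sum lookup_single when_def)
      also have "lkp (push N p) u = 0"
        using False p(2) by (auto simp: in_kys)
      finally show ?thesis by simp
    qed (auto simp: g_def)
  qed
  finally show ?thesis
    using 1 sum_of_terms[of p] by (simp add: sum_subtractf)
qed

subsection \<open>Degrees\<close>

lemma mon_degree_superset: "finite A \<Longrightarrow> kys m \<subseteq> A \<Longrightarrow> mon_degree m = (\<Sum>v\<in>A. lkp m v)"
  unfolding mon_degree_def by (rule sum.mono_neutral_left) (auto simp: in_kys)

lemma mon_degree_add: "mon_degree (a + b) = mon_degree a + mon_degree b"
proof -
  let ?A = "kys a \<union> kys b"
  have "kys (a + b) \<subseteq> ?A" by (rule keys_add)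
  then show ?thesis
    using mon_degree_superset[of ?A a] mon_degree_superset[of ?A b] mon_degree_superset[of ?A "a + b"]
    by (simp add: lookup_add sum.distrib)
qed

lemma mon_degree_0 [simp]: "mon_degree 0 = 0"
  by (simp add: mon_degree_def)

lemma mon_degree_single [simp]: "mon_degree (sgl v k) = k"
  by (cases "k = 0") (simp_all add: mon_degree_def)

lemma mon_degree_sum: "mon_degree (sum f I) = (\<Sum>i\<in>I. mon_degree (f i))"
  by (induction I rule: infinite_finite_induct) (auto simp: mon_degree_add)

lemma homog_alt: "homog e p \<longleftrightarrow> kys p \<subseteq> {m. int (mon_degree m) = e}"
  by (auto simp: homog_def)

lemma homog_0 [simp]: "homog e 0" by (simp add: homog_def)

lemma homog_add: "homog e p \<Longrightarrow> homog e q \<Longrightarrow> homog e (p + q)"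
  unfolding homog_alt by (rule keys_plus_sub)

lemma homog_diff: "homog e p \<Longrightarrow> homog e q \<Longrightarrow> homog e (p - q)"
  unfolding homog_alt by (rule keys_minus_sub)

lemma homog_sum: "(\<And>i. i \<in> I \<Longrightarrow> homog e (f i)) \<Longrightarrow> homog e (sum f I)"
  by (induction I rule: infinite_finite_induct) (auto intro: homog_add)

lemma homog_mult: "homog d p \<Longrightarrow> homog e q \<Longrightarrow> homog (d + e) (p * q)"
  unfolding homog_alt by (erule (1) keys_mult_sub) (auto simp: mon_degree_add)

lemma homog_single: "int (mon_degree m) = e \<Longrightarrow> homog e (sgl m c)"
  unfolding homog_alt by (rule keys_sgl_sub) auto

definition hcomp :: "int \<Rightarrow> 'k::comm_ring_1 mpoly \<Rightarrow> 'k mpoly" where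
  "hcomp e = restr {m. int (mon_degree m) = e}"

lemma homog_hcomp: "homog e (hcomp e p)"
  by (auto simp: homog_alt hcomp_def keys_restr)

lemma hcomp_homog: "homog e p \<Longrightarrow> hcomp e p = p"
  by (auto simp: homog_alt hcomp_def intro!: restr_ident)

lemma hcomp_add: "hcomp e (p + q) = hcomp e p + hcomp e q"
  by (simp add: hcomp_def restr_add)

lemma hcomp_0 [simp]: "hcomp e 0 = 0" by (simp add: hcomp_def)

lemma hcomp_sum: "hcomp e (sum f I) = (\<Sum>i\<in>I. hcomp e (f i))"
  by (simp add: hcomp_def restr_sum)

lemma hcomp_diff: "hcomp e (p - q) = hcomp e p - hcomp e q"
  unfolding hcomp_def by (rule poly_mapping_eqI) (simp add: lookup_restr lookup_minus)

lemma keys_hcomp: "kys (hcomp e p) \<subseteq> kys p"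
  by (simp add: hcomp_def keys_restr)

lemma hcomp_mult_homog:
  assumes "homog d q"
  shows "hcomp (d + e) (q * p) = q * hcomp e p"
  using assms unfolding homog_alt
proof (induction q rule: term_induct)
  case (single m c)
  show ?case
    by (induction p rule: poly_induct)
       (use single in \<open>auto simp: hcomp_add distrib_left hcomp_def restr_single mult_single
          mon_degree_add restr_add\<close>)
qed (auto simp: hcomp_add distrib_right)

subsection \<open>The polynomial rings\<close>

definition mons :: "var set \<Rightarrow> (var \<Rightarrow>\<^sub>0 nat) set" where
  "mons V = {m. kys m \<subseteq> V}"

lemma mons_iff: "m \<in> mons V \<longleftrightarrow> (\<forall>v. lkp m v \<noteq> 0 \<longrightarrow> v \<in> V)"
  by (auto simp: mons_def in_kys)

lemma keys_add_nat: "kys (a + b) = kys a \<union> kys b" for a b :: "'a \<Rightarrow>\<^sub>0 nat"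
  by (auto simp: in_kys lookup_add)

lemma mons_add: "a + b \<in> mons V \<longleftrightarrow> a \<in> mons V \<and> b \<in> mons V"
  by (auto simp: mons_def keys_add_nat)

lemma mons_0 [simp]: "0 \<in> mons V" by (simp add: mons_def)

lemma mons_single: "sgl v k \<in> mons V \<longleftrightarrow> k = 0 \<or> v \<in> V"
  by (auto simp: mons_def)

lemma mons_mono: "V \<subseteq> V' \<Longrightarrow> m \<in> mons V \<Longrightarrow> m \<in> mons V'"
  by (auto simp: mons_def)

lemma pvars_subset_iff: "pvars p \<subseteq> V \<longleftrightarrow> kys p \<subseteq> mons V"
  by (auto simp: pvars_def mons_def)

lemma carrier_poly_ring: "carrier (poly_ring V) = {p. kys p \<subseteq> mons V}"
  by (simp add: poly_ring_def pvars_subset_iff)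

lemma poly_ring_simps [simp]:
  "x \<otimes>\<^bsub>poly_ring V\<^esub> y = x * y" "x \<oplus>\<^bsub>poly_ring V\<^esub> y = x + y"
  "\<zero>\<^bsub>poly_ring V\<^esub> = 0" "\<one>\<^bsub>poly_ring V\<^esub> = 1"
  by (simp_all add: poly_ring_def ring_of_type_algebra_def)

lemma poly_ring_closed:
  "0 \<in> carrier (poly_ring V)" "1 \<in> carrier (poly_ring V)"
  "p \<in> carrier (poly_ring V) \<Longrightarrow> q \<in> carrier (poly_ring V) \<Longrightarrow> p + q \<in> carrier (poly_ring V)"
  "p \<in> carrier (poly_ring V) \<Longrightarrow> q \<in> carrier (poly_ring V) \<Longrightarrow> p - q \<in> carrier (poly_ring V)"
  "p \<in> carrier (poly_ring V) \<Longrightarrow> q \<in> carrier (poly_ring V) \<Longrightarrow> p * q \<in> carrier (poly_ring V)"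
  "p \<in> carrier (poly_ring V) \<Longrightarrow> - p \<in> carrier (poly_ring V)"
  "m \<in> mons V \<Longrightarrow> sgl m c \<in> carrier (poly_ring V)"
  unfolding carrier_poly_ring mem_Collect_eq
  by (simp_all add: keys_plus_sub keys_minus_sub keys_uminus)
     (use keys_mult_sub[of p "mons V" q "mons V" "mons V"] in \<open>auto simp: mons_add\<close>)

lemma poly_ring_sum:
  "(\<And>i. i \<in> I \<Longrightarrow> f i \<in> carrier (poly_ring V)) \<Longrightarrow> sum f I \<in> carrier (poly_ring V)"
  by (induction I rule: infinite_finite_induct) (auto intro!: poly_ring_closed)

lemma cring_poly_ring: "cring (poly_ring V :: 'k::comm_ring_1 mpoly ring)"
proof -
  have "\<exists>y\<in>carrier (poly_ring V). y + x = 0 \<and> x + y = 0"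
    if "x \<in> carrier (poly_ring V)" for x :: "'k mpoly"
    by (rule bexI[of _ "- x"]) (use that in \<open>auto intro: poly_ring_closed\<close>)
  then show ?thesis
    by (intro cringI abelian_groupI comm_monoidI)
       (auto simp: algebra_simps intro: poly_ring_closed)
qed

lemma ring_poly_ring: "ring (poly_ring V :: 'k::comm_ring_1 mpoly ring)"
  using cring_poly_ring by (rule cring.axioms(1))

lemma uminus_poly_ring:
  assumes "p \<in> carrier (poly_ring V)"
  shows "\<ominus>\<^bsub>poly_ring V\<^esub> p = - p"
proof -
  interpret cring "poly_ring V" by (rule cring_poly_ring)
  show ?thesis
    by (rule minus_equality) (use assms in \<open>auto intro: poly_ring_closed\<close>)
qed

lemma ideal_poly_ringI:
  assumes "I \<subseteq> carrier (poly_ring V)" "0 \<in> I" "\<And>p q. p \<in> I \<Longrightarrow> q \<in> I \<Longrightarrow> p + q \<in> I"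
    "\<And>p q. p \<in> I \<Longrightarrow> q \<in> carrier (poly_ring V) \<Longrightarrow> q * p \<in> I"
  shows "ideal I (poly_ring V)"
proof -
  interpret cring "poly_ring V" by (rule cring_poly_ring)
  have neg: "- p \<in> I" if "p \<in> I" for p
    using assms(4)[OF that, of "- 1"] by (auto intro: poly_ring_closed)
  show ?thesis
  proof (rule idealI[OF ring_poly_ring])
    show "subgroup I (add_monoid (poly_ring V))"
      by (rule subgroup.intro)
         (use assms neg in \<open>auto simp: subset_iff uminus_poly_ring[unfolded a_inv_def, simplified]\<close>)
  qed (use assms in \<open>auto simp: mult.commute\<close>)
qed

lemma ideal_poly_ringD:
  assumes "ideal I (poly_ring V)"
  shows "I \<subseteq> carrier (poly_ring V)" "0 \<in> I" "p \<in> I \<Longrightarrow> q \<in> I \<Longrightarrow> p + q \<in> I"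
    "p \<in> I \<Longrightarrow> q \<in> carrier (poly_ring V) \<Longrightarrow> q * p \<in> I"
    "p \<in> I \<Longrightarrow> q \<in> I \<Longrightarrow> p - q \<in> I"
proof -
  interpret ideal I "poly_ring V" by fact
  show s: "I \<subseteq> carrier (poly_ring V)" by (simp add: a_subset)
  show "0 \<in> I" using additive_subgroup.zero_closed[OF is_additive_subgroup] by simp
  show pl: "p + q \<in> I" if "p \<in> I" "q \<in> I" for p q using additive_subgroup.a_closed[OF is_additive_subgroup that] by simp
  show m: "q * p \<in> I" if "p \<in> I" "q \<in> carrier (poly_ring V)" for p q
    using I_l_closed[OF that] by simp
  show "p - q \<in> I" if "p \<in> I" "q \<in> I"
    using pl[OF that(1) m[OF that(2), of "- 1"]] by (auto intro: poly_ring_closed)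
qed

lemma ideal_of_monomials:
  assumes "\<And>m m'. m \<in> U \<Longrightarrow> m' \<in> mons V \<Longrightarrow> m + m' \<in> U"
  shows "ideal {p \<in> carrier (poly_ring V). kys p \<subseteq> U} (poly_ring V)"
proof (rule ideal_poly_ringI)
  fix p q :: "'a mpoly"
  assume p: "p \<in> {p \<in> carrier (poly_ring V). kys p \<subseteq> U}" and q: "q \<in> carrier (poly_ring V)"
  have "kys (p * q) \<subseteq> U"
    by (rule keys_mult_sub[of p U q "mons V"]) (use assms p q in \<open>auto simp: carrier_poly_ring\<close>)
  then show "q * p \<in> {p \<in> carrier (poly_ring V). kys p \<subseteq> U}"
    using p q by (auto simp: mult.commute intro: poly_ring_closed)
qed (auto simp: poly_ring_closed dest: keys_plus_sub subsetD[OF keys_add])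

lemma monomials_in_ideal:
  assumes "ideal I (poly_ring V)" "\<And>m. m \<in> U \<Longrightarrow> m \<in> mons V \<Longrightarrow> mono1 m \<in> I"
    "p \<in> carrier (poly_ring V)" "kys p \<subseteq> U"
  shows "p \<in> I"
proof -
  note I = ideal_poly_ringD[OF assms(1)]
  have "kys p \<subseteq> U \<inter> mons V" using assms by (simp add: carrier_poly_ring)
  then show ?thesis
  proof (induction p rule: term_induct)
    case (single m c)
    have "sgl 0 c * mono1 m \<in> I"
      by (rule I(4)) (use assms(2) single in \<open>auto intro: poly_ring_closed\<close>)
    then show ?case by (simp add: mult_single)
  qed (use I in auto)
qed

lemma pvar_mono: "pvar v = mono1 (sgl v 1)" by (simp add: pvar_def)

lemma pvar_closed: "v \<in> V \<Longrightarrow> pvar v \<in> carrier (poly_ring V)"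
  unfolding pvar_mono by (rule poly_ring_closed) (simp add: mons_single)

definition vmon :: "(nat \<Rightarrow> var) \<Rightarrow> nat set \<Rightarrow> var \<Rightarrow>\<^sub>0 nat" where
  "vmon g G = (\<Sum>i\<in>G. sgl (g i) 1)"

lemma prod_monomials: "(\<Prod>i\<in>G. mono1 (f i)) = mono1 (\<Sum>i\<in>G. f i)"
  by (induction G rule: infinite_finite_induct) (auto simp: mult_single)

lemma xmon_mono: "xmon G = mono1 (vmon Xv G)" and ymon_mono: "ymon G = mono1 (vmon Yv G)"
  by (simp_all add: xmon_def ymon_def pvar_mono prod_monomials vmon_def)

lemma lookup_vmon:
  assumes "finite G"
  shows "lkp (vmon Xv G) (Xv i) = (if i \<in> G then 1 else 0)" "lkp (vmon Xv G) (Yv i) = 0"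
    "lkp (vmon Yv G) (Yv i) = (if i \<in> G then 1 else 0)" "lkp (vmon Yv G) (Xv i) = 0"
    "lkp (vmon Xv G) (Zv F) = 0" "lkp (vmon Yv G) (Zv F) = 0"
  using assms by (simp_all add: vmon_def lookup_sum lookup_single when_def)

lemma vmon_closed: "g ` G \<subseteq> V \<Longrightarrow> vmon g G \<in> mons V"
  unfolding vmon_def by (induction G rule: infinite_finite_induct) (auto simp: mons_add mons_single)

lemma mon_degree_vmon: "mon_degree (vmon g G) = card G"
  by (simp add: vmon_def mon_degree_sum)

lemma le_monomial: 
  assumes "\<And>v. lkp a v \<le> lkp m v"
  shows "\<exists>c. m = a + (c :: 'a \<Rightarrow>\<^sub>0 nat)"
  by (rule exI[of _ "m - a"], rule poly_mapping_eqI) (use assms in \<open>simp add: lookup_add lookup_minus\<close>)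

section \<open>Dimension shifting along a regular sequence\<close>

text \<open>A graded free resolution $\dots \to P_1 \to P_0 = S$ of $S/I$; \<open>D i\<close> is the matrix of
  $P_{i+1} \to P_i$, and the \<open>j\<close>-th basis element of $P_i$ has degree \<open>a i j\<close>. Matrices and vectors are
  functions on all natural numbers, so that the sums range over the ranks. The columns beyond the rank
  are zero, which makes the transposed differential of a cochain vanish there.\<close>

locale graded_resolution =
  fixes V :: "var set" and I :: "'k::comm_ring_1 mpoly set"
    and r :: "nat \<Rightarrow> nat" and a :: "nat \<Rightarrow> nat \<Rightarrow> int" and D :: "nat \<Rightarrow> nat \<Rightarrow> nat \<Rightarrow> 'k mpoly"
  assumes r0: "r 0 = 1" and a0: "a 0 0 = 0"
    and D_closed: "D i j k \<in> carrier (poly_ring V)"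
    and D_homog: "j < r i \<Longrightarrow> k < r (Suc i) \<Longrightarrow> homog (a (Suc i) k - a i j) (D i j k)"
    and D_out: "r (Suc i) \<le> k \<Longrightarrow> D i j k = 0"
    and augment: "p \<in> I \<longleftrightarrow>
      (\<exists>v. (\<forall>k. v k \<in> carrier (poly_ring V)) \<and> p = (\<Sum>k<r 1. D 0 0 k * v k))"
    and DD: "(\<Sum>k<r (Suc i). D i j k * D (Suc i) k l) = 0"
    and exact: "(\<And>k. v k \<in> carrier (poly_ring V)) \<Longrightarrow>
      (\<And>j. j < r i \<Longrightarrow> (\<Sum>k<r (Suc i). D i j k * v k) = 0) \<Longrightarrow>
      \<exists>u. (\<forall>l. u l \<in> carrier (poly_ring V)) \<and>
          (\<forall>k<r (Suc i). v k = (\<Sum>l<r (Suc (Suc i)). D (Suc i) k l * u l))"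
begin

abbreviation C :: "'k mpoly set" where "C \<equiv> carrier (poly_ring V)"

lemmas C_closed = poly_ring_closed[where V = V] poly_ring_sum[where V = V]

text \<open>Replacing the entries of a lift by their homogeneous components keeps it a lift, since the
  matrices are homogeneous.\<close>

lemma exact_homog:
  assumes v: "\<And>k. v k \<in> C" and cyc: "\<And>j. j < r i \<Longrightarrow> (\<Sum>k<r (Suc i). D i j k * v k) = 0"
    and hv: "\<And>k. k < r (Suc i) \<Longrightarrow> homog (e - a (Suc i) k) (v k)"
  shows "\<exists>u. (\<forall>l. u l \<in> C) \<and> (\<forall>l<r (Suc (Suc i)). homog (e - a (Suc (Suc i)) l) (u l)) \<and>
    (\<forall>k<r (Suc i). v k = (\<Sum>l<r (Suc (Suc i)). D (Suc i) k l * u l))"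
proof -
  obtain u where u: "\<And>l. u l \<in> C"
    and vu: "\<And>k. k < r (Suc i) \<Longrightarrow> v k = (\<Sum>l<r (Suc (Suc i)). D (Suc i) k l * u l)"
    using exact[OF v cyc] by auto
  define u' where "u' l = hcomp (e - a (Suc (Suc i)) l) (u l)" for l
  have "v k = (\<Sum>l<r (Suc (Suc i)). D (Suc i) k l * u' l)" if k: "k < r (Suc i)" for k
  proof -
    have "v k = hcomp (e - a (Suc i) k) (v k)" using hv[OF k] by (simp add: hcomp_homog)
    also have "\<dots> = (\<Sum>l<r (Suc (Suc i)). hcomp (e - a (Suc i) k) (D (Suc i) k l * u l))"
      by (subst vu[OF k]) (rule hcomp_sum)
    also have "\<dots> = (\<Sum>l<r (Suc (Suc i)). D (Suc i) k l * u' l)"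
    proof (rule sum.cong[OF refl])
      fix l assume "l \<in> {..<r (Suc (Suc i))}"
      then have "homog (a (Suc (Suc i)) l - a (Suc i) k) (D (Suc i) k l)"
        using k by (intro D_homog) auto
      from hcomp_mult_homog[OF this, of "e - a (Suc (Suc i)) l" "u l"]
      show "hcomp (e - a (Suc i) k) (D (Suc i) k l * u l) = D (Suc i) k l * u' l"
        by (simp add: u'_def)
    qed
    finally show ?thesis .
  qed
  moreover have "u' l \<in> C" for l
    using u[of l] keys_hcomp[of _ "u l"] by (auto simp: u'_def carrier_poly_ring)
  ultimately show ?thesis
    by (intro exI[of _ u']) (auto simp: u'_def homog_hcomp)
qed

lemma augment_homog:
  assumes p: "p \<in> I" "homog e p"
  shows "\<exists>v. (\<forall>k. v k \<in> C) \<and> (\<forall>k<r 1. homog (e - a 1 k) (v k)) \<and> p = (\<Sum>k<r 1. D 0 0 k * v k)"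
proof -
  obtain v where v: "\<And>k. v k \<in> C" and pv: "p = (\<Sum>k<r 1. D 0 0 k * v k)"
    using p(1) augment by auto
  define v' where "v' k = hcomp (e - a 1 k) (v k)" for k
  have "p = hcomp e p" using p(2) by (simp add: hcomp_homog)
  also have "\<dots> = (\<Sum>k<r 1. hcomp e (D 0 0 k * v k))"
    by (subst pv) (rule hcomp_sum)
  also have "\<dots> = (\<Sum>k<r 1. D 0 0 k * v' k)"
  proof (rule sum.cong[OF refl])
    fix k assume "k \<in> {..<r 1}"
    then have "homog (a 1 k) (D 0 0 k)"
      using D_homog[of 0 0 k] by (simp add: r0 a0)
    from hcomp_mult_homog[OF this, of "e - a 1 k" "v k"]
    show "hcomp e (D 0 0 k * v k) = D 0 0 k * v' k"
      by (simp add: v'_def)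
  qed
  finally have "p = (\<Sum>k<r 1. D 0 0 k * v' k)" .
  moreover have "v' k \<in> C" for k
    using v[of k] keys_hcomp[of _ "v k"] by (auto simp: v'_def carrier_poly_ring)
  ultimately show ?thesis
    by (intro exI[of _ v']) (auto simp: v'_def homog_hcomp)
qed

text \<open>Multiplication by \<open>g \<in> I\<close> is zero on $S/I$, so on the resolution it is homotopic to zero.\<close>

definition null_homotopy :: "'k mpoly \<Rightarrow> int \<Rightarrow> (nat \<Rightarrow> nat \<Rightarrow> nat \<Rightarrow> 'k mpoly) \<Rightarrow> bool" where
  "null_homotopy g \<delta> h \<longleftrightarrow>
     (\<forall>i k j. h i k j \<in> C) \<and>
     (\<forall>i. \<forall>k<r (Suc i). \<forall>j<r i. homog (a i j + \<delta> - a (Suc i) k) (h i k j)) \<and>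
     (\<Sum>k<r 1. D 0 0 k * h 0 k 0) = g \<and>
     (\<forall>i. \<forall>k<r (Suc i). \<forall>k'<r (Suc i).
        (\<Sum>l<r (Suc (Suc i)). D (Suc i) k l * h (Suc i) l k') + (\<Sum>j<r i. h i k j * D i j k') =
        (if k = k' then g else 0))"

lemma sum_delta_mult: "k' < (m::nat) \<Longrightarrow> (\<Sum>k<m. f k * (if k = k' then g else 0)) = f k' * (g::'k mpoly)"
proof -
  assume "k' < m"
  have "(\<Sum>k<m. f k * (if k = k' then g else 0)) = (\<Sum>k<m. if k' = k then f k * g else 0)"
    by (rule sum.cong) auto
  then show ?thesis using \<open>k' < m\<close> by simp
qed

lemma null_homotopy_exists:
  assumes g: "g \<in> I" "g \<in> C" "homog \<delta> g"
  shows "\<exists>h. null_homotopy g \<delta> h"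
proof -
  define ok where "ok i h \<longleftrightarrow> (\<forall>k j. h k j \<in> C) \<and>
      (\<forall>k<r (Suc i). \<forall>j<r i. homog (a i j + \<delta> - a (Suc i) k) (h k j)) \<and>
      (i = 0 \<longrightarrow> (\<Sum>k<r 1. D 0 0 k * h k 0) = g) \<and>
      (\<forall>j<r i. \<forall>k'<r (Suc i).
         (\<Sum>k<r (Suc i). D i j k * ((if k = k' then g else 0) - (\<Sum>j'<r i. h k j' * D i j' k'))) = 0)"
    for i and h :: "nat \<Rightarrow> nat \<Rightarrow> 'k mpoly"
  define nxt where "nxt i h h' \<longleftrightarrow> (\<forall>k<r (Suc i). \<forall>k'<r (Suc i).
        (\<Sum>l<r (Suc (Suc i)). D (Suc i) k l * h' l k') + (\<Sum>j<r i. h k j * D i j k') =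
        (if k = k' then g else 0))" for i and h h' :: "nat \<Rightarrow> nat \<Rightarrow> 'k mpoly"
  have "\<exists>h. \<forall>i. ok i (h i) \<and> nxt i (h i) (h (Suc i))"
  proof (rule dependent_nat_choice)
    obtain v where v: "\<And>k. v k \<in> C" "\<And>k. k < r 1 \<Longrightarrow> homog (\<delta> - a 1 k) (v k)"
      and gv: "g = (\<Sum>k<r 1. D 0 0 k * v k)"
      using augment_homog[OF g(1,3)] by auto
    have "(\<Sum>k<r 1. D 0 0 k * ((if k = k' then g else 0) - v k * D 0 0 k')) = 0"
      if "k' < r 1" for k'
    proof -
      have "(\<Sum>k<r 1. D 0 0 k * ((if k = k' then g else 0) - v k * D 0 0 k'))
          = (\<Sum>k<r 1. D 0 0 k * (if k = k' then g else 0)) - (\<Sum>k<r 1. D 0 0 k * v k) * D 0 0 k'"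
        by (simp add: right_diff_distrib sum_subtractf sum_distrib_right mult.assoc)
      then show ?thesis using that by (simp only: sum_delta_mult gv[symmetric]) simp
    qed
    then have "ok 0 (\<lambda>k j. v k)"
      using v gv by (auto simp: ok_def r0 a0)
    then show "\<exists>h. ok 0 h" by blast
  next
    fix h i assume h: "ok i h"
    have *: "\<exists>u. (\<forall>l. u l \<in> C) \<and>
        (\<forall>l<r (Suc (Suc i)). homog ((a (Suc i) k' + \<delta>) - a (Suc (Suc i)) l) (u l)) \<and>
        (\<forall>k<r (Suc i). (if k = k' then g else 0) - (\<Sum>j'<r i. h k j' * D i j' k') =
            (\<Sum>l<r (Suc (Suc i)). D (Suc i) k l * u l))" if k': "k' < r (Suc i)" for k'
    proof (rule exact_homog[where e = "a (Suc i) k' + \<delta>"])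
      show "(if k = k' then g else 0) - (\<Sum>j'<r i. h k j' * D i j' k') \<in> C" for k
        using h g(2) by (intro C_closed) (auto simp: ok_def intro!: C_closed D_closed)
    next
      fix k assume k: "k < r (Suc i)"
      have "homog (a (Suc i) k' + \<delta> - a (Suc i) k) (h k j' * D i j' k')" if "j' < r i" for j'
      proof -
        have "homog (a i j' + \<delta> - a (Suc i) k) (h k j')" using h k that by (simp add: ok_def)
        from homog_mult[OF this D_homog[OF that k']] show ?thesis by (simp add: algebra_simps)
      qed
      then show "homog (a (Suc i) k' + \<delta> - a (Suc i) k)
          ((if k = k' then g else 0) - (\<Sum>j'<r i. h k j' * D i j' k'))"
        using g(3) by (intro homog_diff homog_sum) auto
    qed (use h k' in \<open>auto simp: ok_def\<close>)
    define u where "u k' = (SOME u. (\<forall>l. u l \<in> C) \<and>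
        (\<forall>l<r (Suc (Suc i)). homog ((a (Suc i) k' + \<delta>) - a (Suc (Suc i)) l) (u l)) \<and>
        (\<forall>k<r (Suc i). (if k = k' then g else 0) - (\<Sum>j'<r i. h k j' * D i j' k') =
            (\<Sum>l<r (Suc (Suc i)). D (Suc i) k l * u l)))" for k'
    note u = someI_ex[OF *, folded u_def]
    define h' where "h' l k' = (if k' < r (Suc i) then u k' l else 0)" for l k'
    have n: "(\<Sum>l<r (Suc (Suc i)). D (Suc i) k l * h' l k') =
        (if k = k' then g else 0) - (\<Sum>j<r i. h k j * D i j k')"
      if "k < r (Suc i)" "k' < r (Suc i)" for k k'
      using u[OF that(2)] that by (simp add: h'_def)
    then have "nxt i h h'" by (simp add: nxt_def)
    have "(\<Sum>l<r (Suc (Suc i)). D (Suc i) k l *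
        ((if l = l' then g else 0) - (\<Sum>k'<r (Suc i). h' l k' * D (Suc i) k' l'))) = 0"
      if k: "k < r (Suc i)" and l': "l' < r (Suc (Suc i))" for k l'
    proof -
      have "(\<Sum>l<r (Suc (Suc i)). D (Suc i) k l * (\<Sum>k'<r (Suc i). h' l k' * D (Suc i) k' l'))
          = (\<Sum>l<r (Suc (Suc i)). \<Sum>k'<r (Suc i). D (Suc i) k l * h' l k' * D (Suc i) k' l')"
        by (simp add: sum_distrib_left mult.assoc)
      also have "\<dots> = (\<Sum>k'<r (Suc i). (\<Sum>l<r (Suc (Suc i)). D (Suc i) k l * h' l k') * D (Suc i) k' l')"
        by (subst sum.swap) (simp add: sum_distrib_right)
      also have "\<dots> = (\<Sum>k'<r (Suc i). ((if k = k' then g else 0) - (\<Sum>j<r i. h k j * D i j k')) * D (Suc i) k' l')"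
        by (rule sum.cong) (simp_all add: n k)
      also have "\<dots> = (\<Sum>k'<r (Suc i). D (Suc i) k' l' * (if k' = k then g else 0))
          - (\<Sum>k'<r (Suc i). \<Sum>j<r i. h k j * D i j k' * D (Suc i) k' l')"
        by (simp only: left_diff_distrib sum_subtractf sum_distrib_right)
           (simp add: mult.commute eq_commute)
      also have "(\<Sum>k'<r (Suc i). \<Sum>j<r i. h k j * D i j k' * D (Suc i) k' l') =
          (\<Sum>j<r i. h k j * (\<Sum>k'<r (Suc i). D i j k' * D (Suc i) k' l'))"
        by (subst sum.swap) (simp add: sum_distrib_left mult.assoc)
      finally show ?thesis
        using k l' by (simp add: right_diff_distrib sum_subtractf sum_delta_mult DD)
    qed
    then have "ok (Suc i) h'"
      using u by (simp add: ok_def h'_def C_closed(1))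
    with \<open>nxt i h h'\<close> show "\<exists>h'. ok (Suc i) h' \<and> nxt i h h'" by blast
  qed
  then obtain h where "\<forall>i. ok i (h i) \<and> nxt i (h i) (h (Suc i))" by blast
  then have "null_homotopy g \<delta> h"
    by (auto simp: null_homotopy_def ok_def nxt_def)
  then show ?thesis by blast
qed

definition dT :: "nat \<Rightarrow> (nat \<Rightarrow> 'k mpoly) \<Rightarrow> nat \<Rightarrow> 'k mpoly" where
  "dT i w k = (\<Sum>j<r i. D i j k * w j)"

text \<open>The transpose of a homotopy maps \<open>(Suc i)\<close>-cochains to \<open>i\<close>-cochains.\<close>

definition hT :: "(nat \<Rightarrow> nat \<Rightarrow> nat \<Rightarrow> 'k mpoly) \<Rightarrow> nat \<Rightarrow> (nat \<Rightarrow> 'k mpoly) \<Rightarrow> nat \<Rightarrow> 'k mpoly" where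
  "hT h i w j = (\<Sum>k<r (Suc i). h i k j * w k)"

lemma dT_add: "dT i (\<lambda>j. w j + w' j) k = dT i w k + dT i w' k"
  and dT_diff: "dT i (\<lambda>j. w j - w' j) k = dT i w k - dT i w' k"
  and dT_smult: "dT i (\<lambda>j. c * w j) k = c * dT i w k"
  by (simp_all add: dT_def distrib_left right_diff_distrib sum.distrib sum_subtractf
      sum_distrib_left mult.left_commute)

lemma hT_add: "hT h i (\<lambda>j. w j + w' j) k = hT h i w k + hT h i w' k"
  and hT_diff: "hT h i (\<lambda>j. w j - w' j) k = hT h i w k - hT h i w' k"
  and hT_smult: "hT h i (\<lambda>j. c * w j) k = c * hT h i w k"
  by (simp_all add: hT_def distrib_left right_diff_distrib sum.distrib sum_subtractf
      sum_distrib_left mult.left_commute)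

lemma dT_closed: "(\<And>j. w j \<in> C) \<Longrightarrow> dT i w k \<in> C"
  unfolding dT_def by (intro C_closed D_closed) auto

lemma hT_closed: "null_homotopy g \<delta> h \<Longrightarrow> (\<And>j. w j \<in> C) \<Longrightarrow> hT h i w k \<in> C"
  unfolding hT_def by (intro C_closed) (auto simp: null_homotopy_def)

lemma dT_dT: "dT (Suc i) (dT i w) l = 0"
proof -
  have "dT (Suc i) (dT i w) l = (\<Sum>k<r (Suc i). \<Sum>j<r i. D i j k * D (Suc i) k l * w j)"
    by (simp add: dT_def sum_distrib_left mult_ac)
  also have "\<dots> = (\<Sum>j<r i. (\<Sum>k<r (Suc i). D i j k * D (Suc i) k l) * w j)"
    by (subst sum.swap) (simp add: sum_distrib_right)
  finally show ?thesis by (simp add: DD)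
qed

lemma homotopy_Suc:
  assumes h: "null_homotopy g \<delta> h" and k': "k' < r (Suc i)"
  shows "hT h (Suc i) (dT (Suc i) w) k' + dT i (hT h i w) k' = g * w k'"
proof -
  have "hT h (Suc i) (dT (Suc i) w) k' =
      (\<Sum>l<r (Suc (Suc i)). \<Sum>k<r (Suc i). w k * (D (Suc i) k l * h (Suc i) l k'))"
    by (simp add: hT_def dT_def sum_distrib_left mult_ac)
  also have "\<dots> = (\<Sum>k<r (Suc i). w k * (\<Sum>l<r (Suc (Suc i)). D (Suc i) k l * h (Suc i) l k'))"
    by (subst sum.swap) (simp add: sum_distrib_left)
  finally have 1: "hT h (Suc i) (dT (Suc i) w) k' = \<dots>" .
  have "dT i (hT h i w) k' = (\<Sum>j<r i. \<Sum>k<r (Suc i). w k * (h i k j * D i j k'))"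
    by (simp add: hT_def dT_def sum_distrib_left mult_ac)
  also have "\<dots> = (\<Sum>k<r (Suc i). w k * (\<Sum>j<r i. h i k j * D i j k'))"
    by (subst sum.swap) (simp add: sum_distrib_left)
  finally have "hT h (Suc i) (dT (Suc i) w) k' + dT i (hT h i w) k' =
    (\<Sum>k<r (Suc i). w k * ((\<Sum>l<r (Suc (Suc i)). D (Suc i) k l * h (Suc i) l k') +
      (\<Sum>j<r i. h i k j * D i j k')))"
    unfolding 1 by (simp add: sum.distrib distrib_left)
  also have "\<dots> = (\<Sum>k<r (Suc i). w k * (if k = k' then g else 0))"
    by (rule sum.cong) (use h k' in \<open>auto simp: null_homotopy_def\<close>)
  finally show ?thesis using k' by (simp add: sum_delta_mult mult.commute)
qed

lemma homotopy_0:
  assumes h: "null_homotopy g \<delta> h"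
  shows "hT h 0 (dT 0 w) 0 = g * w 0"
proof -
  have "hT h 0 (dT 0 w) 0 = (\<Sum>k<r 1. D 0 0 k * h 0 k 0) * w 0"
    by (simp add: hT_def dT_def r0 sum_distrib_left sum_distrib_right mult_ac)
  then show ?thesis using h by (simp add: null_homotopy_def)
qed

subsection \<open>Cohomology modulo an ideal\<close>

text \<open>Cocycles and coboundaries of the dual complex with coefficients in $S/A$, represented by
  vectors over $S$; \<open>bd i\<close> is the differential that ends in degree \<open>i\<close>.\<close>

definition bd :: "nat \<Rightarrow> (nat \<Rightarrow> 'k mpoly) \<Rightarrow> nat \<Rightarrow> 'k mpoly" where
  "bd i u j = (case i of 0 \<Rightarrow> 0 | Suc i' \<Rightarrow> dT i' u j)"

definition cocycle :: "'k mpoly set \<Rightarrow> nat \<Rightarrow> (nat \<Rightarrow> 'k mpoly) \<Rightarrow> bool" where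
  "cocycle A i w \<longleftrightarrow> (\<forall>j. w j \<in> C) \<and> (\<forall>k. dT i w k \<in> A)"

definition cobound :: "'k mpoly set \<Rightarrow> nat \<Rightarrow> (nat \<Rightarrow> 'k mpoly) \<Rightarrow> bool" where
  "cobound A i w \<longleftrightarrow> (\<exists>u. (\<forall>j. u j \<in> C) \<and> (\<forall>j<r i. w j - bd i u j \<in> A))"

lemma bd_simps [simp]: "bd 0 u j = 0" "bd (Suc i) u j = dT i u j"
  by (simp_all add: bd_def)

lemma dT_bd: "dT i (bd i u) k = 0"
proof (cases i)
  case 0
  then show ?thesis by (simp add: dT_def)
next
  case (Suc i')
  then have "bd i u = dT i' u" by (simp add: fun_eq_iff)
  then show ?thesis using Suc by (simp add: dT_dT)
qed

lemma bd_lin: "bd i (\<lambda>j. w j + w' j) k = bd i w k + bd i w' k"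
   "bd i (\<lambda>j. w j - w' j) k = bd i w k - bd i w' k"
   "bd i (\<lambda>j. c * w j) k = c * bd i w k"
  by (cases i; simp add: dT_add dT_diff dT_smult)+

lemma bd_closed: "(\<And>j. w j \<in> C) \<Longrightarrow> bd i w k \<in> C"
  by (cases i) (auto intro: dT_closed C_closed)

lemma cobound_lin:
  assumes A: "ideal A (poly_ring V)" and w: "cobound A i w"
  shows "cobound A i w' \<Longrightarrow> cobound A i (\<lambda>j. w j + w' j)"
    "cobound A i w' \<Longrightarrow> cobound A i (\<lambda>j. w j - w' j)"
    "c \<in> C \<Longrightarrow> cobound A i (\<lambda>j. c * w j)"
proof -
  note I = ideal_poly_ringD[OF A]
  obtain u where u: "\<And>j. u j \<in> C" "\<And>j. j < r i \<Longrightarrow> w j - bd i u j \<in> A"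
    using w by (auto simp: cobound_def)
  {
    assume "cobound A i w'"
    then obtain u' where u': "\<And>j. u' j \<in> C" "\<And>j. j < r i \<Longrightarrow> w' j - bd i u' j \<in> A"
      by (auto simp: cobound_def)
    show "cobound A i (\<lambda>j. w j + w' j)"
      unfolding cobound_def
      by (intro exI[of _ "\<lambda>j. u j + u' j"])
         (use u u' I(3)[OF u(2) u'(2)] in \<open>auto simp: bd_lin C_closed algebra_simps\<close>)
    show "cobound A i (\<lambda>j. w j - w' j)"
      unfolding cobound_def
      by (intro exI[of _ "\<lambda>j. u j - u' j"])
         (use u u' I(5)[OF u(2) u'(2)] in \<open>auto simp: bd_lin C_closed algebra_simps\<close>)
  }
  show "cobound A i (\<lambda>j. c * w j)" if "c \<in> C"
    unfolding cobound_def
    by (intro exI[of _ "\<lambda>j. c * u j"])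
       (use u that I(4)[OF u(2) that] in \<open>auto simp: bd_lin C_closed right_diff_distrib\<close>)
qed

lemma ideal_sum:
  assumes "ideal A (poly_ring V)" "\<And>i. i \<in> J \<Longrightarrow> f i \<in> A"
  shows "sum f J \<in> A"
  using assms(2) ideal_poly_ringD[OF assms(1)]
  by (induction J rule: infinite_finite_induct) auto

lemma dT_ideal:
  assumes "ideal A (poly_ring V)" "\<And>j. j < r i \<Longrightarrow> w j \<in> A"
  shows "dT i w k \<in> A"
  unfolding dT_def
  by (rule ideal_sum[OF assms(1)]) (use ideal_poly_ringD(4)[OF assms(1)] assms(2) D_closed in auto)

lemma hT_ideal:
  assumes "ideal A (poly_ring V)" "null_homotopy g \<delta> h" "\<And>j. j < r (Suc i) \<Longrightarrow> w j \<in> A"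
  shows "hT h i w k \<in> A"
  unfolding hT_def
  by (rule ideal_sum[OF assms(1)])
     (use ideal_poly_ringD(4)[OF assms(1)] assms(2,3) in \<open>auto simp: null_homotopy_def\<close>)

lemma dT_out: "r (Suc i) \<le> k \<Longrightarrow> dT i w k = 0"
  by (simp add: dT_def D_out)

text \<open>The differentials and the shifts are homogeneous, so they commute with taking homogeneous
  components.\<close>

lemma hT_hcomp:
  assumes h: "null_homotopy g \<delta> h" and j: "j < r i"
  shows "hT h i (\<lambda>k. hcomp (a (Suc i) k + e) (w k)) j = hcomp (a i j + (e + \<delta>)) (hT h i w j)"
  unfolding hT_def hcomp_sum
proof (rule sum.cong[OF refl])
  fix k assume "k \<in> {..<r (Suc i)}"
  then have "homog (a i j + \<delta> - a (Suc i) k) (h i k j)"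
    using h j by (auto simp: null_homotopy_def)
  from hcomp_mult_homog[OF this, of "a (Suc i) k + e" "w k"]
  show "h i k j * hcomp (a (Suc i) k + e) (w k) = hcomp (a i j + (e + \<delta>)) (h i k j * w k)"
    by (simp add: algebra_simps)
qed

lemma dT_hcomp:
  assumes k: "k < r (Suc i)"
  shows "dT i (\<lambda>j. hcomp (a i j + e) (w j)) k = hcomp (a (Suc i) k + e) (dT i w k)"
  unfolding dT_def hcomp_sum
proof (rule sum.cong[OF refl])
  fix j assume "j \<in> {..<r i}"
  then have "homog (a (Suc i) k - a i j) (D i j k)" using D_homog k by simp
  from hcomp_mult_homog[OF this, of "a i j + e" "w j"]
  show "D i j k * hcomp (a i j + e) (w j) = hcomp (a (Suc i) k + e) (D i j k * w j)"
    by (simp add: algebra_simps)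
qed

lemma cocycle_hcomp:
  assumes "cocycle {0} i w"
  shows "cocycle {0} i (\<lambda>j. hcomp (a i j + e) (w j))"
  unfolding cocycle_def
proof (intro conjI allI)
  fix j show "hcomp (a i j + e) (w j) \<in> C"
    using assms keys_hcomp[of _ "w j"] by (fastforce simp: cocycle_def carrier_poly_ring)
next
  fix k show "dT i (\<lambda>j. hcomp (a i j + e) (w j)) k \<in> {0}"
    using assms dT_hcomp[of k i e w] dT_out[of i k] by (cases "k < r (Suc i)") (auto simp: cocycle_def)
qed

end

text \<open>The situation of Rees's lemma: \<open>g 0\<close>, \<open>g 1\<close>, \dots is a regular sequence in \<open>I\<close>, with \<open>A k\<close> the
  ideal generated by its first \<open>k\<close> elements when \<open>A 0\<close> is zero. The elements have the common degree
  \<open>\<delta>\<close>, so that every step shifts the grading alike.\<close>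

locale regular_chain = graded_resolution +
  fixes g :: "nat \<Rightarrow> 'a mpoly" and A :: "nat \<Rightarrow> 'a mpoly set" and N :: nat and \<delta> :: int
  assumes A_ideal: "ideal (A k) (poly_ring V)"
    and A_Suc: "k < N \<Longrightarrow> x \<in> A (Suc k) \<longleftrightarrow> (\<exists>c\<in>carrier (poly_ring V). x - g k * c \<in> A k)"
    and reg: "k < N \<Longrightarrow> c \<in> carrier (poly_ring V) \<Longrightarrow> g k * c \<in> A k \<Longrightarrow> c \<in> A k"
    and g_I: "k < N \<Longrightarrow> g k \<in> I" and g_C: "k < N \<Longrightarrow> g k \<in> carrier (poly_ring V)"
    and g_homog: "k < N \<Longrightarrow> homog \<delta> (g k)"
begin

lemmas AI = ideal_poly_ringD[OF A_ideal]

text \<open>The exact sequence $0 \to S/A_k \to S/A_k \to S/A_{k+1} \to 0$, whose first map is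
  multiplication by $g_k$, has a connecting homomorphism from the \<open>i\<close>-th cohomology modulo $A_{k+1}$ to
  the cohomology in degree $i+1$ modulo $A_k$. It maps the class of \<open>v\<close> to that of \<open>w\<close> if
  $D^T v \equiv g_k w$ modulo $A_k$. The lemmas below show that the transpose $h^T$ of a null-homotopy
  of $g_k$ is its inverse in the degrees where the neighbouring cohomology vanishes: the homotopy
  relation gives $D^T h^T w \equiv g_k w$ for every cocycle \<open>w\<close> modulo $A_k$.\<close>

lemma cobound_SucI:
  assumes "k < N" "cobound (A k) i (\<lambda>j. u j - g k * c j)" "\<And>j. c j \<in> C"
  shows "cobound (A (Suc k)) i u"
proof -
  obtain u' where u': "\<And>j. u' j \<in> C" "\<And>j. j < r i \<Longrightarrow> u j - g k * c j - bd i u' j \<in> A k"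
    using assms(2) by (auto simp: cobound_def)
  show ?thesis
    unfolding cobound_def
    by (intro exI[of _ u'])
       (use u' assms in \<open>auto simp: A_Suc algebra_simps intro!: bexI[of _ "c _"]\<close>)
qed

lemma cobound_SucD:
  assumes k: "k < N" and u: "cobound (A (Suc k)) i u"
  shows "\<exists>c. (\<forall>j. c j \<in> C) \<and> (\<forall>l. dT i u l - g k * dT i c l \<in> A k)"
proof -
  obtain u' where u': "\<And>j. u' j \<in> C" "\<And>j. j < r i \<Longrightarrow> u j - bd i u' j \<in> A (Suc k)"
    using u by (auto simp: cobound_def)
  then have "\<forall>j. \<exists>c\<in>C. j < r i \<longrightarrow> u j - bd i u' j - g k * c \<in> A k"
    using A_Suc[OF k] C_closed(1) by blast
  then obtain c where c: "\<And>j. c j \<in> C" "\<And>j. j < r i \<Longrightarrow> u j - bd i u' j - g k * c j \<in> A k"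
    by metis
  have "dT i (\<lambda>j. u j - bd i u' j - g k * c j) l \<in> A k" for l
    by (rule dT_ideal[OF A_ideal c(2)])
  then show ?thesis
    using c(1) by (intro exI[of _ c]) (auto simp: dT_diff dT_smult dT_bd)
qed

lemma shift_mod:
  assumes k: "k < N" and h: "null_homotopy (g k) \<delta> h" and w: "cocycle (A k) (Suc i) w"
  shows "l < r (Suc i) \<Longrightarrow> g k * w l - dT i (hT h i w) l \<in> A k"
    and "cocycle (A (Suc k)) i (hT h i w)"
proof -
  have *: "g k * w l - dT i (hT h i w) l \<in> A k" if l: "l < r (Suc i)" for l
  proof -
    have "g k * w l - dT i (hT h i w) l = hT h (Suc i) (dT (Suc i) w) l"
      by (simp add: homotopy_Suc[OF h l, of w, symmetric])
    also have "\<dots> \<in> A k"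
      by (rule hT_ideal[OF A_ideal h]) (use w in \<open>auto simp: cocycle_def\<close>)
    finally show ?thesis .
  qed
  then show "l < r (Suc i) \<Longrightarrow> g k * w l - dT i (hT h i w) l \<in> A k" .
  have wC: "w j \<in> C" for j using w by (simp add: cocycle_def)
  have "dT i (hT h i w) l \<in> A (Suc k)" for l
  proof (cases "l < r (Suc i)")
    case True
    have "0 - (g k * w l - dT i (hT h i w) l) \<in> A k"
      by (rule AI(5)[OF AI(2) *[OF True]])
    then show ?thesis using k wC by (auto simp: A_Suc intro!: bexI[of _ "w l"])
  next
    case False
    then show ?thesis by (simp add: dT_out AI(2))
  qed
  then show "cocycle (A (Suc k)) i (hT h i w)"
    by (simp add: cocycle_def hT_closed[OF h] wC)
qed

lemma homotopy: "k < N \<Longrightarrow> \<exists>h. null_homotopy (g k) \<delta> h"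
  by (rule null_homotopy_exists) (simp_all add: g_I g_C g_homog)

text \<open>Below the grade of \<open>I\<close> modulo \<open>A k\<close> the cohomology vanishes: on it the regular element \<open>g k\<close> acts
  injectively, as the cohomology one degree lower modulo \<open>A (Suc k)\<close> vanishes, but also as zero.\<close>

lemma vanishing:
  assumes "i + k < N" "cocycle (A k) i w"
  shows "cobound (A k) i w"
  using assms
proof (induction i arbitrary: k w)
  case 0
  then have k: "k < N" by simp
  obtain h where h: "null_homotopy (g k) \<delta> h" using homotopy[OF k] by blast
  have "g k * w 0 \<in> A k"
    unfolding homotopy_0[OF h, symmetric]
    by (rule hT_ideal[OF A_ideal h]) (use 0 in \<open>auto simp: cocycle_def\<close>)
  then have "w 0 \<in> A k" using reg[OF k] 0 by (auto simp: cocycle_def)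
  then show ?case
    unfolding cobound_def by (intro exI[of _ "\<lambda>_. 0"]) (auto simp: r0 C_closed)
next
  case (Suc i)
  then have k: "k < N" by simp
  obtain h where h: "null_homotopy (g k) \<delta> h" using homotopy[OF k] by blast
  note sh = shift_mod[OF k h Suc.prems(2)]
  have "cobound (A (Suc k)) i (hT h i w)"
    by (rule Suc.IH[OF _ sh(2)]) (use Suc.prems in simp)
  from cobound_SucD[OF k this] obtain c where c: "\<And>j. c j \<in> C"
    "\<And>l. dT i (hT h i w) l - g k * dT i c l \<in> A k" by blast
  have "w l - dT i c l \<in> A k" if l: "l < r (Suc i)" for l
  proof (rule reg[OF k])
    show "w l - dT i c l \<in> C"
      using Suc.prems(2) c(1) by (auto simp: cocycle_def intro!: C_closed dT_closed)
    from AI(3)[OF sh(1)[OF l] c(2)[of l]] show "g k * (w l - dT i c l) \<in> A k"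
      by (simp add: algebra_simps)
  qed
  then show ?case
    unfolding cobound_def using c(1) by (intro exI[of _ c]) auto
qed

text \<open>If $h^T w$ is a coboundary modulo $A_{k+1}$, then $g_k w$ is congruent to $g_k$ times a
  coboundary, and $g_k$ can be cancelled. Conversely, if \<open>w\<close> is congruent to $D^T c$, then
  $h^T w - g_k c$ is a cocycle modulo $A_k$, hence a coboundary by \<open>vanishing\<close>.\<close>

lemma shift_cobound:
  assumes ik: "i + k < N" and h: "null_homotopy (g k) \<delta> h" and w: "cocycle (A k) (Suc i) w"
  shows "cobound (A (Suc k)) i (hT h i w) \<longleftrightarrow> cobound (A k) (Suc i) w"
proof
  have k: "k < N" using ik by simp
  note sh = shift_mod[OF k h w]
  have wC: "w j \<in> C" for j using w by (simp add: cocycle_def)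
  {
    assume "cobound (A (Suc k)) i (hT h i w)"
    from cobound_SucD[OF k this] obtain c where c: "\<And>j. c j \<in> C"
      "\<And>l. dT i (hT h i w) l - g k * dT i c l \<in> A k" by blast
    have "w l - dT i c l \<in> A k" if l: "l < r (Suc i)" for l
    proof (rule reg[OF k])
      show "w l - dT i c l \<in> C"
        using wC c(1) by (auto intro!: C_closed dT_closed)
      from AI(3)[OF sh(1)[OF l] c(2)[of l]] show "g k * (w l - dT i c l) \<in> A k"
        by (simp add: algebra_simps)
    qed
    then show "cobound (A k) (Suc i) w"
      unfolding cobound_def using c(1) by (intro exI[of _ c]) auto
  }
  assume "cobound (A k) (Suc i) w"
  then obtain c where c: "\<And>j. c j \<in> C" "\<And>l. l < r (Suc i) \<Longrightarrow> w l - dT i c l \<in> A k"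
    by (auto simp: cobound_def)
  have "dT i (\<lambda>j. hT h i w j - g k * c j) l \<in> A k" for l
  proof (cases "l < r (Suc i)")
    case True
    have "g k * (w l - dT i c l) - (g k * w l - dT i (hT h i w) l) \<in> A k"
      by (rule AI(5)[OF AI(4)[OF c(2)[OF True] g_C[OF k]] sh(1)[OF True]])
    then show ?thesis by (simp add: dT_diff dT_smult) (simp add: algebra_simps)
  qed (simp add: dT_out AI(2))
  then have "cocycle (A k) i (\<lambda>j. hT h i w j - g k * c j)"
    using c(1) g_C[OF k] wC by (auto simp: cocycle_def intro!: C_closed hT_closed[OF h])
  from cobound_SucI[OF k vanishing[OF ik this] c(1)]
  show "cobound (A (Suc k)) i (hT h i w)" .
qed

text \<open>The preimage of \<open>v\<close> is its image \<open>w\<close> under the connecting homomorphism: the difference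
  $v - h^T w$ is a cocycle even modulo $A_k$, where the cohomology vanishes.\<close>

lemma shift_surj:
  assumes ik: "i + k < N" and h: "null_homotopy (g k) \<delta> h" and v: "cocycle (A (Suc k)) i v"
  shows "\<exists>w. cocycle (A k) (Suc i) w \<and> cobound (A (Suc k)) i (\<lambda>j. v j - hT h i w j)"
proof -
  have k: "k < N" using ik by simp
  have "\<forall>l. \<exists>c\<in>C. dT i v l - g k * c \<in> A k"
    using v A_Suc[OF k] by (auto simp: cocycle_def)
  then obtain w where w: "\<And>l. w l \<in> C" "\<And>l. dT i v l - g k * w l \<in> A k"
    by metis
  have vC: "v j \<in> C" for j using v by (simp add: cocycle_def)
  have cw: "cocycle (A k) (Suc i) w"
    unfolding cocycle_def
  proof (intro conjI allI w(1))
    fix l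
    have "dT (Suc i) (\<lambda>l. dT i v l - g k * w l) l \<in> A k"
      by (rule dT_ideal[OF A_ideal w(2)])
    then have "- (g k * dT (Suc i) w l) \<in> A k"
      by (simp add: dT_diff dT_smult dT_dT)
    then have "g k * dT (Suc i) w l \<in> A k"
      using AI(5)[OF AI(2)] by fastforce
    then show "dT (Suc i) w l \<in> A k"
      by (rule reg[OF k dT_closed[OF w(1)]])
  qed
  have "dT i (\<lambda>j. v j - hT h i w j) l \<in> A k" for l
  proof (cases "l < r (Suc i)")
    case True
    from AI(3)[OF w(2)[of l] shift_mod(1)[OF k h cw True]] show ?thesis
      by (simp add: dT_diff algebra_simps)
  qed (simp add: dT_out AI(2))
  then have "cocycle (A k) i (\<lambda>j. v j - hT h i w j)"
    using vC w(1) by (auto simp: cocycle_def intro!: C_closed hT_closed[OF h])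
  from vanishing[OF ik this] have "cobound (A k) i (\<lambda>j. (v j - hT h i w j) - g k * 0)" by simp
  from cobound_SucI[OF k this C_closed(1)] cw show ?thesis by blast
qed

text \<open>Composing the shifts along \<open>g 0\<close>, \<open>g 1\<close>, \dots identifies the \<open>N\<close>-th cohomology modulo \<open>A 0\<close>
  with the cohomology in degree \<open>N - k\<close> modulo \<open>A k\<close>; each of the \<open>k\<close> shifts contributes \<open>\<delta>\<close> to the
  degree.\<close>

definition shift_map :: "nat \<Rightarrow> ((nat \<Rightarrow> 'a mpoly) \<Rightarrow> nat \<Rightarrow> 'a mpoly) \<Rightarrow> bool" where
  "shift_map k \<psi> \<longleftrightarrow> (\<forall>w w'. \<psi> (\<lambda>j. w j + w' j) = (\<lambda>j. \<psi> w j + \<psi> w' j)) \<and>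
    (\<forall>c w. \<psi> (\<lambda>j. c * w j) = (\<lambda>j. c * \<psi> w j)) \<and>
    (\<forall>w. (\<forall>j. w j \<in> C) \<longrightarrow> (\<forall>j. \<psi> w j \<in> C)) \<and>
    (\<forall>w e. \<forall>j<r (N - k). \<psi> (\<lambda>j. hcomp (a N j + e) (w j)) j =
       hcomp (a (N - k) j + (e + int k * \<delta>)) (\<psi> w j)) \<and>
    (\<forall>w. cocycle (A 0) N w \<longrightarrow> cocycle (A k) (N - k) (\<psi> w)) \<and>
    (\<forall>w. cocycle (A 0) N w \<longrightarrow>
       (cobound (A k) (N - k) (\<psi> w) \<longleftrightarrow> cobound (A 0) N w)) \<and>
    (\<forall>v. cocycle (A k) (N - k) v \<longrightarrow>
       (\<exists>w. cocycle (A 0) N w \<and> cobound (A k) (N - k) (\<lambda>j. v j - \<psi> w j)))"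

lemma shift_mapD:
  assumes "shift_map k \<psi>"
  shows "\<psi> (\<lambda>j. w j + w' j) = (\<lambda>j. \<psi> w j + \<psi> w' j)"
    and "\<psi> (\<lambda>j. c * w j) = (\<lambda>j. c * \<psi> w j)"
    and "(\<And>j. w j \<in> C) \<Longrightarrow> \<psi> w j \<in> C"
    and "j < r (N - k) \<Longrightarrow> \<psi> (\<lambda>j. hcomp (a N j + e) (w j)) j =
       hcomp (a (N - k) j + (e + int k * \<delta>)) (\<psi> w j)"
    and "cocycle (A 0) N w \<Longrightarrow> cocycle (A k) (N - k) (\<psi> w)"
    and "cocycle (A 0) N w \<Longrightarrow> cobound (A k) (N - k) (\<psi> w) \<longleftrightarrow> cobound (A 0) N w"
    and "cocycle (A k) (N - k) v \<Longrightarrow>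
       \<exists>w. cocycle (A 0) N w \<and> cobound (A k) (N - k) (\<lambda>j. v j - \<psi> w j)"
  using assms unfolding shift_map_def by simp_all

lemma iterated_shift:
  assumes "k \<le> N"
  shows "\<exists>\<psi>. shift_map k \<psi>"
  using assms
proof (induction k)
  case 0
  have "cobound (A 0) N (\<lambda>j. 0)"
    unfolding cobound_def
    by (intro exI[of _ "\<lambda>_. 0"]) (simp add: C_closed AI(2) bd_def dT_def split: nat.splits)
  then show ?case
    by (intro exI[of _ "\<lambda>w. w"]) (auto simp: shift_map_def)
next
  case (Suc k)
  then have k: "k < N" and kN: "k \<le> N" by simp_all
  obtain h where h: "null_homotopy (g k) \<delta> h" using homotopy[OF k] by blast
  define i where "i = N - Suc k"
  have i: "N - k = Suc i" "N - Suc k = i" "i + k < N"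
    using k by (simp_all add: i_def)
  obtain \<psi> where \<psi>: "shift_map k \<psi>" using Suc.IH[OF kN] by blast
  note \<psi>1 = shift_mapD(1)[OF \<psi>] and \<psi>2 = shift_mapD(2)[OF \<psi>] and \<psi>3 = shift_mapD(3)[OF \<psi>]
    and \<psi>4 = shift_mapD(4)[OF \<psi>, unfolded i] and \<psi>5 = shift_mapD(5)[OF \<psi>, unfolded i]
    and \<psi>6 = shift_mapD(6)[OF \<psi>, unfolded i] and \<psi>7 = shift_mapD(7)[OF \<psi>, unfolded i]
  show ?case
    unfolding shift_map_def i
  proof (intro exI[of _ "\<lambda>w. hT h i (\<psi> w)"] conjI allI impI)
    fix w w' show "hT h i (\<psi> (\<lambda>j. w j + w' j)) = (\<lambda>j. hT h i (\<psi> w) j + hT h i (\<psi> w') j)"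
      by (simp add: \<psi>1 hT_add fun_eq_iff)
  next
    fix c w show "hT h i (\<psi> (\<lambda>j. c * w j)) = (\<lambda>j. c * hT h i (\<psi> w) j)"
      by (simp add: \<psi>2 hT_smult fun_eq_iff)
  next
    fix w :: "nat \<Rightarrow> 'a mpoly" and j assume "\<forall>j. w j \<in> C"
    then show "hT h i (\<psi> w) j \<in> C" by (intro hT_closed[OF h] \<psi>3) auto
  next
    fix w :: "nat \<Rightarrow> 'a mpoly" and e j
    assume j: "j < r i"
    have "hT h i (\<psi> (\<lambda>j. hcomp (a N j + e) (w j))) j =
        hT h i (\<lambda>k'. hcomp (a (Suc i) k' + (e + int k * \<delta>)) (\<psi> w k')) j"
      unfolding hT_def by (rule sum.cong) (simp_all add: \<psi>4)
    also have "\<dots> = hcomp (a i j + ((e + int k * \<delta>) + \<delta>)) (hT h i (\<psi> w) j)"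
      by (rule hT_hcomp[OF h j])
    finally show "hT h i (\<psi> (\<lambda>j. hcomp (a N j + e) (w j))) j =
        hcomp (a i j + (e + int (Suc k) * \<delta>)) (hT h i (\<psi> w) j)"
      by (simp add: algebra_simps)
  next
    fix w assume w: "cocycle (A 0) N w"
    show "cocycle (A (Suc k)) i (hT h i (\<psi> w))"
      by (rule shift_mod(2)[OF k h \<psi>5[OF w]])
    show "cobound (A (Suc k)) i (hT h i (\<psi> w)) = cobound (A 0) N w"
      using shift_cobound[OF i(3) h \<psi>5[OF w]] \<psi>6[OF w] by simp
  next
    fix v assume "cocycle (A (Suc k)) i v"
    from shift_surj[OF i(3) h this] obtain w1 where w1: "cocycle (A k) (Suc i) w1"
      "cobound (A (Suc k)) i (\<lambda>j. v j - hT h i w1 j)" by blast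
    from \<psi>7[OF w1(1)] obtain w where w: "cocycle (A 0) N w"
      "cobound (A k) (Suc i) (\<lambda>j. w1 j - \<psi> w j)" by blast
    have "cocycle (A k) (Suc i) (\<lambda>j. w1 j - \<psi> w j)"
      using w1(1) \<psi>5[OF w(1)] AI(5) by (auto simp: cocycle_def dT_diff intro!: C_closed)
    from shift_cobound[OF i(3) h this] w(2)
    have "cobound (A (Suc k)) i (hT h i (\<lambda>j. w1 j - \<psi> w j))" by simp
    also have "hT h i (\<lambda>j. w1 j - \<psi> w j) = (\<lambda>j. hT h i w1 j - hT h i (\<psi> w) j)"
      by (simp add: hT_diff fun_eq_iff)
    finally have "cobound (A (Suc k)) i (\<lambda>j. hT h i w1 j - hT h i (\<psi> w) j)" .
    from cobound_lin(1)[OF A_ideal w1(2) this] w(1)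
    show "\<exists>w. cocycle (A 0) N w \<and> cobound (A (Suc k)) i (\<lambda>j. v j - hT h i (\<psi> w) j)"
      by (intro exI[of _ w]) simp
  qed
qed

text \<open>For \<open>k = N\<close> the target is $(A_N : I)/A_N$, the homomorphisms from $S/I$ to $S/A_N$ (Rees's
  lemma).\<close>

definition ext_colon_map :: "((nat \<Rightarrow> 'a mpoly) \<Rightarrow> 'a mpoly) \<Rightarrow> bool" where
  "ext_colon_map \<Psi> \<longleftrightarrow> (\<forall>w w'. \<Psi> (\<lambda>j. w j + w' j) = \<Psi> w + \<Psi> w') \<and>
    (\<forall>c w. \<Psi> (\<lambda>j. c * w j) = c * \<Psi> w) \<and>
    (\<forall>w. (\<forall>j. w j \<in> C) \<longrightarrow> \<Psi> w \<in> C) \<and>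
    (\<forall>w e. \<Psi> (\<lambda>j. hcomp (a N j + e) (w j)) = hcomp (e + int N * \<delta>) (\<Psi> w)) \<and>
    (\<forall>w. cocycle {0} N w \<longrightarrow> (\<forall>q\<in>I. q * \<Psi> w \<in> A N)) \<and>
    (\<forall>w. cocycle {0} N w \<longrightarrow> (\<Psi> w \<in> A N \<longleftrightarrow> cobound {0} N w)) \<and>
    (\<forall>s\<in>C. (\<forall>q\<in>I. q * s \<in> A N) \<longrightarrow> (\<exists>w. cocycle {0} N w \<and> s - \<Psi> w \<in> A N))"

lemma ext_colon_mapD:
  assumes "ext_colon_map \<Psi>"
  shows "\<Psi> (\<lambda>j. w j + w' j) = \<Psi> w + \<Psi> w'"
    and "\<Psi> (\<lambda>j. c * w j) = c * \<Psi> w"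
    and "(\<And>j. w j \<in> C) \<Longrightarrow> \<Psi> w \<in> C"
    and "\<Psi> (\<lambda>j. hcomp (a N j + e) (w j)) = hcomp (e + int N * \<delta>) (\<Psi> w)"
    and "cocycle {0} N w \<Longrightarrow> q \<in> I \<Longrightarrow> q * \<Psi> w \<in> A N"
    and "cocycle {0} N w \<Longrightarrow> \<Psi> w \<in> A N \<longleftrightarrow> cobound {0} N w"
    and "s \<in> C \<Longrightarrow> (\<And>q. q \<in> I \<Longrightarrow> q * s \<in> A N) \<Longrightarrow> \<exists>w. cocycle {0} N w \<and> s - \<Psi> w \<in> A N"
  using assms unfolding ext_colon_map_def by simp_all

theorem ext_colon:
  assumes A0: "A 0 = {0}"
  shows "\<exists>\<Psi>. ext_colon_map \<Psi>"
proof -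
  have coc: "cocycle (A N) 0 v \<longleftrightarrow> (\<forall>j. v j \<in> C) \<and> (\<forall>q\<in>I. q * v 0 \<in> A N)" for v
  proof -
    have "(\<forall>k. D 0 0 k * v 0 \<in> A N) \<longleftrightarrow> (\<forall>q\<in>I. q * v 0 \<in> A N)"
    proof (intro iffI ballI allI)
      fix q assume *: "\<forall>k. D 0 0 k * v 0 \<in> A N" and "q \<in> I"
      then obtain u where u: "\<And>k. u k \<in> C" "q = (\<Sum>k<r 1. D 0 0 k * u k)"
        using augment by auto
      have "q * v 0 = (\<Sum>k<r 1. u k * (D 0 0 k * v 0))"
        by (simp add: u(2) sum_distrib_left sum_distrib_right mult_ac)
      also have "\<dots> \<in> A N"
        by (rule ideal_sum[OF A_ideal]) (use AI(4) * u(1) in auto)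
      finally show "q * v 0 \<in> A N" .
    next
      fix k assume *: "\<forall>q\<in>I. q * v 0 \<in> A N"
      show "D 0 0 k * v 0 \<in> A N"
      proof (cases "k < r 1")
        case True
        have "D 0 0 k = (\<Sum>k'<r 1. D 0 0 k' * (if k' = k then 1 else 0))"
          using True by (simp add: sum_delta_mult)
        moreover have "\<forall>k'. (if k' = k then 1 else 0) \<in> C" by (auto intro: C_closed)
        ultimately have "D 0 0 k \<in> I"
          unfolding augment by (intro exI[of _ "\<lambda>k'. if k' = k then 1 else 0"] conjI)
        then show ?thesis using * by blast
      next
        case False
        then show ?thesis using D_out[of 0 k 0] AI(2) by simp
      qed
    qed
    then show ?thesis by (simp add: cocycle_def dT_def r0)
  qed
  have cob: "cobound (A N) 0 v \<longleftrightarrow> v 0 \<in> A N" for v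
    by (auto simp: cobound_def r0 intro!: exI[of _ "\<lambda>_. 0"] C_closed)
  obtain \<psi> where "shift_map N \<psi>" using iterated_shift[of N] by blast
  note \<psi> = shift_mapD[OF this, unfolded diff_self_eq_0 A0]
  have hom: "\<psi> (\<lambda>j. hcomp (a N j + e) (w j)) 0 = hcomp (e + int N * \<delta>) (\<psi> w 0)" for w e
    using \<psi>(4)[of 0 e w] by (simp add: r0 a0)
  show ?thesis
    unfolding ext_colon_map_def
  proof (intro exI[of _ "\<lambda>w. \<psi> w 0"] conjI allI impI ballI)
    fix s assume "s \<in> C" "\<forall>q\<in>I. q * s \<in> A N"
    then have "cocycle (A N) 0 (\<lambda>_. s)" by (simp add: coc)
    from \<psi>(7)[OF this] show "\<exists>w. cocycle {0} N w \<and> s - \<psi> w 0 \<in> A N" by (simp add: cob)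
  next
    fix w assume w: "cocycle {0} N w"
    show "q * \<psi> w 0 \<in> A N" if "q \<in> I" for q
      using \<psi>(5)[OF w] that by (simp add: coc)
    show "\<psi> w 0 \<in> A N \<longleftrightarrow> cobound {0} N w"
      using \<psi>(6)[OF w] by (simp add: cob)
  qed (simp_all add: \<psi>(1,2,3) hom)
qed

end

section \<open>A normal form for the relations\<close>

text \<open>The homomorphism from monomials to a commutative monoid with given values on the variables.\<close>

definition mon_hom :: "(var \<Rightarrow> 'c::comm_monoid_add) \<Rightarrow> (var \<Rightarrow>\<^sub>0 nat) \<Rightarrow> 'c" where
  "mon_hom e m = (\<Sum>v\<in>kys m. \<Sum>_\<in>{..<lkp m v}. e v)"

lemma sum_lessThan_add: "(\<Sum>_\<in>{..<a + b}. c) = (\<Sum>_\<in>{..<a}. c) + (\<Sum>_\<in>{..<b::nat}. c::'c::comm_monoid_add)"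
  by (induction b) (auto simp: add_ac)

lemma mon_hom_superset:
  "finite A \<Longrightarrow> kys m \<subseteq> A \<Longrightarrow> mon_hom e m = (\<Sum>v\<in>A. \<Sum>_\<in>{..<lkp m v}. e v)"
  unfolding mon_hom_def by (rule sum.mono_neutral_left) (auto simp: in_kys)

lemma mon_hom_add: "mon_hom e (a + b) = mon_hom e a + mon_hom e b"
  using mon_hom_superset[of "kys a \<union> kys b" a e] mon_hom_superset[of "kys a \<union> kys b" b e]
    mon_hom_superset[of "kys a \<union> kys b" "a + b" e]
  by (simp add: lookup_add sum_lessThan_add sum.distrib keys_add_nat)

lemma mon_hom_0 [simp]: "mon_hom e 0 = 0"
  by (simp add: mon_hom_def)

lemma mon_hom_var [simp]: "mon_hom e (sgl v 1) = e v" "mon_hom e (sgl v (Suc 0)) = e v"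
  by (simp_all add: mon_hom_def)

lemma mon_hom_vmon: "mon_hom e (vmon g G) = (\<Sum>i\<in>G. e (g i))"
  unfolding vmon_def by (induction G rule: infinite_finite_induct) (auto simp: mon_hom_add)

lemma mon_induct [consumes 1, case_names zero var add]:
  assumes "m \<in> mons V" and "P 0" and "\<And>v. v \<in> V \<Longrightarrow> P (sgl v 1)"
    and "\<And>a b. a \<in> mons V \<Longrightarrow> b \<in> mons V \<Longrightarrow> P a \<Longrightarrow> P b \<Longrightarrow> P (a + b)"
  shows "P m"
proof -
  have sing: "P (sgl v c)" if "v \<in> V" for v c
  proof (induction c)
    case (Suc c)
    have "P (sgl v 1 + sgl v c)"
      by (rule assms(4)) (use that Suc assms(3) in \<open>auto simp: mons_single\<close>)
    then show ?case by (simp flip: single_add)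
  qed (simp add: assms(2))
  have "kys m \<subseteq> V" using assms(1) by (simp add: mons_def)
  then have "m \<in> mons V \<and> P m"
    by (induction m rule: term_induct) (auto simp: assms(2,4) sing mons_single mons_add)
  then show ?thesis ..
qed

lemma split_var: "lkp m v \<noteq> 0 \<Longrightarrow> \<exists>m1. m = sgl v (1::nat) + m1"
  by (rule le_monomial) (auto simp: lookup_single when_def)

definition VS :: "nat \<Rightarrow> var set" where "VS n = xvars n \<union> yvars n"
definition VT :: "nat \<Rightarrow> nat set set \<Rightarrow> var set" where "VT n \<Delta> = xvars n \<union> yvars n \<union> zvars \<Delta>"
definition VQ :: "nat \<Rightarrow> nat set set \<Rightarrow> var set" where "VQ n \<Delta> = xvars n \<union> zvars \<Delta>"

lemma rings: "ring_S n = poly_ring (VS n)" "ring_T n \<Delta> = poly_ring (VT n \<Delta>)"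
  "ring_Q n \<Delta> = poly_ring (VQ n \<Delta>)"
  by (simp_all add: ring_S_def ring_T_def ring_Q_def VS_def VT_def VQ_def)

lemma var_mem [simp]:
  "Xv i \<in> xvars n \<longleftrightarrow> i \<in> {1..n}" "Yv i \<in> yvars n \<longleftrightarrow> i \<in> {1..n}"
  "Xv i \<notin> yvars n" "Yv i \<notin> xvars n" "Zv F \<notin> xvars n" "Zv F \<notin> yvars n"
  "Xv i \<notin> zvars \<Delta>" "Yv i \<notin> zvars \<Delta>" "Zv F \<in> zvars \<Delta> \<longleftrightarrow> F \<in> facets \<Delta>"
  by (auto simp: xvars_def yvars_def zvars_def)

lemma V_mem [simp]:
  "Xv i \<in> VS n \<longleftrightarrow> i \<in> {1..n}" "Yv i \<in> VS n \<longleftrightarrow> i \<in> {1..n}" "Zv F \<notin> VS n"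
  "Xv i \<in> VT n \<Delta> \<longleftrightarrow> i \<in> {1..n}" "Yv i \<in> VT n \<Delta> \<longleftrightarrow> i \<in> {1..n}" "Zv F \<in> VT n \<Delta> \<longleftrightarrow> F \<in> facets \<Delta>"
  "Xv i \<in> VQ n \<Delta> \<longleftrightarrow> i \<in> {1..n}" "Yv i \<notin> VQ n \<Delta>" "Zv F \<in> VQ n \<Delta> \<longleftrightarrow> F \<in> facets \<Delta>"
  by (auto simp: VS_def VT_def VQ_def)

lemma V_sub: "VS n \<subseteq> VT n \<Delta>" "VQ n \<Delta> \<subseteq> VT n \<Delta>" "xvars n \<subseteq> VS n"
  by (auto simp: VS_def VT_def VQ_def)

text \<open>For a set \<open>K\<close> of indices, the variables $y_j$ with $j \<in> K$ are identified with $x_j$; \<open>tv K j\<close>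
  is what $y_j$ becomes.\<close>

definition tv :: "nat set \<Rightarrow> nat \<Rightarrow> var" where
  "tv K i = (if i \<in> K then Xv i else Yv i)"

definition collapse :: "nat set \<Rightarrow> (var \<Rightarrow>\<^sub>0 nat) \<Rightarrow> var \<Rightarrow>\<^sub>0 nat" where
  "collapse K = mon_hom (\<lambda>v. sgl (case v of Yv i \<Rightarrow> tv K i | _ \<Rightarrow> v) 1)"

text \<open>The first component counts the variables $z_F$. As the canonical module is the ideal of
  $S/(x_1 y_1, \dots, x_n y_n)$ generated by the monomials $\mathbf{y}^{[n] \setminus F}$, the second
  component replaces $z_F$ by $\mathbf{y}^{[n] \setminus F}$, after the identifications given by \<open>K\<close>.\<close>

definition nf :: "nat \<Rightarrow> nat set \<Rightarrow> (var \<Rightarrow>\<^sub>0 nat) \<Rightarrow> nat \<times> (var \<Rightarrow>\<^sub>0 nat)" where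
  "nf n K = mon_hom (\<lambda>v. case v of Xv i \<Rightarrow> (0, sgl (Xv i) 1) | Yv i \<Rightarrow> (0, sgl (tv K i) 1)
     | Zv F \<Rightarrow> (1, vmon (tv K) ({1..n} - F)))"

lemma nf_add: "nf n K (a + b) = nf n K a + nf n K b"
  by (simp add: nf_def mon_hom_add)

lemma nf_var [simp]: "nf n K (sgl (Xv i) (Suc 0)) = (0, sgl (Xv i) 1)"
  "nf n K (sgl (Yv i) (Suc 0)) = (0, sgl (tv K i) 1)"
  "nf n K (sgl (Zv F) (Suc 0)) = (1, vmon (tv K) ({1..n} - F))"
  by (simp_all add: nf_def)

lemma nf_0 [simp]: "nf n K 0 = 0" by (simp add: nf_def)

lemma collapse_add: "collapse K (a + b) = collapse K a + collapse K b"
  by (simp add: collapse_def mon_hom_add)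

lemma collapse_var [simp]: "collapse K (sgl (Xv i) (Suc 0)) = sgl (Xv i) 1"
  "collapse K (sgl (Yv i) (Suc 0)) = sgl (tv K i) 1"
  "collapse K (sgl (Zv F) (Suc 0)) = sgl (Zv F) 1"
  by (simp_all add: collapse_def)

lemma collapse_0 [simp]: "collapse K 0 = 0" by (simp add: collapse_def)

lemma collapse_vmon: "collapse K (vmon Yv G) = vmon (tv K) G"
  by (simp add: collapse_def mon_hom_vmon) (simp add: vmon_def)

lemma nf_collapse: "nf n K (collapse K m) = nf n K m"
proof -
  have "m \<in> mons UNIV" by (simp add: mons_def)
  then show ?thesis
  proof (induction m rule: mon_induct)
    case (var v) then show ?case by (cases v) (simp_all add: tv_def)
  qed (simp_all add: nf_add collapse_add)
qed

lemma collapse_degree: "mon_degree (collapse K m) = mon_degree m"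
proof -
  have "m \<in> mons UNIV" by (simp add: mons_def)
  then show ?thesis
  proof (induction m rule: mon_induct)
    case (var v) then show ?case by (cases v) simp_all
  qed (simp_all add: mon_degree_add collapse_add)
qed

definition VS_K :: "nat \<Rightarrow> nat set \<Rightarrow> var set" where
  "VS_K n K = xvars n \<union> Yv ` ({1..n} - K)"

lemma VS_K_mem [simp]: "Xv i \<in> VS_K n K \<longleftrightarrow> i \<in> {1..n}" "Yv i \<in> VS_K n K \<longleftrightarrow> i \<in> {1..n} \<and> i \<notin> K"
  "Zv F \<notin> VS_K n K"
  by (auto simp: VS_K_def)

lemma VS_K_sub: "VS_K n K \<subseteq> VS n" "VS n = VS_K n {}" "xvars n = VS_K n {1..n}"
  by (auto simp: VS_def VS_K_def yvars_def)

lemma collapse_closed: "m \<in> mons (VT n \<Delta>) \<Longrightarrow> collapse K m \<in> mons (VS_K n K \<union> zvars \<Delta>)"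
proof (induction m rule: mon_induct)
  case (var v) then show ?case by (cases v) (simp_all add: mons_single tv_def)
qed (simp_all add: mons_add collapse_add)

lemma nf_reduced: "m \<in> mons (VS_K n K) \<Longrightarrow> nf n K m = (0, m)"
proof (induction m rule: mon_induct)
  case (var v) then show ?case by (cases v) (simp_all add: tv_def)
qed (simp_all add: nf_add zero_prod_def)

lemma lookup_vmon_tv:
  assumes "finite G"
  shows "lkp (vmon (tv K) G) (Xv i) = (if i \<in> G \<and> i \<in> K then 1 else 0)"
    "lkp (vmon (tv K) G) (Yv i) = (if i \<in> G \<and> i \<notin> K then 1 else 0)"
    "lkp (vmon (tv K) G) (Zv F) = 0"
proof -
  have "lkp (vmon (tv K) G) v = (\<Sum>i\<in>G. if tv K i = v then 1 else 0)" for v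
    by (auto simp: vmon_def lookup_sum lookup_single when_def intro!: sum.cong)
  then show "lkp (vmon (tv K) G) (Xv i) = (if i \<in> G \<and> i \<in> K then 1 else 0)"
    "lkp (vmon (tv K) G) (Yv i) = (if i \<in> G \<and> i \<notin> K then 1 else 0)"
    "lkp (vmon (tv K) G) (Zv F) = 0"
    using assms
    by (simp_all add: tv_def if_distrib[of "\<lambda>v. v = _"] sum.If_cases cong: if_cong)
       (auto simp: card_1_singleton_iff card_eq_0_iff)
qed

lemma vmon_union: "finite G \<Longrightarrow> finite H \<Longrightarrow> G \<inter> H = {} \<Longrightarrow> vmon g (G \<union> H) = vmon g G + vmon g H"
  by (simp add: vmon_def sum.union_disjoint)

lemma monomial_cases:
  assumes m: "m \<in> mons (V \<union> zvars \<Delta>)"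
  obtains (0) "m \<in> mons V"
  | (1) F m1 where "F \<in> facets \<Delta>" "m1 \<in> mons V" "m = sgl (Zv F) 1 + m1"
  | (2) F F' m2 where "F \<in> facets \<Delta>" "F' \<in> facets \<Delta>" "m2 \<in> mons (V \<union> zvars \<Delta>)"
      "m = sgl (Zv F) 1 + (sgl (Zv F') 1 + m2)"
proof -
  have step: "m \<in> mons V \<or> (\<exists>F\<in>facets \<Delta>. \<exists>m1\<in>mons (V \<union> zvars \<Delta>). m = sgl (Zv F) 1 + m1)"
    if mV: "m \<in> mons (V \<union> zvars \<Delta>)" for m
  proof (cases "m \<in> mons V")
    case False
    then obtain F where F: "lkp m (Zv F) \<noteq> 0" "F \<in> facets \<Delta>"
      using mV by (auto simp: mons_iff zvars_def)
    from split_var[OF F(1)] obtain m1 where "m = sgl (Zv F) 1 + m1" by blast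
    then show ?thesis using F mV by (auto simp: mons_add)
  qed simp
  show thesis
  proof (cases "m \<in> mons V")
    case False
    then obtain F m1 where F: "F \<in> facets \<Delta>" "m1 \<in> mons (V \<union> zvars \<Delta>)" "m = sgl (Zv F) 1 + m1"
      using step[OF m] by blast
    show thesis
    proof (cases "m1 \<in> mons V")
      case False
      then show thesis using step[OF F(2)] F that(3) by blast
    qed (use F that(2) in blast)
  qed (use that(1) in blast)
qed

locale simplicial =
  fixes n :: nat and \<Delta> :: "nat set set"
  assumes cpx: "simplicial_complex n \<Delta>"
begin

abbreviation T :: "'k::comm_ring_1 mpoly ring" where "T \<equiv> poly_ring (VT n \<Delta>)"

lemma face_sub: "F \<in> \<Delta> \<Longrightarrow> F \<subseteq> {1..n}" and face_down: "F \<in> \<Delta> \<Longrightarrow> G \<subseteq> F \<Longrightarrow> G \<in> \<Delta>"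
  using cpx unfolding simplicial_complex_def by blast+

lemma empty_face: "{} \<in> \<Delta>"
  using cpx unfolding simplicial_complex_def by blast

lemma facet_face: "F \<in> facets \<Delta> \<Longrightarrow> F \<in> \<Delta>" by (simp add: facets_def)

lemma facet_sub: "F \<in> facets \<Delta> \<Longrightarrow> F \<subseteq> {1..n}"
  by (rule face_sub[OF facet_face])

lemma facet_finite: "F \<in> facets \<Delta> \<Longrightarrow> finite F"
  using facet_sub finite_subset by blast

lemma finite_\<Delta>: "finite \<Delta>"
  by (rule finite_subset[of _ "Pow {1..n}"]) (use face_sub in auto)

lemma face_in_facet: "G \<in> \<Delta> \<Longrightarrow> \<exists>F\<in>facets \<Delta>. G \<subseteq> F"
proof -
  assume "G \<in> \<Delta>"
  from finite_has_maximal2[OF finite_\<Delta> this] obtain F where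
    F: "F \<in> \<Delta>" "G \<subseteq> F" "\<forall>b\<in>\<Delta>. F \<subseteq> b \<longrightarrow> F = b" by blast
  then have "F \<in> facets \<Delta>" unfolding facets_def by (simp add: eq_commute)
  with F(2) show ?thesis by blast
qed

lemma finite_facets: "finite (facets \<Delta>)"
  using finite_\<Delta> by (simp add: facets_def)

definition xsupp :: "(var \<Rightarrow>\<^sub>0 nat) \<Rightarrow> nat set" where
  "xsupp u = {j \<in> {1..n}. lkp u (Xv j) \<noteq> 0}"

definition bad :: "nat set \<Rightarrow> (var \<Rightarrow>\<^sub>0 nat) \<Rightarrow> bool" where
  "bad K u \<longleftrightarrow> (\<exists>j\<in>{1..n}. if j \<in> K then 2 \<le> lkp u (Xv j) else lkp u (Xv j) \<noteq> 0 \<and> lkp u (Yv j) \<noteq> 0)"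

text \<open>The normal forms of the monomials that vanish modulo the relations.\<close>

definition dead :: "nat set \<Rightarrow> (nat \<times> (var \<Rightarrow>\<^sub>0 nat)) set" where
  "dead K = {(e, u). 2 \<le> e \<or> bad K u \<or> (e = 0 \<and> xsupp u \<notin> \<Delta>)}"

lemma bad_add: "bad K u \<Longrightarrow> bad K (u + u')"
proof -
  assume "bad K u"
  then obtain j where "j \<in> {1..n}"
    "if j \<in> K then 2 \<le> lkp u (Xv j) else lkp u (Xv j) \<noteq> 0 \<and> lkp u (Yv j) \<noteq> 0"
    unfolding bad_def by blast
  then show ?thesis
    unfolding bad_def by (intro bexI[of _ j]) (simp_all add: lookup_add split: if_splits)
qed

lemma xsupp_add: "xsupp (u + u') = xsupp u \<union> xsupp u'"
  unfolding xsupp_def lookup_add by auto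

text \<open>If the support of \<open>u\<close> is no face, it is not contained in the facet \<open>F\<close>, so that replacing
  $z_F$ by $\mathbf{y}^{[n] \setminus F}$ produces a vanishing product.\<close>

lemma dead_add_var:
  assumes w: "w \<in> dead K" and v: "v \<in> VT n \<Delta>"
  shows "w + nf n K (sgl v 1) \<in> dead K"
proof -
  obtain e u where [simp]: "w = (e, u)" by (cases w)
  show ?thesis
  proof (cases v)
    case (Zv F)
    then have F: "F \<in> facets \<Delta>" using v by simp
    have "bad K (u + vmon (tv K) ({1..n} - F))" if "xsupp u \<notin> \<Delta>"
    proof -
      have "\<not> xsupp u \<subseteq> F" using that face_down[OF facet_face[OF F]] by blast
      then obtain j where "j \<in> {1..n}" "lkp u (Xv j) \<noteq> 0" "j \<notin> F"
        by (auto simp: xsupp_def)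
      then show ?thesis
        by (auto simp: bad_def lookup_add lookup_vmon_tv intro!: bexI[of _ j])
    qed
    then show ?thesis using w bad_add by (auto simp: Zv dead_def plus_prod_def)
  next
    case (Xv i)
    have "xsupp (u + sgl (Xv i) 1) \<in> \<Delta> \<Longrightarrow> xsupp u \<in> \<Delta>"
      by (erule face_down) (simp add: xsupp_add)
    then show ?thesis using w bad_add by (auto simp: Xv dead_def plus_prod_def)
  next
    case (Yv i)
    have "xsupp (u + sgl (tv K i) 1) \<in> \<Delta> \<Longrightarrow> xsupp u \<in> \<Delta>"
      by (erule face_down) (simp add: xsupp_add)
    then show ?thesis using w bad_add by (auto simp: Yv dead_def plus_prod_def)
  qed
qed

lemma dead_add:
  assumes "m \<in> mons (VT n \<Delta>)" "w \<in> dead K"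
  shows "w + nf n K m \<in> dead K"
  using assms
proof (induction m arbitrary: w rule: mon_induct)
  case (var v) then show ?case using dead_add_var by simp
next
  case (add a b)
  then show ?case by (simp add: nf_add flip: add.assoc)
qed simp

text \<open>By \<open>rel_ideal_contains\<close> and \<open>rel_ideal_least\<close> this is the ideal generated by the relations of $R_\Delta$ and
  the $y_j - x_j$ with $j \in K$.\<close>

definition rel_ideal :: "nat set \<Rightarrow> 'k::comm_ring_1 mpoly set" where
  "rel_ideal K = {p \<in> carrier T. kys (push (nf n K) p) \<subseteq> dead K}"

lemma ideal_rel_ideal: "ideal (rel_ideal K) T"
proof (rule ideal_poly_ringI)
  fix p q :: "'a mpoly" assume p: "p \<in> rel_ideal K" and q: "q \<in> carrier T"
  have "kys (push (nf n K) p * push (nf n K) q) \<subseteq> dead K"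
  proof (rule keys_mult_sub[of _ "dead K" _ "nf n K ` mons (VT n \<Delta>)"])
    show "kys (push (nf n K) q) \<subseteq> nf n K ` mons (VT n \<Delta>)"
      using keys_push[of "nf n K" q] q by (auto simp: carrier_poly_ring)
  qed (use p dead_add in \<open>auto simp: rel_ideal_def\<close>)
  then show "q * p \<in> rel_ideal K"
    using p q by (simp add: rel_ideal_def poly_ring_closed push_mult[of "nf n K", OF nf_add] mult.commute)
next
  fix p q :: "'a mpoly" assume "p \<in> rel_ideal K" "q \<in> rel_ideal K"
  then show "p + q \<in> rel_ideal K"
    by (simp add: rel_ideal_def poly_ring_closed push_add keys_plus_sub)
qed (auto simp: rel_ideal_def poly_ring_closed)

lemma mono_in_rel_ideal: "m \<in> mons (VT n \<Delta>) \<Longrightarrow> nf n K m \<in> dead K \<Longrightarrow> mono1 m \<in> rel_ideal K"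
  by (simp add: rel_ideal_def poly_ring_closed keys_sgl_sub del: keys_single)

lemma diff_in_rel_ideal:
  assumes "m \<in> mons (VT n \<Delta>)" "m' \<in> mons (VT n \<Delta>)" "nf n K m = nf n K m'"
  shows "mono1 m - mono1 m' \<in> rel_ideal K"
  using assms by (simp add: rel_ideal_def poly_ring_closed push_diff)

subsection \<open>The defining ideal\<close>

text \<open>\<open>contains_relations J\<close>: the ideal \<open>J\<close> contains the defining relations of $R_\Delta$, written as
  monomials and binomials.\<close>

definition contains_relations :: "'k::comm_ring_1 mpoly set \<Rightarrow> bool" where
  "contains_relations J \<longleftrightarrow> ideal J T \<and>
     (\<forall>G. G \<subseteq> {1..n} \<longrightarrow> G \<notin> \<Delta> \<longrightarrow> mono1 (vmon Xv G) \<in> J) \<and>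
     (\<forall>i\<in>{1..n}. mono1 (sgl (Xv i) 1 + sgl (Yv i) 1) \<in> J) \<and>
     (\<forall>F\<in>facets \<Delta>. \<forall>i\<in>{1..n} - F. mono1 (sgl (Xv i) 1 + sgl (Zv F) 1) \<in> J) \<and>
     (\<forall>F1\<in>facets \<Delta>. \<forall>F2\<in>facets \<Delta>. F1 \<noteq> F2 \<longrightarrow> 
        mono1 (vmon Yv (F1 - F2) + sgl (Zv F1) 1) - mono1 (vmon Yv (F2 - F1) + sgl (Zv F2) 1) \<in> J) \<and>
     (\<forall>F1\<in>facets \<Delta>. \<forall>F2\<in>facets \<Delta>. mono1 (sgl (Zv F1) 1 + sgl (Zv F2) 1) \<in> J)"

lemma ideal_restrict:
  assumes "ideal J (poly_ring V')" "V \<subseteq> V'"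
  shows "ideal (J \<inter> carrier (poly_ring V)) (poly_ring V)"
proof -
  note J = ideal_poly_ringD[OF assms(1)]
  have "carrier (poly_ring V) \<subseteq> carrier (poly_ring V')"
    using assms(2) by (auto simp: carrier_poly_ring intro: mons_mono)
  then show ?thesis
    by (intro ideal_poly_ringI) (use J in \<open>auto intro: poly_ring_closed\<close>)
qed

lemma genideal_mono_ring:
  assumes J: "ideal J (poly_ring V')" "V \<subseteq> V'" and S: "S \<subseteq> J" "S \<subseteq> carrier (poly_ring V)"
  shows "Idl\<^bsub>poly_ring V\<^esub> S \<subseteq> J"
  using ring.genideal_minimal[OF ring_poly_ring ideal_restrict[OF J]] S by blast

lemma genideal_closed:
  assumes "S \<subseteq> carrier (poly_ring V)"
  shows "Idl\<^bsub>poly_ring V\<^esub> S \<subseteq> carrier (poly_ring V)" "S \<subseteq> Idl\<^bsub>poly_ring V\<^esub> S"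
    "ideal (Idl\<^bsub>poly_ring V\<^esub> S) (poly_ring V)"
  using ring.genideal_ideal[OF ring_poly_ring assms] ring.genideal_self[OF ring_poly_ring assms]
    ideal_poly_ringD(1) by blast+

lemma xmon_closed: "G \<subseteq> {1..n} \<Longrightarrow> Xv ` {1..n} \<subseteq> V \<Longrightarrow> xmon G \<in> carrier (poly_ring V)"
  unfolding xmon_mono by (rule poly_ring_closed) (auto intro!: vmon_closed)

lemma carrier_mono: "V \<subseteq> V' \<Longrightarrow> carrier (poly_ring V) \<subseteq> carrier (poly_ring V')"
  by (auto simp: carrier_poly_ring intro: mons_mono)

lemma SR_gens: "{xmon F |F. F \<subseteq> {1..n} \<and> F \<notin> \<Delta>} \<subseteq> carrier (poly_ring (xvars n))"
  by (auto intro!: xmon_closed)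

lemma SR_closed: "stanley_reisner_ideal n \<Delta> \<subseteq> carrier (poly_ring (VS n))"
  unfolding stanley_reisner_ideal_def
  using genideal_closed(1)[OF SR_gens] carrier_mono[OF V_sub(3)] by blast

lemma \<Gamma>_gens:
  "stanley_reisner_ideal n \<Delta> \<union> {pvar (Xv i) * pvar (Yv i) |i. i \<in> {1..n}} \<subseteq> carrier (poly_ring (VS n))"
  using SR_closed by (auto intro!: poly_ring_closed pvar_closed)

lemma ideal_\<Gamma>_least:
  assumes J: "ideal J (poly_ring V)" "VS n \<subseteq> V"
    and 1: "\<And>G. G \<subseteq> {1..n} \<Longrightarrow> G \<notin> \<Delta> \<Longrightarrow> mono1 (vmon Xv G) \<in> J"
    and 2: "\<And>i. i \<in> {1..n} \<Longrightarrow> mono1 (sgl (Xv i) 1 + sgl (Yv i) 1) \<in> J"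
  shows "ideal_\<Gamma> n \<Delta> \<subseteq> J"
proof -
  have "stanley_reisner_ideal n \<Delta> \<subseteq> J"
    unfolding stanley_reisner_ideal_def
    by (rule genideal_mono_ring[OF J(1) _ _ SR_gens])
       (use 1 V_sub(3)[of n] J(2) in \<open>auto simp: xmon_mono subset_iff\<close>)
  then show ?thesis
    unfolding ideal_\<Gamma>_def rings
    by (intro genideal_mono_ring[OF J]) (use 2 \<Gamma>_gens in \<open>auto simp: pvar_mono mult_single\<close>)
qed

lemma ideal_\<Gamma>_props:
  shows "ideal (ideal_\<Gamma> n \<Delta>) (poly_ring (VS n))"
    and "\<And>G. G \<subseteq> {1..n} \<Longrightarrow> G \<notin> \<Delta> \<Longrightarrow> mono1 (vmon Xv G) \<in> ideal_\<Gamma> n \<Delta>"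
    and "\<And>i. i \<in> {1..n} \<Longrightarrow> mono1 (sgl (Xv i) 1 + sgl (Yv i) 1) \<in> ideal_\<Gamma> n \<Delta>"
proof -
  note \<Gamma> = genideal_closed[OF \<Gamma>_gens, folded rings(1), folded ideal_\<Gamma>_def]
  then show "ideal (ideal_\<Gamma> n \<Delta>) (poly_ring (VS n))" by (simp add: rings)
  show "mono1 (vmon Xv G) \<in> ideal_\<Gamma> n \<Delta>" if "G \<subseteq> {1..n}" "G \<notin> \<Delta>" for G
    using genideal_closed(2)[OF SR_gens] \<Gamma>(2) that
    unfolding stanley_reisner_ideal_def xmon_mono by blast
  show "mono1 (sgl (Xv i) 1 + sgl (Yv i) 1) \<in> ideal_\<Gamma> n \<Delta>" if "i \<in> {1..n}" for i
    using \<Gamma>(2) that by (auto simp: pvar_mono mult_single)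
qed

lemma xsupp_monomial:
  "u \<in> mons V \<Longrightarrow> \<exists>c\<in>mons V. u = vmon Xv (xsupp u) + c"
proof -
  assume u: "u \<in> mons V"
  have "\<exists>c. u = vmon Xv (xsupp u) + c"
  proof (rule le_monomial)
    fix v show "lkp (vmon Xv (xsupp u)) v \<le> lkp u v"
      by (cases v) (auto simp: lookup_vmon xsupp_def)
  qed
  then obtain c where "u = vmon Xv (xsupp u) + c" by blast
  then have "c \<in> mons V" using u mons_add[of "vmon Xv (xsupp u)" c V] by simp
  then show ?thesis using \<open>u = vmon Xv (xsupp u) + c\<close> by (rule bexI[rotated])
qed

text \<open>All generators are squarefree monomials. So membership is decided monomial by monomial, and a
  monomial is a multiple of a generator iff the indices of its $x_j$ form no face or some $x_j y_j$
  divides it.\<close>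

lemma ideal_\<Gamma>_monomial:
  "(ideal_\<Gamma> n \<Delta> :: 'a::comm_ring_1 mpoly set) =
    {p \<in> carrier (poly_ring (VS n)). kys p \<subseteq> {m. (0, m) \<in> dead {}}}"
proof
  have "ideal {p :: 'a mpoly. p \<in> carrier (poly_ring (VS n)) \<and> kys p \<subseteq> {m. (0, m) \<in> dead {}}} (poly_ring (VS n))"
  proof (rule ideal_of_monomials)
    fix m m' assume m: "m \<in> {m. (0, m) \<in> dead {}}" "m' \<in> mons (VS n)"
    have "nf n {} m' = (0, m')" using m(2) by (intro nf_reduced) (simp add: VS_K_sub(2))
    then show "m + m' \<in> {m. (0, m) \<in> dead {}}"
      using dead_add[OF mons_mono[OF V_sub(1) m(2)], of "(0, m)" "{}"] m(1) by simp
  qed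
  then show "(ideal_\<Gamma> n \<Delta> :: 'a mpoly set) \<subseteq> {p \<in> carrier (poly_ring (VS n)). kys p \<subseteq> {m. (0, m) \<in> dead {}}}"
  proof (rule ideal_\<Gamma>_least[OF _ order_refl])
    fix G assume G: "G \<subseteq> {1..n}" "G \<notin> \<Delta>"
    then have "xsupp (vmon Xv G) = G"
      using finite_subset[of G "{1..n}"] by (auto simp: xsupp_def lookup_vmon)
    then show "mono1 (vmon Xv G) \<in> {p \<in> carrier (poly_ring (VS n)). kys p \<subseteq> {m. (0, m) \<in> dead {}}}"
      using G by (auto simp: dead_def intro!: poly_ring_closed vmon_closed)
  next
    fix i assume "i \<in> {1..n}"
    then show "mono1 (sgl (Xv i) 1 + sgl (Yv i) 1) \<in>
        {p \<in> carrier (poly_ring (VS n)). kys p \<subseteq> {m. (0, m) \<in> dead {}}}"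
      by (auto simp: dead_def bad_def lookup_add lookup_single poly_ring_closed mons_add mons_single
          intro!: bexI[of _ i])
  qed
  show "{p \<in> carrier (poly_ring (VS n)). kys p \<subseteq> {m. (0, m) \<in> dead {}}} \<subseteq>
      (ideal_\<Gamma> n \<Delta> :: 'a mpoly set)"
  proof safe
    fix p :: "'a mpoly"
    assume p: "p \<in> carrier (poly_ring (VS n))" "kys p \<subseteq> {m. (0, m) \<in> dead {}}"
    note \<Gamma> = ideal_\<Gamma>_props
    show "p \<in> ideal_\<Gamma> n \<Delta>"
    proof (rule monomials_in_ideal[OF \<Gamma>(1) _ p])
      fix m assume m: "m \<in> {m. (0, m) \<in> dead {}}" "m \<in> mons (VS n)"
      have dvd: "(mono1 m :: 'a mpoly) \<in> ideal_\<Gamma> n \<Delta>"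
        if "(mono1 a :: 'a mpoly) \<in> ideal_\<Gamma> n \<Delta>" "m = a + c" for a c
        using ideal_poly_ringD(4)[OF \<Gamma>(1) that(1), of "mono1 c :: 'a mpoly"] m(2)
        by (simp add: that(2) mult_single mons_add poly_ring_closed add.commute)
      from m(1) consider "xsupp m \<notin> \<Delta>"
        | j where "j \<in> {1..n}" "lkp m (Xv j) \<noteq> 0" "lkp m (Yv j) \<noteq> 0"
        by (auto simp: dead_def bad_def)
      then show "(mono1 m :: 'a mpoly) \<in> ideal_\<Gamma> n \<Delta>"
      proof cases
        case 1
        obtain c where c: "m = vmon Xv (xsupp m) + c" using xsupp_monomial[OF m(2)] by blast
        have "xsupp m \<subseteq> {1..n}" by (auto simp: xsupp_def)
        from \<Gamma>(2)[OF this 1] have "(mono1 (vmon Xv (xsupp m)) :: 'a mpoly) \<in> ideal_\<Gamma> n \<Delta>" .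
        then show ?thesis by (rule dvd[OF _ c])
      next
        case (2 j)
        have "\<exists>c. m = (sgl (Xv j) 1 + sgl (Yv j) 1) + c"
        proof (rule le_monomial)
          fix v show "lkp (sgl (Xv j) 1 + sgl (Yv j) 1) v \<le> lkp m v"
            using 2 by (cases v) (auto simp: lookup_add lookup_single when_def)
        qed
        then show ?thesis using dvd \<Gamma>(3)[OF 2(1)] by blast
      qed
    qed
  qed
qed

end

context simplicial
begin

lemma contains_relationsD:
  fixes J :: "'k::comm_ring_1 mpoly set"
  assumes "contains_relations J"
  shows "ideal J T"
    and "G \<subseteq> {1..n} \<Longrightarrow> G \<notin> \<Delta> \<Longrightarrow> mono1 (vmon Xv G) \<in> J"
    and "i \<in> {1..n} \<Longrightarrow> mono1 (sgl (Xv i) 1 + sgl (Yv i) 1) \<in> J"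
    and "F \<in> facets \<Delta> \<Longrightarrow> i \<in> {1..n} - F \<Longrightarrow> mono1 (sgl (Xv i) 1 + sgl (Zv F) 1) \<in> J"
    and "F \<in> facets \<Delta> \<Longrightarrow> F' \<in> facets \<Delta> \<Longrightarrow> F \<noteq> F' \<Longrightarrow>
      mono1 (vmon Yv (F - F') + sgl (Zv F) 1) - mono1 (vmon Yv (F' - F) + sgl (Zv F') 1) \<in> J"
    and "F \<in> facets \<Delta> \<Longrightarrow> F' \<in> facets \<Delta> \<Longrightarrow> mono1 (sgl (Zv F) 1 + sgl (Zv F') 1) \<in> J"
  using assms unfolding contains_relations_def by simp_all

lemma relations_least:
  fixes J :: "'k::comm_ring_1 mpoly set"
  assumes J: "contains_relations J"
  shows "relations_R n \<Delta> \<subseteq> J"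
proof -
  have id: "ideal J T" using J by (simp add: contains_relations_def)
  have "ideal_\<Gamma> n \<Delta> \<subseteq> J"
    by (rule ideal_\<Gamma>_least[OF id V_sub(1)]) (use J in \<open>simp_all add: contains_relations_def\<close>)
  moreover have "{pvar (Xv i) * pvar (Zv F) | i F. F \<in> facets \<Delta> \<and> i \<in> {1..n} \<and> i \<notin> F} \<subseteq> J"
    using J by (auto simp: contains_relations_def pvar_mono mult_single)
  moreover have "{ymon (F1 - F2) * pvar (Zv F1) - ymon (F2 - F1) * pvar (Zv F2) | F1 F2.
           F1 \<in> facets \<Delta> \<and> F2 \<in> facets \<Delta> \<and> F1 \<noteq> F2} \<subseteq> J"
    using J by (auto simp: contains_relations_def pvar_mono ymon_mono mult_single)
  moreover have "{pvar (Zv F1) * pvar (Zv F2) | F1 F2. F1 \<in> facets \<Delta> \<and> F2 \<in> facets \<Delta>} \<subseteq> J"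
    using J by (auto simp: contains_relations_def pvar_mono mult_single)
  ultimately show ?thesis
    unfolding relations_R_def rings
    by (intro ring.genideal_minimal[OF ring_poly_ring id] Un_least)
qed

lemma y_vmon_closed: "F \<in> facets \<Delta> \<Longrightarrow> vmon Yv (F - G) \<in> mons (VT n \<Delta>)"
  by (rule vmon_closed) (use facet_sub in force)

lemma relations_props: "contains_relations (relations_R n \<Delta> :: 'k::comm_ring_1 mpoly set)"
proof -
  let ?gens = "ideal_\<Gamma> n \<Delta>
      \<union> {pvar (Xv i) * pvar (Zv F) | i F. F \<in> facets \<Delta> \<and> i \<in> {1..n} \<and> i \<notin> F}
      \<union> {ymon (F1 - F2) * pvar (Zv F1) - ymon (F2 - F1) * pvar (Zv F2) | F1 F2.
           F1 \<in> facets \<Delta> \<and> F2 \<in> facets \<Delta> \<and> F1 \<noteq> F2}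
      \<union> {pvar (Zv F1) * pvar (Zv F2) | F1 F2. F1 \<in> facets \<Delta> \<and> F2 \<in> facets \<Delta>} :: 'k mpoly set"
  have "ideal_\<Gamma> n \<Delta> \<subseteq> carrier (T :: 'k mpoly ring)"
    using ideal_poly_ringD(1)[OF ideal_\<Gamma>_props(1)] carrier_mono[OF V_sub(1)] by blast
  then have "?gens \<subseteq> carrier T"
    by (auto simp: ymon_mono intro!: poly_ring_closed pvar_closed y_vmon_closed)
  note R = genideal_closed[OF this, folded rings(2), folded relations_R_def]
  have sub: "ideal_\<Gamma> n \<Delta> \<subseteq> (relations_R n \<Delta> :: 'k mpoly set)" using R(2) by blast
  have eq1: "pvar v * pvar w = mono1 (sgl v 1 + sgl w 1)" for v w
    by (simp add: pvar_mono mult_single)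
  have eq2: "ymon G * pvar w = mono1 (vmon Yv G + sgl w 1)" for G w
    by (simp add: pvar_mono mult_single ymon_mono)
  have gens: "?gens \<subseteq> relations_R n \<Delta>" by (rule R(2))
  show ?thesis
    unfolding contains_relations_def
  proof (intro conjI ballI allI impI)
    show "ideal (relations_R n \<Delta> :: 'k mpoly set) T" using R(3) by (simp add: rings)
  next
    fix G assume "G \<subseteq> {1..n}" "G \<notin> \<Delta>"
    then show "(mono1 (vmon Xv G) :: 'k mpoly) \<in> relations_R n \<Delta>" 
      using ideal_\<Gamma>_props(2) sub by blast
  next
    fix i assume "i \<in> {1..n}"
    then show "(mono1 (sgl (Xv i) 1 + sgl (Yv i) 1) :: 'k mpoly) \<in> relations_R n \<Delta>"
      using ideal_\<Gamma>_props(3) sub by blast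
  next
    fix F i assume "F \<in> facets \<Delta>" "i \<in> {1..n} - F"
    then have "pvar (Xv i) * pvar (Zv F) \<in> ?gens" by blast
    then show "(mono1 (sgl (Xv i) 1 + sgl (Zv F) 1) :: 'k mpoly) \<in> relations_R n \<Delta>"
      using gens unfolding eq1 by blast
  next
    fix F1 F2 assume "F1 \<in> facets \<Delta>" "F2 \<in> facets \<Delta>" "F1 \<noteq> F2"
    then have "ymon (F1 - F2) * pvar (Zv F1) - ymon (F2 - F1) * pvar (Zv F2) \<in> ?gens" by blast
    then show "(mono1 (vmon Yv (F1 - F2) + sgl (Zv F1) 1) - mono1 (vmon Yv (F2 - F1) + sgl (Zv F2) 1)
      :: 'k mpoly) \<in> relations_R n \<Delta>"
      using gens unfolding eq2 by blast
  next
    fix F1 F2 assume "F1 \<in> facets \<Delta>" "F2 \<in> facets \<Delta>"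
    then have "pvar (Zv F1) * pvar (Zv F2) \<in> ?gens" by blast
    then show "(mono1 (sgl (Zv F1) 1 + sgl (Zv F2) 1) :: 'k mpoly) \<in> relations_R n \<Delta>"
      using gens unfolding eq1 by blast
  qed
qed

lemma theta_in_rel_ideal: "i \<in> K \<Longrightarrow> i \<in> {1..n} \<Longrightarrow> mono1 (sgl (Yv i) 1) - mono1 (sgl (Xv i) 1) \<in> rel_ideal K"
  by (rule diff_in_rel_ideal) (simp_all add: tv_def mons_single)

lemma rel_ideal_contains: "contains_relations (rel_ideal K :: 'k::comm_ring_1 mpoly set)"
  unfolding contains_relations_def
proof (intro conjI ballI allI impI)
  show "ideal (rel_ideal K :: 'k mpoly set) T" by (rule ideal_rel_ideal)
next
  fix G assume G: "G \<subseteq> {1..n}" "G \<notin> \<Delta>"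
  have fin: "finite G" using G(1) finite_subset by blast
  have nf: "nf n K (vmon Xv G) = (0, vmon Xv G)"
    by (rule nf_reduced, rule vmon_closed) (use G in auto)
  have "xsupp (vmon Xv G) = G" using G fin by (auto simp: xsupp_def lookup_vmon)
  then show "(mono1 (vmon Xv G) :: 'k mpoly) \<in> rel_ideal K"
    using G nf by (intro mono_in_rel_ideal) (auto simp: dead_def intro!: vmon_closed)
next
  fix i assume i: "i \<in> {1..n}"
  have "bad K (sgl (Xv i) 1 + sgl (tv K i) 1)"
    unfolding bad_def
    by (rule bexI[OF _ i]) (simp add: tv_def lookup_add lookup_single)
  then show "(mono1 (sgl (Xv i) 1 + sgl (Yv i) 1) :: 'k mpoly) \<in> rel_ideal K"
    using i by (intro mono_in_rel_ideal) (simp_all add: nf_add mons_add mons_single dead_def)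
next
  fix F i assume F: "F \<in> facets \<Delta>" and i: "i \<in> {1..n} - F"
  have "bad K (sgl (Xv i) 1 + vmon (tv K) ({1..n} - F))"
    unfolding bad_def
    by (rule bexI[of _ i]) (use i in \<open>auto simp: lookup_add lookup_vmon_tv lookup_single\<close>)
  then show "(mono1 (sgl (Xv i) 1 + sgl (Zv F) 1) :: 'k mpoly) \<in> rel_ideal K"
    using i F by (intro mono_in_rel_ideal) (simp_all add: nf_add mons_add mons_single dead_def)
next
  fix F1 F2 assume F: "F1 \<in> facets \<Delta>" "F2 \<in> facets \<Delta>" "F1 \<noteq> F2"
  have nf: "nf n K (vmon Yv G) = (0, vmon (tv K) G)" if "G \<subseteq> {1..n}" for G
  proof -
    have "vmon Yv G \<in> mons (VT n \<Delta>)" by (rule vmon_closed) (use that in auto)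
    have "collapse K (vmon Yv G) \<in> mons (VS_K n K)"
      unfolding collapse_vmon by (rule vmon_closed) (use that in \<open>auto simp: tv_def\<close>)
    from nf_reduced[OF this] show ?thesis by (simp only: nf_collapse) (simp add: collapse_vmon)
  qed
  have *: "vmon (tv K) (F1 - F2) + vmon (tv K) ({1..n} - F1) = vmon (tv K) ({1..n} - F1 \<inter> F2)"
    if "F1 \<in> facets \<Delta>" "F2 \<in> facets \<Delta>" for F1 F2
    using facet_sub[OF that(1)] facet_finite[OF that(1)]
    by (subst vmon_union[symmetric]) (auto intro!: arg_cong[of _ _ "vmon (tv K)"])
  show "(mono1 (vmon Yv (F1 - F2) + sgl (Zv F1) 1) - mono1 (vmon Yv (F2 - F1) + sgl (Zv F2) 1) :: 'k mpoly) \<in> rel_ideal K"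
  proof (rule diff_in_rel_ideal)
    have "F1 - F2 \<subseteq> {1..n}" "F2 - F1 \<subseteq> {1..n}" using facet_sub F by blast+
    then show "nf n K (vmon Yv (F1 - F2) + sgl (Zv F1) 1) = nf n K (vmon Yv (F2 - F1) + sgl (Zv F2) 1)"
      using *[OF F(1,2)] *[OF F(2,1)] by (simp add: nf_add nf Int_commute)
  qed (use F in \<open>simp_all add: mons_add mons_single y_vmon_closed\<close>)
next
  fix F1 F2 assume "F1 \<in> facets \<Delta>" "F2 \<in> facets \<Delta>"
  then show "(mono1 (sgl (Zv F1) 1 + sgl (Zv F2) 1) :: 'k mpoly) \<in> rel_ideal K"
    by (intro mono_in_rel_ideal) (simp_all add: nf_add mons_add mons_single dead_def)
qed

lemma le_two_vars: "lkp m v \<noteq> 0 \<Longrightarrow> lkp m w \<noteq> 0 \<Longrightarrow> v \<noteq> w \<Longrightarrow> \<exists>c. m = (sgl v 1 + sgl w 1) + (c :: var \<Rightarrow>\<^sub>0 nat)"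
  by (rule le_monomial) (auto simp: lookup_add lookup_single when_def)

lemma le_square: "2 \<le> lkp m v \<Longrightarrow> \<exists>c. m = (sgl v 1 + sgl v 1) + (c :: var \<Rightarrow>\<^sub>0 nat)"
  by (rule le_monomial) (auto simp: lookup_add lookup_single when_def)

text \<open>Modulo an ideal \<open>J\<close> as in the statement, every monomial reduces to one without the variables
  $y_j$ with $j \<in> K$. Such a monomial \<open>m\<close> is determined by its normal form if it has no $z_F$. If it
  is $z_F m_1$, its normal form is $m_1 \mathbf{y}^{[n] \setminus F}$, and an equality
  $m_1 \mathbf{y}^{[n] \setminus F} = m_2 \mathbf{y}^{[n] \setminus F'}$ forces
  $m_1 = c\, \mathbf{y}^{F \setminus F'}$ and $m_2 = c\, \mathbf{y}^{F' \setminus F}$.\<close>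

lemma rel_ideal_least:
  fixes J :: "'k::comm_ring_1 mpoly set"
  assumes rel: "contains_relations J" and K: "K \<subseteq> {1..n}"
    and \<theta>: "\<And>j. j \<in> K \<Longrightarrow> mono1 (sgl (Yv j) 1) - mono1 (sgl (Xv j) 1) \<in> J"
  shows "rel_ideal K \<subseteq> J"
proof
  have id: "ideal J T" using rel by (simp add: contains_relations_def)
  note I = ideal_poly_ringD[OF id]
  let ?M = "mons (VT n \<Delta>)"
  define cg where "cg m m' \<longleftrightarrow> mono1 m - mono1 m' \<in> J" for m m'
  have cg_refl: "cg m m" for m by (simp add: cg_def I(2))
  have cg_sym: "cg m' m" if "cg m m'" for m m'
    using I(5)[OF I(2) that[unfolded cg_def]] by (simp add: cg_def)
  have cg_trans: "cg a c" if "cg a b" "cg b c" for a b c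
    using I(3)[OF that[unfolded cg_def]] by (simp add: cg_def)
  have cg_add: "cg (c + a) (c + b)" if "cg a b" "c \<in> ?M" for a b c
  proof -
    have "mono1 c * (mono1 a - mono1 b) \<in> J"
      by (rule I(4)) (use that in \<open>simp_all add: cg_def poly_ring_closed\<close>)
    then show ?thesis by (simp add: cg_def right_diff_distrib mult_single)
  qed
  have cg_null: "mono1 m \<in> J" if "cg m m'" "mono1 m' \<in> J" for m m'
    using I(3)[OF that(1)[unfolded cg_def] that(2)] by simp
  have null_add: "mono1 (c + a) \<in> J" if "mono1 a \<in> J" "c \<in> ?M" for c a
    using I(4)[OF that(1), of "mono1 c"] that(2) by (simp add: mult_single poly_ring_closed)
  have red_closed: "collapse K m \<in> ?M" if "m \<in> ?M" for m
    by (rule mons_mono[OF _ collapse_closed[OF that]])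
       (use K in \<open>auto simp: VS_K_def VT_def yvars_def\<close>)
  have red: "cg m (collapse K m)" if "m \<in> ?M" for m
    using that
  proof (induction m rule: mon_induct)
    case (var v)
    show ?case
    proof (cases v)
      case (Yv i)
      then show ?thesis using \<theta>[of i] cg_refl by (simp add: tv_def cg_def)
    qed (use cg_refl in simp_all)
  next
    case (add a b)
    have "cg (b + a) (b + collapse K a)" by (rule cg_add) (use add in auto)
    moreover have "cg (collapse K a + b) (collapse K a + collapse K b)"
      by (rule cg_add) (use add red_closed in auto)
    ultimately show ?case
      using cg_trans by (simp add: collapse_add add.commute)
  qed (simp add: cg_refl)
  have "VS_K n K \<subseteq> VT n \<Delta>" by (auto simp: VS_K_def VT_def yvars_def)
  then have sub: "m \<in> ?M" if "m \<in> mons (VS_K n K)" for m using mons_mono that by blast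
  have sub2: "c \<in> ?M" if "u \<in> mons (VS_K n K)" "u = a + c" for u a c
    using sub[OF that(1)] by (simp add: that(2) mons_add)
  have bad_null: "mono1 u \<in> J" if u: "u \<in> mons (VS_K n K)" and b: "bad K u" for u
  proof -
    obtain j where j: "j \<in> {1..n}"
      "if j \<in> K then 2 \<le> lkp u (Xv j) else lkp u (Xv j) \<noteq> 0 \<and> lkp u (Yv j) \<noteq> 0"
      using b unfolding bad_def by blast
    have xy: "mono1 (sgl (Xv j) 1 + sgl (Yv j) 1) \<in> J"
      by (rule contains_relationsD(3)[OF rel j(1)])
    show ?thesis
    proof (cases "j \<in> K")
      case True
      have "cg (sgl (Xv j) 1 + sgl (Xv j) 1) (sgl (Xv j) 1 + sgl (Yv j) 1)"
        by (rule cg_add[OF cg_sym]) (use \<theta>[OF True] j(1) in \<open>simp_all add: cg_def mons_single\<close>)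
      from cg_null[OF this xy] have xx: "mono1 (sgl (Xv j) 1 + sgl (Xv j) 1) \<in> J" .
      obtain c where c: "u = (sgl (Xv j) 1 + sgl (Xv j) 1) + c"
        using le_square[of u "Xv j"] j(2) True by auto
      from null_add[OF xx sub2[OF u c]] c show ?thesis by (simp add: add.commute)
    next
      case False
      obtain c where c: "u = (sgl (Xv j) 1 + sgl (Yv j) 1) + c"
        using le_two_vars[of u "Xv j" "Yv j"] j(2) False by auto
      from null_add[OF xy sub2[OF u c]] c show ?thesis by (simp add: add.commute)
    qed
  qed
  have bad_null1: "mono1 (sgl (Zv F) 1 + m1) \<in> J"
    if F: "F \<in> facets \<Delta>" and m1: "m1 \<in> mons (VS_K n K)"
      and b: "bad K (vmon (tv K) ({1..n} - F) + m1)" for F m1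
  proof (cases "bad K m1")
    case True
    then show ?thesis using null_add[OF bad_null[OF m1]] F by (simp add: mons_single)
  next
    case False
    obtain j where j: "j \<in> {1..n}"
      "if j \<in> K then 2 \<le> lkp (vmon (tv K) ({1..n} - F) + m1) (Xv j)
       else lkp (vmon (tv K) ({1..n} - F) + m1) (Xv j) \<noteq> 0 \<and> lkp (vmon (tv K) ({1..n} - F) + m1) (Yv j) \<noteq> 0"
      using b unfolding bad_def by blast
    have nb: "\<not> (if j \<in> K then 2 \<le> lkp m1 (Xv j) else lkp m1 (Xv j) \<noteq> 0 \<and> lkp m1 (Yv j) \<noteq> 0)"
      using False j(1) unfolding bad_def by blast
    have "j \<notin> F \<and> lkp m1 (Xv j) \<noteq> 0"
      using j nb by (auto simp: lookup_add lookup_vmon_tv split: if_splits)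
    then have jF: "j \<in> {1..n} - F" and "lkp m1 (Xv j) \<noteq> 0" using j(1) by auto
    from split_var[OF this(2)] obtain c where c: "m1 = sgl (Xv j) 1 + c" ..
    from null_add[OF contains_relationsD(4)[OF rel F jF] sub2[OF m1 c]]
    show ?thesis by (simp add: c ac_simps)
  qed
  fix p :: "'k mpoly" assume p: "p \<in> rel_ideal K"
  show "p \<in> J"
  proof (rule push_reduction[where N = "nf n K" and W = "dead K" and A = ?M])
    show "0 \<in> J" by (rule I(2))
    show "p + q \<in> J" if "p \<in> J" "q \<in> J" for p q by (rule I(3)[OF that])
    show "sgl 0 c * p \<in> J" if "p \<in> J" for c p
      by (rule I(4)[OF that]) (simp add: poly_ring_closed)
    show "kys p \<subseteq> ?M" "kys (push (nf n K) p) \<subseteq> dead K"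
      using p by (auto simp: rel_ideal_def carrier_poly_ring)
  next
    fix m assume m: "m \<in> ?M" "nf n K m \<in> dead K"
    let ?m = "collapse K m"
    have nfm: "nf n K ?m \<in> dead K" using m(2) by (simp add: nf_collapse)
    have "mono1 ?m \<in> J"
      using collapse_closed[OF m(1), of K]
    proof (cases rule: monomial_cases)
      case 0
      then have "(0, ?m) \<in> dead K" using nfm by (simp add: nf_reduced)
      then consider "bad K ?m" | "xsupp ?m \<notin> \<Delta>" by (auto simp: dead_def)
      then show ?thesis
      proof cases
        case 1
        then show ?thesis using bad_null[OF 0] by simp
      next
        case 2
        obtain c where c: "?m = vmon Xv (xsupp ?m) + c" using xsupp_monomial[OF 0] by blast
        have c': "c \<in> ?M" by (rule sub2[OF 0 c])
        have "xsupp ?m \<subseteq> {1..n}" by (auto simp: xsupp_def)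
        then have "mono1 (vmon Xv (xsupp ?m)) \<in> J"
          using contains_relationsD(2)[OF rel _ 2] by simp
        from null_add[OF this c'] show ?thesis
          unfolding add.commute[of c] c[symmetric] .
      qed
    next
      case (1 F m1)
      then show ?thesis
        using nfm by (intro bad_null1[of F m1, folded 1(3)]) (simp_all add: nf_add nf_reduced dead_def)
    next
      case (2 F F' m2)
      have "m2 \<in> ?M" using red_closed[OF m(1)] 2(4) by (simp add: mons_add)
      from null_add[OF contains_relationsD(6)[OF rel 2(1,2)] this]
      show ?thesis by (simp add: 2(4) ac_simps)
    qed
    with red[OF m(1)] show "mono1 m \<in> J" by (rule cg_null)
  next
    fix m m' assume m: "m \<in> ?M" "m' \<in> ?M" and eq: "nf n K m = nf n K m'" and nd: "nf n K m \<notin> dead K"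
    have form: "fst (nf n K m) = 0 \<and> nf n K m = (0, collapse K m) \<or>
        (\<exists>F\<in>facets \<Delta>. \<exists>m1\<in>mons (VS_K n K). collapse K m = sgl (Zv F) 1 + m1 \<and>
           nf n K m = (1, vmon (tv K) ({1..n} - F) + m1))"
      if "m \<in> ?M" "nf n K m \<notin> dead K" for m
      using collapse_closed[OF that(1), of K]
    proof (cases rule: monomial_cases)
      case 0
      then show ?thesis using nf_reduced[OF 0] by (simp add: nf_collapse)
    next
      case (1 F m1)
      have "nf n K (collapse K m) = (1, vmon (tv K) ({1..n} - F) + m1)"
        unfolding 1(3) nf_add using nf_reduced[OF 1(2)] by simp
      then have "nf n K m = (1, vmon (tv K) ({1..n} - F) + m1)" by (simp only: nf_collapse)
      with 1 show ?thesis by blast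
    next
      case (2 F F' m2)
      have "fst (nf n K (collapse K m)) \<ge> 2" unfolding 2(4) by (simp add: nf_add)
      then show ?thesis using that(2) by (auto simp: nf_collapse dead_def split: prod.splits)
    qed
    have "cg (collapse K m) (collapse K m')"
      using form[OF m(1) nd] form[OF m(2) nd[unfolded eq]]
    proof (elim disjE conjE bexE)
      fix F m1 F' m1'
      assume F: "F \<in> facets \<Delta>" "F' \<in> facets \<Delta>" and m1: "m1 \<in> mons (VS_K n K)" "m1' \<in> mons (VS_K n K)"
        and cm: "collapse K m = sgl (Zv F) 1 + m1" "collapse K m' = sgl (Zv F') 1 + m1'"
        and nfm: "nf n K m = (1, vmon (tv K) ({1..n} - F) + m1)"
          "nf n K m' = (1, vmon (tv K) ({1..n} - F') + m1')"
      have fin: "finite F" "finite F'" using F facet_finite by auto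
      have split: "vmon (tv K) ({1..n} - F) = vmon (tv K) ({1..n} - (F \<union> F')) + vmon (tv K) (F' - F)"
        if "F \<in> facets \<Delta>" "F' \<in> facets \<Delta>" for F F'
        using facet_sub[OF that(2)] facet_finite[OF that(2)]
        by (subst vmon_union[symmetric]) (auto intro!: arg_cong[of _ _ "vmon (tv K)"])
      have "vmon (tv K) ({1..n} - F) + m1 = vmon (tv K) ({1..n} - F') + m1'"
        using eq nfm by simp
      then have e: "vmon (tv K) (F' - F) + m1 = vmon (tv K) (F - F') + m1'"
        unfolding split[OF F] split[OF F(2,1)] by (simp add: Un_commute add.assoc)
      have "\<exists>c. m1 = vmon (tv K) (F - F') + c"
      proof (rule le_monomial)
        fix v
        have "lkp (vmon (tv K) (F' - F)) v + lkp m1 v = lkp (vmon (tv K) (F - F')) v + lkp m1' v"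
          by (simp flip: lookup_add add: e)
        moreover have "lkp (vmon (tv K) (F - F')) v = 0 \<or> lkp (vmon (tv K) (F' - F)) v = 0"
          using fin by (cases v) (simp_all add: lookup_vmon_tv)
        ultimately show "lkp (vmon (tv K) (F - F')) v \<le> lkp m1 v" by auto
      qed
      then obtain c where c: "m1 = vmon (tv K) (F - F') + c" by blast
      have "vmon (tv K) (F - F') + (vmon (tv K) (F' - F) + c) = vmon (tv K) (F - F') + m1'"
        using e by (simp add: c add.left_commute[of "vmon (tv K) (F - F')"])
      then have c': "m1' = vmon (tv K) (F' - F) + c" by simp
      have cM: "c \<in> ?M" by (rule sub2[OF m1(1) c])
      have yt: "cg (z + vmon (tv K) (G - H)) (z + vmon Yv (G - H))" if "G \<in> facets \<Delta>" "z \<in> ?M" for G H z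
        using red[OF y_vmon_closed[OF that(1), of H]] that(2)
        by (intro cg_add[OF cg_sym]) (simp_all add: collapse_vmon)
      have b: "cg (vmon Yv (F - F') + sgl (Zv F) 1) (vmon Yv (F' - F) + sgl (Zv F') 1)"
        using contains_relationsD(5)[OF rel F] cg_refl by (cases "F = F'") (simp_all add: cg_def)
      have 1: "cg (collapse K m) ((c + sgl (Zv F) 1) + vmon Yv (F - F'))"
        using yt[OF F(1), of "c + sgl (Zv F) 1" F'] cM F by (simp add: cm c mons_add mons_single ac_simps)
      have 2: "cg (collapse K m') ((c + sgl (Zv F') 1) + vmon Yv (F' - F))"
        using yt[OF F(2), of "c + sgl (Zv F') 1" F] cM F by (simp add: cm c' mons_add mons_single ac_simps)
      have "cg ((c + sgl (Zv F) 1) + vmon Yv (F - F')) ((c + sgl (Zv F') 1) + vmon Yv (F' - F))"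
        using cg_add[OF b cM] by (simp add: ac_simps)
      then show ?thesis using cg_trans[OF 1] cg_trans[OF _ cg_sym[OF 2]] by blast
    qed (use eq cg_refl in auto)
    then have "cg m m'"
      using cg_trans[OF red[OF m(1)]] cg_trans[OF _ cg_sym[OF red[OF m(2)]]] by blast
    then show "mono1 m - mono1 m' \<in> J" by (simp add: cg_def)
  qed
qed

lemma relations_rel_ideal: "relations_R n \<Delta> = rel_ideal {}"
  using relations_least[OF rel_ideal_contains] rel_ideal_least[OF relations_props] by blast

lemma one_notin_rel_ideal: "(1 :: 'k::comm_ring_1 mpoly) \<notin> rel_ideal K"
proof -
  have "push (nf n K) (1 :: 'k mpoly) = sgl 0 1"
    using push_single[of "nf n K" 0 "1::'k"] by simp
  moreover have "xsupp 0 = {}" by (simp add: xsupp_def)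
  then have "0 \<notin> dead K" using empty_face by (simp add: dead_def zero_prod_def bad_def)
  ultimately show ?thesis by (simp add: rel_ideal_def)
qed

text \<open>Let $i \<notin> K$ and let \<open>u\<close> be a monomial that does not vanish. If $x_i$ does not divide \<open>u\<close>, then
  $y_i u$ does not vanish, and its coefficient in the image of $(y_i - x_i) p$ is that of \<open>u\<close> in the image of
  \<open>p\<close>; if $x_i$ divides \<open>u\<close>, then $y_i$ does not, and $x_i u$ plays this role up to sign.\<close>

lemma theta_regular:
  assumes i: "i \<in> {1..n}" "i \<notin> K" and p: "p \<in> carrier T"
    and prod: "(mono1 (sgl (Yv i) 1) - mono1 (sgl (Xv i) 1)) * p \<in> rel_ideal K"
  shows "p \<in> rel_ideal K"
proof -
  define P where "P = push (nf n K) p"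
  let ?X = "(0::nat, sgl (Xv i) (1::nat))" and ?Y = "(0::nat, sgl (Yv i) (1::nat))"
  have "push (nf n K) ((mono1 (sgl (Yv i) 1) - mono1 (sgl (Xv i) 1)) * p) =
      mono1 ?Y * P - mono1 ?X * P"
    using i(2) by (simp add: push_mult[of "nf n K", OF nf_add] push_diff P_def left_diff_distrib tv_def)
  then have nul: "lkp (mono1 ?Y * P) w - lkp (mono1 ?X * P) w = 0" if "w \<notin> dead K" for w
    using prod that by (force simp: rel_ideal_def in_kys lookup_minus)
  have "lkp P (e, u) = 0" if nd: "(e, u) \<notin> dead K" for e u
  proof (cases "lkp u (Xv i) = 0")
    case True
    have "\<not> bad K (sgl (Yv i) 1 + u)"
      using nd True i by (auto simp: dead_def bad_def lookup_add lookup_single when_def split: if_splits)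
    moreover have "xsupp (sgl (Yv i) 1 + u) = xsupp u"
      by (auto simp: xsupp_def lookup_add lookup_single)
    ultimately have "?Y + (e, u) \<notin> dead K" using nd by (simp add: dead_def)
    from nul[OF this] have "lkp P (e, u) = lkp (mono1 ?X * P) (?Y + (e, u))"
      by (simp only: lookup_monomial_mult) simp
    also have "\<dots> = 0"
    proof (rule lookup_monomial_mult_outside, rule notI)
      fix w assume "?Y + (e, u) = ?X + w"
      then have "lkp (snd (?Y + (e, u))) (Xv i) = lkp (snd (?X + w)) (Xv i)" by simp
      then show False using True by (simp add: lookup_add lookup_single)
    qed
    finally show ?thesis .
  next
    case False
    have "\<not> bad K u" using nd by (simp add: dead_def)
    then have "\<not> (if i \<in> K then 2 \<le> lkp u (Xv i) else lkp u (Xv i) \<noteq> 0 \<and> lkp u (Yv i) \<noteq> 0)"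
      using i(1) unfolding bad_def by blast
    then have y0: "lkp u (Yv i) = 0" using False i(2) by simp
    have "\<not> bad K (sgl (Xv i) 1 + u)"
      using nd y0 i by (auto simp: dead_def bad_def lookup_add lookup_single when_def split: if_splits)
    moreover have "xsupp (sgl (Xv i) 1 + u) = xsupp u"
      using False i by (auto simp: xsupp_def lookup_add lookup_single when_def)
    ultimately have "?X + (e, u) \<notin> dead K" using nd by (simp add: dead_def)
    from nul[OF this] have "lkp P (e, u) = lkp (mono1 ?Y * P) (?X + (e, u))"
      by (simp only: lookup_monomial_mult) simp
    also have "\<dots> = 0"
    proof (rule lookup_monomial_mult_outside, rule notI)
      fix w assume "?X + (e, u) = ?Y + w"
      then have "lkp (snd (?X + (e, u))) (Yv i) = lkp (snd (?Y + w)) (Yv i)" by simp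
      then show False using y0 by (simp add: lookup_add lookup_single)
    qed
    finally show ?thesis .
  qed
  then show ?thesis using p by (auto simp: rel_ideal_def P_def in_kys)
qed

end

section \<open>The annihilator of $f_\Delta$\<close>

lemma lookup_partial_deriv:
  fixes p :: "'k::comm_ring_1 mpoly"
  shows "lkp (partial_deriv v p) u = of_nat (lkp u v + 1) * lkp p (u + sgl v 1)"
proof -
  have "lkp (partial_deriv v p) u = (\<Sum>m\<in>kys p.
      (of_nat (lkp m v) * lkp p m when m - sgl v 1 = u))"
    by (simp add: partial_deriv_def lookup_sum lookup_single)
  also have "\<dots> = (\<Sum>m\<in>kys p. (if m = u + sgl v 1 then of_nat (lkp u v + 1) * lkp p m else 0))"
  proof (rule sum.cong[OF refl])
    fix m assume "m \<in> kys p"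
    show "(of_nat (lkp m v) * lkp p m when m - sgl v 1 = u) =
      (if m = u + sgl v 1 then of_nat (lkp u v + 1) * lkp p m else 0)"
    proof (cases "lkp m v = 0")
      case True
      then have "m \<noteq> u + sgl v 1" by (auto simp: lookup_add)
      then show ?thesis using True by simp
    next
      case False
      then obtain m1 where m1: "m = sgl v 1 + m1" using split_var by meson
      then have "m - sgl v 1 = m1" by simp
      moreover have "m = u + sgl v 1 \<longleftrightarrow> m1 = u" by (simp add: m1 add.commute)
      ultimately show ?thesis by (auto simp: m1 lookup_add when_def)
    qed
  qed
  also have "\<dots> = of_nat (lkp u v + 1) * lkp p (u + sgl v 1)"
    by (simp add: in_kys)
  finally show ?thesis .
qed

lemma partial_deriv_commute: "partial_deriv v \<circ> partial_deriv w = partial_deriv w \<circ> partial_deriv v"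
proof (rule ext, rule poly_mapping_eqI)
  fix p :: "'a mpoly" and u
  show "lkp ((partial_deriv v \<circ> partial_deriv w) p) u = lkp ((partial_deriv w \<circ> partial_deriv v) p) u"
    by (cases "v = w") (simp_all add: lookup_partial_deriv lookup_add lookup_single ac_simps)
qed

lemma funpow_commute:
  assumes "f \<circ> g = g \<circ> f"
  shows "(f ^^ a) \<circ> (g ^^ b) = (g ^^ b) \<circ> (f ^^ a)"
proof -
  have 1: "f \<circ> (g ^^ b) = (g ^^ b) \<circ> f"
  proof (induction b)
    case (Suc b)
    have "f \<circ> (g ^^ Suc b) = (f \<circ> g) \<circ> (g ^^ b)" by (simp add: o_assoc)
    also have "\<dots> = g \<circ> (f \<circ> (g ^^ b))" using assms by (simp add: o_assoc)
    also have "\<dots> = (g ^^ Suc b) \<circ> f" by (simp only: Suc funpow.simps o_assoc)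
    finally show ?case .
  qed simp
  show ?thesis
  proof (induction a)
    case (Suc a)
    have "(f ^^ Suc a) \<circ> (g ^^ b) = f \<circ> ((f ^^ a) \<circ> (g ^^ b))" by (simp add: o_assoc)
    also have "\<dots> = (f \<circ> (g ^^ b)) \<circ> (f ^^ a)" by (simp only: Suc o_assoc)
    also have "\<dots> = (g ^^ b) \<circ> (f ^^ Suc a)" by (simp only: 1 funpow.simps o_assoc)
    finally show ?case .
  qed simp
qed

text \<open>On squarefree polynomials the factorials in the derivatives are trivial, so that operators act
  by contraction.\<close>

definition squarefree_poly :: "'k::comm_ring_1 mpoly \<Rightarrow> bool" where
  "squarefree_poly p \<longleftrightarrow> (\<forall>m\<in>kys p. \<forall>v. lkp m v \<le> 1)"

lemma partial_deriv_squarefree: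
  assumes "squarefree_poly p"
  shows "lkp (partial_deriv v p) u = lkp p (u + sgl v 1)" "squarefree_poly (partial_deriv v p)"
proof -
  have *: "lkp (partial_deriv v p) u = lkp p (u + sgl v 1)" for u
  proof (cases "lkp p (u + sgl v 1) = 0")
    case False
    then have "u + sgl v 1 \<in> kys p" by (simp add: in_kys)
    then have "lkp (u + sgl v 1) v \<le> 1"
      using assms unfolding squarefree_poly_def by blast
    then have "lkp u v = 0" by (simp add: lookup_add)
    then show ?thesis by (simp add: lookup_partial_deriv)
  qed (simp add: lookup_partial_deriv)
  then show "lkp (partial_deriv v p) u = lkp p (u + sgl v 1)" .
  show "squarefree_poly (partial_deriv v p)"
    unfolding squarefree_poly_def
  proof (intro ballI allI)
    fix m w assume "m \<in> kys (partial_deriv v p)"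
    then have "m + sgl v 1 \<in> kys p" by (simp add: in_kys *)
    then have "lkp (m + sgl v 1) w \<le> 1" using assms unfolding squarefree_poly_def by blast
    then show "lkp m w \<le> 1" by (simp add: lookup_add)
  qed
qed

lemma partial_deriv_funpow_squarefree:
  assumes "squarefree_poly p"
  shows "squarefree_poly ((partial_deriv v ^^ k) p) \<and> (\<forall>u. lkp ((partial_deriv v ^^ k) p) u = lkp p (u + sgl v k))"
proof (induction k)
  case (Suc k)
  have "u + sgl v 1 + sgl v k = u + sgl v (Suc k)" for u
    by (simp add: add.assoc flip: single_add)
  then show ?case using Suc partial_deriv_squarefree[of "(partial_deriv v ^^ k) p" v] by simp
qed (use assms in simp)

lemma lookup_monomial_operator:
  assumes p: "squarefree_poly p"
  shows "lkp (monomial_operator m p) u = lkp p (u + m)"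
proof -
  let ?f = "\<lambda>v. partial_deriv v ^^ lkp m v :: 'a mpoly \<Rightarrow> 'a mpoly"
  interpret comp_fun_commute ?f
  proof
    fix v w show "?f w \<circ> ?f v = ?f v \<circ> ?f w"
      by (rule funpow_commute[OF partial_deriv_commute[of w v]])
  qed
  have "squarefree_poly (Finite_Set.fold ?f p A) \<and>
      (\<forall>u. lkp (Finite_Set.fold ?f p A) u = lkp p (u + (\<Sum>v\<in>A. sgl v (lkp m v))))" if "finite A" for A
    using that
  proof (induction A rule: finite_induct)
    case (insert v A)
    then show ?case
      using partial_deriv_funpow_squarefree[of "Finite_Set.fold ?f p A" "lkp m v" v]
      by (simp add: ac_simps)
  qed (use p in simp)
  then show ?thesis
    using sum_of_terms[of m] by (simp add: monomial_operator_def)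
qed

lemma lookup_apply_operator:
  assumes "squarefree_poly p"
  shows "lkp (apply_operator q p) u = (\<Sum>m\<in>kys q. lkp q m * lkp p (u + m))"
  unfolding apply_operator_def lookup_sum pconst_def
proof (rule sum.cong[OF refl])
  fix m
  show "lkp (sgl 0 (lkp q m) * monomial_operator m p) u = lkp q m * lkp p (u + m)"
    using lookup_monomial_mult[of 0 "lkp q m" "monomial_operator m p" u]
    by (simp add: lookup_monomial_operator[OF assms])
qed

context simplicial
begin

definition zx :: "nat set \<Rightarrow> var \<Rightarrow>\<^sub>0 nat" where
  "zx F = sgl (Zv F) 1 + vmon Xv F"

lemma f_\<Delta>_eq: "f_\<Delta> \<Delta> = (\<Sum>F\<in>facets \<Delta>. mono1 (zx F))"
  by (simp add: f_\<Delta>_def pvar_mono xmon_mono mult_single zx_def)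

lemma lookup_zx: "F \<in> facets \<Delta> \<Longrightarrow> lkp (zx F) (Xv i) = (if i \<in> F then 1 else 0)"
  "F \<in> facets \<Delta> \<Longrightarrow> lkp (zx F) (Yv i) = 0"
  "F \<in> facets \<Delta> \<Longrightarrow> lkp (zx F) (Zv G) = (if F = G then 1 else 0)"
  by (simp_all add: zx_def lookup_add lookup_vmon facet_finite lookup_single when_def)

lemma zx_inj: "F \<in> facets \<Delta> \<Longrightarrow> F' \<in> facets \<Delta> \<Longrightarrow> zx F = zx F' \<Longrightarrow> F = F'"
proof -
  assume F: "F \<in> facets \<Delta>" "F' \<in> facets \<Delta>" "zx F = zx F'"
  show "F = F'"
  proof (rule ccontr)
    assume "F \<noteq> F'"
    then have "lkp (zx F') (Zv F) = 0" using lookup_zx(3)[OF F(2), of F] by simp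
    moreover have "lkp (zx F) (Zv F) = 1" using lookup_zx(3)[OF F(1), of F] by simp
    ultimately show False unfolding F(3) by simp
  qed
qed

lemma lookup_f_\<Delta>:
  "lkp (f_\<Delta> \<Delta> :: 'k::comm_ring_1 mpoly) w = (if \<exists>F\<in>facets \<Delta>. w = zx F then 1 else 0)"
proof (cases "\<exists>F\<in>facets \<Delta>. w = zx F")
  case True
  then obtain F where F: "F \<in> facets \<Delta>" "w = zx F" by blast
  have "lkp (f_\<Delta> \<Delta> :: 'k mpoly) w = (\<Sum>F'\<in>facets \<Delta>. if F' = F then 1 else 0)"
    unfolding f_\<Delta>_eq lookup_sum
    by (rule sum.cong) (use F zx_inj in \<open>auto simp: lookup_single when_def\<close>)
  then show ?thesis using F finite_facets by auto
next
  case False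
  then have "(1 when zx F = w) = (0::'k)" if "F \<in> facets \<Delta>" for F
    using that by (auto simp: when_def)
  then show ?thesis using False by (simp add: f_\<Delta>_eq lookup_sum lookup_single)
qed

lemma squarefree_f_\<Delta>: "squarefree_poly (f_\<Delta> \<Delta> :: 'k::comm_ring_1 mpoly)"
  unfolding squarefree_poly_def
proof (intro ballI allI)
  fix m v assume "m \<in> kys (f_\<Delta> \<Delta> :: 'k mpoly)"
  then obtain F where F: "F \<in> facets \<Delta>" "m = zx F"
    by (auto simp: in_kys lookup_f_\<Delta> split: if_splits)
  then show "lkp m v \<le> 1" by (cases v) (simp_all add: lookup_zx)
qed

lemma lookup_apply_f:
  fixes q :: "'k::comm_ring_1 mpoly"
  shows "lkp (apply_operator q (f_\<Delta> \<Delta>)) u = (\<Sum>m | m \<in> kys q \<and> (\<exists>F\<in>facets \<Delta>. u + m = zx F). lkp q m)"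
  by (simp add: lookup_apply_operator[OF squarefree_f_\<Delta>] lookup_f_\<Delta> sum.If_cases Int_def
      if_distrib[of "\<lambda>x. _ * x"] cong: if_cong)

abbreviation full where "full \<equiv> {1..n}"

lemma vmon_tv_full: "G \<subseteq> full \<Longrightarrow> vmon (tv full) G = vmon Xv G"
  unfolding vmon_def by (rule sum.cong) (auto simp: tv_def)

lemma VQ_reduced: "VQ n \<Delta> = VS_K n full \<union> zvars \<Delta>"
  by (auto simp: VQ_def VS_K_def)

lemma vmon_compl: "H \<subseteq> full \<Longrightarrow> vmon Xv (full - H) + vmon Xv H = vmon Xv full"
proof -
  assume H: "H \<subseteq> full"
  have "(full - H) \<inter> H = {}" "full - H \<union> H = full" using H by blast+
  then show ?thesis
    using vmon_union[of "full - H" H Xv] finite_subset[OF H] by (simp only: finite_Diff finite_atLeastAtMost)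
qed

text \<open>The coefficient of $\mathbf{x}^H$ in $q \cdot f_\Delta$ collects the terms $z_F \mathbf{x}^{F \setminus H}$ of
  \<open>q\<close>, whose normal form is $\mathbf{x}^{[n] \setminus H}$.\<close>

lemma match_linear:
  assumes m: "m \<in> mons (VQ n \<Delta>)" and H: "H \<subseteq> full"
  shows "nf n full m = (1, vmon Xv (full - H)) \<longleftrightarrow> (\<exists>F\<in>facets \<Delta>. vmon Xv H + m = zx F)"
proof -
  have finH: "finite H" using H finite_subset by blast
  have m': "m \<in> mons (VS_K n full \<union> zvars \<Delta>)" using m by (simp add: VQ_reduced)
  show ?thesis
    using m'
  proof (cases rule: monomial_cases)
    case 0
    have "vmon Xv H + m \<noteq> zx F" if F: "F \<in> facets \<Delta>" for F
    proof
      assume "vmon Xv H + m = zx F"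
      then have "lkp (vmon Xv H + m) (Zv F) = lkp (zx F) (Zv F)" by simp
      moreover have "lkp m (Zv F) = 0" using 0 unfolding mons_iff by (metis VS_K_mem(3))
      ultimately show False using F finH by (simp add: lookup_add lookup_vmon lookup_zx)
    qed
    then show ?thesis using nf_reduced[OF 0] by simp
  next
    case (1 F m1)
    have nfm: "nf n full m = (1, vmon Xv (full - F) + m1)"
      unfolding 1(3) nf_add using nf_reduced[OF 1(2)] by (simp add: vmon_tv_full[simplified])
    have F: "F \<subseteq> full" by (rule facet_sub[OF 1(1)])
    have "vmon Xv (full - F) + m1 = vmon Xv (full - H) \<longleftrightarrow>
        (vmon Xv (full - F) + m1) + (vmon Xv H + vmon Xv F) = vmon Xv (full - H) + (vmon Xv H + vmon Xv F)"
      by simp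
    also have "(vmon Xv (full - F) + m1) + (vmon Xv H + vmon Xv F) =
        (vmon Xv (full - F) + vmon Xv F) + (m1 + vmon Xv H)" by (simp add: ac_simps)
    also have "\<dots> = vmon Xv full + (m1 + vmon Xv H)" by (simp only: vmon_compl[OF F])
    also have "vmon Xv (full - H) + (vmon Xv H + vmon Xv F) =
        (vmon Xv (full - H) + vmon Xv H) + vmon Xv F" by (simp add: ac_simps)
    also have "\<dots> = vmon Xv full + vmon Xv F" by (simp only: vmon_compl[OF H])
    finally have eq: "nf n full m = (1, vmon Xv (full - H)) \<longleftrightarrow> m1 + vmon Xv H = vmon Xv F"
      by (simp only: nfm prod.inject simp_thms add_left_cancel)
    show ?thesis
    proof
      assume "nf n full m = (1, vmon Xv (full - H))"
      then have e: "m1 + vmon Xv H = vmon Xv F" using eq by simp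
      have "vmon Xv H + m = sgl (Zv F) 1 + (m1 + vmon Xv H)"
        by (simp add: 1(3) ac_simps)
      then have "vmon Xv H + m = zx F" by (simp only: e zx_def)
      then show "\<exists>F\<in>facets \<Delta>. vmon Xv H + m = zx F" using 1(1) by blast
    next
      assume "\<exists>F\<in>facets \<Delta>. vmon Xv H + m = zx F"
      then obtain F' where F': "F' \<in> facets \<Delta>" "vmon Xv H + m = zx F'" by blast
      have "lkp (vmon Xv H + m) (Zv F) = lkp (zx F') (Zv F)" by (simp add: F'(2))
      then have "F' = F" using F'(1) by (simp add: 1(3) lookup_add lookup_zx split: if_splits)
      then have "sgl (Zv F) 1 + (m1 + vmon Xv H) = sgl (Zv F) 1 + vmon Xv F"
        using F'(2) by (simp add: 1(3) zx_def ac_simps)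
      then show "nf n full m = (1, vmon Xv (full - H))" using eq by simp
    qed
  next
    case (2 F F' m2)
    have "fst (nf n full m) \<ge> 2" unfolding 2(4) by (simp add: nf_add)
    then have "nf n full m \<noteq> (1, vmon Xv (full - H))" by auto
    moreover have "vmon Xv H + m \<noteq> zx G" if G: "G \<in> facets \<Delta>" for G
    proof
      assume "vmon Xv H + m = zx G"
      then have *: "lkp (vmon Xv H + m) v = lkp (zx G) v" for v by simp
      have "F = G" using *[of "Zv F"] G by (simp add: 2(4) lookup_add lookup_zx split: if_splits)
      moreover have "F' = G" using *[of "Zv F'"] G by (simp add: 2(4) lookup_add lookup_zx split: if_splits)
      ultimately show False using *[of "Zv G"] G by (simp add: 2(4) lookup_add lookup_zx)
    qed
    ultimately show ?thesis by blast
  qed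
qed

lemma match_constant:
  assumes m: "m \<in> mons (VQ n \<Delta>)" and F: "F \<in> facets \<Delta>" and G: "G \<subseteq> F"
  shows "nf n full m = (0, vmon Xv G) \<longleftrightarrow>
    (\<exists>F'\<in>facets \<Delta>. (sgl (Zv F) 1 + vmon Xv (F - G)) + m = zx F')"
proof -
  have fin: "finite F" "finite G" using F G facet_finite finite_subset by blast+
  have sp: "vmon Xv F = vmon Xv (F - G) + vmon Xv G"
  proof -
    have "(F - G) \<inter> G = {}" "F - G \<union> G = F" using G by blast+
    then show ?thesis using vmon_union[of "F - G" G Xv] fin by simp
  qed
  have "nf n full m = (0, vmon Xv G) \<longleftrightarrow> m = vmon Xv G"
  proof
    assume "m = vmon Xv G"
    moreover have "vmon Xv G \<in> mons (VS_K n full)"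
      by (rule vmon_closed) (use G facet_sub[OF F] in auto)
    ultimately show "nf n full m = (0, vmon Xv G)" using nf_reduced by simp
  next
    assume a: "nf n full m = (0, vmon Xv G)"
    have m': "m \<in> mons (VS_K n full \<union> zvars \<Delta>)" using m by (simp add: VQ_reduced)
    then show "m = vmon Xv G"
    proof (cases rule: monomial_cases)
      case 0
      then show ?thesis using a nf_reduced[OF 0] by simp
    next
      case (1 F m1)
      then have "fst (nf n full m) \<noteq> 0" unfolding 1(3) by (simp add: nf_add)
      then show ?thesis using a by simp
    next
      case (2 F F' m2)
      then have "fst (nf n full m) \<noteq> 0" unfolding 2(4) by (simp add: nf_add)
      then show ?thesis using a by simp
    qed
  qed
  also have "m = vmon Xv G \<longleftrightarrow> (sgl (Zv F) 1 + vmon Xv (F - G)) + m = zx F"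
    by (simp add: zx_def sp add.assoc)
  also have "\<dots> \<longleftrightarrow> (\<exists>F'\<in>facets \<Delta>. (sgl (Zv F) 1 + vmon Xv (F - G)) + m = zx F')"
  proof
    assume "\<exists>F'\<in>facets \<Delta>. (sgl (Zv F) 1 + vmon Xv (F - G)) + m = zx F'"
    then obtain F' where F': "F' \<in> facets \<Delta>" "(sgl (Zv F) 1 + vmon Xv (F - G)) + m = zx F'" by blast
    have "lkp ((sgl (Zv F) 1 + vmon Xv (F - G)) + m) (Zv F) = lkp (zx F') (Zv F)"
      by (simp only: F'(2))
    then have "F' = F" using F'(1) by (simp add: lookup_add lookup_zx split: if_splits)
    then show "(sgl (Zv F) 1 + vmon Xv (F - G)) + m = zx F" using F'(2) by simp
  qed (use F in blast)
  finally show ?thesis .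
qed

lemma coefficient_linear:
  fixes q :: "'k::comm_ring_1 mpoly"
  assumes q: "q \<in> carrier (poly_ring (VQ n \<Delta>))" and H: "H \<subseteq> full"
  shows "lkp (apply_operator q (f_\<Delta> \<Delta>)) (vmon Xv H) = lkp (push (nf n full) q) (1, vmon Xv (full - H))"
  unfolding lookup_apply_f lookup_push
  by (rule sum.cong) (use q match_linear[OF _ H] in \<open>auto simp: carrier_poly_ring subset_iff\<close>)

lemma coefficient_constant:
  fixes q :: "'k::comm_ring_1 mpoly"
  assumes q: "q \<in> carrier (poly_ring (VQ n \<Delta>))" and F: "F \<in> facets \<Delta>" and G: "G \<subseteq> F"
  shows "lkp (apply_operator q (f_\<Delta> \<Delta>)) (sgl (Zv F) 1 + vmon Xv (F - G)) =
    lkp (push (nf n full) q) (0, vmon Xv G)"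
  unfolding lookup_apply_f lookup_push
  by (rule sum.cong) (use q match_constant[OF _ F G] in \<open>auto simp: carrier_poly_ring subset_iff\<close>)

lemma squarefree_monomial:
  assumes w: "w \<in> mons (xvars n)" and nb: "\<not> bad full w"
  shows "w = vmon Xv (xsupp w)"
proof (rule poly_mapping_eqI)
  fix v
  have fin: "finite (xsupp w)" by (simp add: xsupp_def)
  show "lkp w v = lkp (vmon Xv (xsupp w)) v"
  proof (cases v)
    case (Xv j)
    show ?thesis
    proof (cases "j \<in> full")
      case True
      then have "\<not> 2 \<le> lkp w (Xv j)" using nb unfolding bad_def by auto
      then show ?thesis using True fin by (simp add: Xv lookup_vmon) (auto simp: xsupp_def)
    next
      case False
      then have "lkp w (Xv j) = 0" using w unfolding mons_iff by (metis var_mem(1))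
      then show ?thesis using False fin by (simp add: Xv lookup_vmon) (auto simp: xsupp_def)
    qed
  next
    case (Yv j)
    then show ?thesis using w fin unfolding mons_iff by (metis lookup_vmon(2) var_mem(4))
  next
    case (Zv F)
    then show ?thesis using w fin unfolding mons_iff by (metis lookup_vmon(5) var_mem(5))
  qed
qed

text \<open>After identifying all $y_i$ with $x_i$, the relations generate the annihilator of $f_\Delta$: the
  coefficients of $q \cdot f_\Delta$ are those of the normal form of \<open>q\<close> at the monomials that do not
  vanish.\<close>

theorem annihilator_rel_ideal:
  fixes q :: "'k::comm_ring_1 mpoly"
  assumes q: "q \<in> carrier (poly_ring (VQ n \<Delta>))"
  shows "apply_operator q (f_\<Delta> \<Delta>) = 0 \<longleftrightarrow> q \<in> rel_ideal full"
proof
  have qT: "q \<in> carrier T" using q carrier_mono[OF V_sub(2)] by blast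
  {
    assume z: "apply_operator q (f_\<Delta> \<Delta>) = 0"
    have "lkp (push (nf n full) q) (e, w) = 0" if nd: "(e, w) \<notin> dead full" for e w
    proof (rule ccontr)
      assume "lkp (push (nf n full) q) (e, w) \<noteq> 0"
      then have "(e, w) \<in> nf n full ` kys q" using keys_push[of "nf n full" q] by (auto simp: in_kys)
      then obtain m where m: "m \<in> mons (VS_K n full \<union> zvars \<Delta>)" "nf n full m = (e, w)"
        using q by (auto simp: carrier_poly_ring VQ_reduced subset_iff)
      have e: "e = 0 \<or> e = 1" using nd by (auto simp: dead_def)
      have "w \<in> mons (xvars n)"
        using m(1)
      proof (cases rule: monomial_cases)
        case 0
        then show ?thesis using nf_reduced[OF 0] m(2) VS_K_sub(3) by simp
      next
        case (1 F m1)
        have "nf n full m = (1, vmon Xv (full - F) + m1)"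
          unfolding 1(3) nf_add using nf_reduced[OF 1(2)] by (simp add: vmon_tv_full[simplified])
        then have "w = vmon Xv (full - F) + m1" using m(2) by (simp only: prod.inject)
        moreover have "vmon Xv (full - F) \<in> mons (xvars n)" by (rule vmon_closed) auto
        ultimately show ?thesis using 1(2) VS_K_sub(3) by (simp add: mons_add)
      next
        case (2 F F' m2)
        have "fst (nf n full m) \<ge> 2" unfolding 2(4) by (simp add: nf_add)
        then show ?thesis using m(2) e by simp
      qed
      then have w: "w = vmon Xv (xsupp w)"
        using nd by (intro squarefree_monomial) (auto simp: dead_def)
      have sub: "xsupp w \<subseteq> full" by (auto simp: xsupp_def)
      from e show False
      proof
        assume "e = 0"
        then have "xsupp w \<in> \<Delta>" using nd by (simp add: dead_def)
        then obtain F where F: "F \<in> facets \<Delta>" "xsupp w \<subseteq> F" using face_in_facet by blast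
        show False
          using coefficient_constant[OF q F] z w \<open>e = 0\<close> \<open>lkp (push (nf n full) q) (e, w) \<noteq> 0\<close> by simp
      next
        assume "e = 1"
        have "full - (full - xsupp w) = xsupp w" using sub by blast
        then show False
          using coefficient_linear[OF q, of "full - xsupp w"] z w \<open>e = 1\<close>
            \<open>lkp (push (nf n full) q) (e, w) \<noteq> 0\<close> by simp
      qed
    qed
    then show "q \<in> rel_ideal full" using qT by (auto simp: rel_ideal_def in_kys)
  }
  assume rel_ideal: "q \<in> rel_ideal full"
  then have nul: "lkp (push (nf n full) q) w = 0" if "w \<notin> dead full" for w
    using that by (auto simp: rel_ideal_def in_kys)
  show "apply_operator q (f_\<Delta> \<Delta>) = 0"
  proof (rule poly_mapping_eqI)
    fix u
    show "lkp (apply_operator q (f_\<Delta> \<Delta>)) u = lkp 0 u"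
    proof (cases "\<exists>m F. F \<in> facets \<Delta> \<and> u + m = zx F")
      case False
      then have "{m. m \<in> kys q \<and> (\<exists>F\<in>facets \<Delta>. u + m = zx F)} = {}" by blast
      then show ?thesis unfolding lookup_apply_f by (simp only: sum.empty lookup_zero)
    next
      case True
      then obtain m F where F: "F \<in> facets \<Delta>" and um: "u + m = zx F" by (elim exE conjE)
      have fin: "finite F" by (rule facet_finite[OF F])
      have le: "lkp u v \<le> lkp (zx F) v" for v
        unfolding um[symmetric] by (simp add: lookup_add)
      define H where "H = {j \<in> F. lkp u (Xv j) \<noteq> 0}"
      have HF: "H \<subseteq> F" "finite H" using fin by (auto simp: H_def)
      have ux: "lkp u (Xv j) = (if j \<in> H then 1 else 0)" for j
        using le[of "Xv j"] F by (auto simp: H_def lookup_zx split: if_splits)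
      have uy: "lkp u (Yv j) = 0" for j
        using le[of "Yv j"] F by (simp add: lookup_zx)
      have uz: "lkp u (Zv G) = 0" if "G \<noteq> F" for G
        using le[of "Zv G"] F that by (auto simp: lookup_zx split: if_splits)
      show ?thesis
      proof (cases "lkp u (Zv F) = 0")
        case True
        have "u = vmon Xv H"
        proof (rule poly_mapping_eqI)
          fix v show "lkp u v = lkp (vmon Xv H) v"
          proof (cases v)
            case (Zv G)
            then show ?thesis using uz[of G] True HF(2) by (cases "G = F") (simp_all add: lookup_vmon)
          qed (simp_all add: ux uy lookup_vmon HF(2))
        qed
        moreover have Hn: "H \<subseteq> full" using HF(1) facet_sub[OF F] by blast
        moreover have "(1, vmon Xv (full - H)) \<notin> dead full"
          by (simp add: dead_def bad_def lookup_vmon)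
        ultimately show ?thesis
          using coefficient_linear[OF q Hn] nul by simp
      next
        case False
        then have z1: "lkp u (Zv F) = 1" using le[of "Zv F"] F by (simp add: lookup_zx)
        have FF: "F - (F - H) = H" using HF by blast
        have "u = sgl (Zv F) 1 + vmon Xv H"
        proof (rule poly_mapping_eqI)
          fix v show "lkp u v = lkp (sgl (Zv F) 1 + vmon Xv H) v"
          proof (cases v)
            case (Zv G)
            then show ?thesis
              using uz[of G] z1 HF(2)
              by (cases "G = F") (simp_all add: lookup_vmon lookup_add lookup_single)
          qed (simp_all add: ux uy lookup_vmon HF(2) lookup_add lookup_single)
        qed
        then have u: "u = sgl (Zv F) 1 + vmon Xv (F - (F - H))" by (simp only: FF)
        have xs: "xsupp (vmon Xv (F - H)) = F - H"
          using facet_sub[OF F] fin by (auto simp: xsupp_def lookup_vmon)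
        have "F - H \<in> \<Delta>" by (rule face_down[OF facet_face[OF F]]) blast
        then have "(0, vmon Xv (F - H)) \<notin> dead full"
          using xs fin by (simp add: dead_def bad_def lookup_vmon)
        then show ?thesis
          using coefficient_constant[OF q F, of "F - H"] nul u by simp
      qed
    qed
  qed
qed

end

section \<open>Presentations and their quotients by $y_i - x_i$\<close>

abbreviation \<theta> :: "nat \<Rightarrow> 'k::comm_ring_1 mpoly" where
  "\<theta> i \<equiv> mono1 (sgl (Yv i) 1) - mono1 (sgl (Xv i) 1)"

lemma ring_hom_image_ideal:
  fixes R (structure) and S (structure)
  assumes h: "ring_hom_ring R S h" and surj: "h ` carrier R = carrier S" and I: "ideal I R"
  shows "ideal (h ` I) S"
proof -
  interpret h: ring_hom_ring R S h by fact
  interpret I: ideal I R by fact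
  show ?thesis
  proof (rule idealI[OF h.S.ring_axioms])
    show "subgroup (h ` I) (add_monoid S)"
      by (rule h.img_is_add_subgroup[OF I.a_subgroup])
  next
    fix a x assume a: "a \<in> h ` I" and x: "x \<in> carrier S"
    from a obtain i where i: "i \<in> I" "a = h i" by blast
    from x surj obtain t where t: "t \<in> carrier R" "x = h t" by blast
    have ic: "i \<in> carrier R" using i(1) I.Icarr by simp
    show "x \<otimes>\<^bsub>S\<^esub> a \<in> h ` I"
      by (rule image_eqI[of _ _ "t \<otimes>\<^bsub>R\<^esub> i"]) (use i t ic I.I_l_closed in simp_all)
    show "a \<otimes>\<^bsub>S\<^esub> x \<in> h ` I"
      by (rule image_eqI[of _ _ "i \<otimes>\<^bsub>R\<^esub> t"]) (use i t ic I.I_r_closed in simp_all)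
  qed
qed

context simplicial
begin

lemma theta_closed: "i \<in> {1..n} \<Longrightarrow> \<theta> i \<in> carrier T"
  by (intro poly_ring_closed) (simp_all add: mons_single)

lemma rel_ideal_mono_empty: "(rel_ideal {} :: 'k::comm_ring_1 mpoly set) \<subseteq> rel_ideal K"
  using relations_least[OF rel_ideal_contains] by (simp add: relations_rel_ideal)

lemma contains_relations_superset:
  fixes J :: "'k::comm_ring_1 mpoly set"
  assumes "ideal J T" "relations_R n \<Delta> \<subseteq> J"
  shows "contains_relations J"
proof -
  note r = contains_relationsD[OF relations_props]
  show ?thesis
    unfolding contains_relations_def
    by (intro conjI ballI allI impI assms(1); rule subsetD[OF assms(2)]; rule r; assumption)
qed

text \<open>The ring is abstract here, since the results apply to every presentation of $R_\Delta$, not only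
  to the one constructed from the colon ideal.\<close>

context
  fixes R :: "('r, 'm) ring_scheme" and h :: "'k::comm_ring_1 mpoly \<Rightarrow> 'r"
  assumes h: "ring_hom_ring T R h" and surj: "h ` carrier T = carrier R"
    and ker: "a_kernel T R h = relations_R n \<Delta>"
begin

interpretation h: ring_hom_ring T R h by (rule h)

text \<open>The preimage of the ideal on the left is the smallest ideal that contains the kernel, which is
  given by the relations, and the elements $y_j - x_j$ with $j \in K$.\<close>

lemma preimage_ideal:
  assumes K: "K \<subseteq> {1..n}" and t: "t \<in> carrier T"
  shows "h t \<in> Idl\<^bsub>R\<^esub> (h ` \<theta> ` K) \<longleftrightarrow> t \<in> rel_ideal K"
proof -
  have cl: "h ` \<theta> ` K \<subseteq> carrier R"
    using K theta_closed h.hom_closed by blast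
  note B = ideal_poly_ringD[OF ideal_rel_ideal]
  show ?thesis
  proof
    assume "h t \<in> Idl\<^bsub>R\<^esub> (h ` \<theta> ` K)"
    moreover have "h ` \<theta> ` K \<subseteq> h ` rel_ideal K"
      using theta_in_rel_ideal K by blast
    then have "Idl\<^bsub>R\<^esub> (h ` \<theta> ` K) \<subseteq> h ` rel_ideal K"
      by (rule h.S.genideal_minimal[OF ring_hom_image_ideal[OF h surj ideal_rel_ideal]])
    ultimately obtain b where b: "b \<in> rel_ideal K" "h t = h b" by blast
    have bT: "b \<in> carrier T" using b(1) B(1) by blast
    have "t \<in> a_kernel T R h +>\<^bsub>T\<^esub> b" by (rule h.homeq_imp_rcos[OF bT t b(2)])
    then have "\<exists>k\<in>a_kernel T R h. t = k + b" by (simp add: a_r_coset_def')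
    then obtain k where k: "k \<in> a_kernel T R h" "t = k + b" by (elim bexE)
    have "k \<in> rel_ideal K" using k(1) rel_ideal_mono_empty unfolding ker relations_rel_ideal by blast
    then show "t \<in> rel_ideal K" unfolding k(2) by (rule B(3)[OF _ b(1)])
  next
    assume tB: "t \<in> rel_ideal K"
    have id: "ideal (Idl\<^bsub>R\<^esub> (h ` \<theta> ` K)) R" by (rule h.S.genideal_ideal[OF cl])
    let ?J = "{p \<in> carrier T. h p \<in> Idl\<^bsub>R\<^esub> (h ` \<theta> ` K)}"
    have J: "ideal ?J T" by (rule h.ideal_vimage[OF id])
    have z: "\<zero>\<^bsub>R\<^esub> \<in> Idl\<^bsub>R\<^esub> (h ` \<theta> ` K)"
      by (rule additive_subgroup.zero_closed[OF ideal.axioms(1)[OF id]])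
    have "relations_R n \<Delta> \<subseteq> ?J"
    proof
      fix p :: "'k mpoly" assume "p \<in> relations_R n \<Delta>"
      then have "p \<in> a_kernel T R h" by (simp only: ker)
      then have "p \<in> carrier T" "h p = \<zero>\<^bsub>R\<^esub>"
        unfolding a_kernel_def'[of T R h] by (simp_all only: mem_Collect_eq)
      then show "p \<in> ?J" using z by (simp only: mem_Collect_eq simp_thms)
    qed
    then have "contains_relations ?J" by (rule contains_relations_superset[OF J])
    moreover have "\<theta> j \<in> ?J" if "j \<in> K" for j
    proof -
      have "h (\<theta> j) \<in> Idl\<^bsub>R\<^esub> (h ` \<theta> ` K)"
        by (rule subsetD[OF h.S.genideal_self[OF cl]]) (use that in simp)
      moreover have "\<theta> j \<in> carrier T" by (rule theta_closed) (use that K in blast)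
      ultimately show ?thesis by (simp only: mem_Collect_eq simp_thms)
    qed
    ultimately have "rel_ideal K \<subseteq> ?J" by (rule rel_ideal_least[OF _ K])
    then show "h t \<in> Idl\<^bsub>R\<^esub> (h ` \<theta> ` K)" using tB by blast
  qed
qed

lemma regular_sequence_theta: "regular_sequence R (map (\<lambda>i. h (\<theta> i)) [1..<Suc n])"
proof -
  let ?as = "map (\<lambda>i. h (\<theta> i)) [1..<Suc n]"
  have set: "set (take i ?as) = h ` \<theta> ` {1..i}" if "i \<le> n" for i
  proof -
    have "set (take i ?as) = (\<lambda>i. h (\<theta> i)) ` {1..<Suc i}"
      using that by (simp add: take_map take_upt del: upt_Suc)
    also have "{1..<Suc i} = {1..i}" by auto
    finally show ?thesis by (simp add: image_image)
  qed
  have full: "set ?as = h ` \<theta> ` {1..n}" using set[of n] by simp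
  show ?thesis
    unfolding regular_sequence_def
  proof (intro conjI allI impI ballI)
    show "set ?as \<subseteq> carrier R"
      unfolding full using theta_closed h.hom_closed by blast
  next
    fix i r assume i: "i < length ?as" and r: "r \<in> carrier R"
      and prod: "?as ! i \<otimes>\<^bsub>R\<^esub> r \<in> Idl\<^bsub>R\<^esub> (set (take i ?as))"
    have i': "i < n" using i by (simp del: upt_Suc)
    from r surj obtain t where t: "t \<in> carrier T" "r = h t" by blast
    have sub: "{1..i} \<subseteq> {1..n}" and si: "Suc i \<in> {1..n}" "Suc i \<notin> {1..i}" using i' by auto
    have "?as ! i = h (\<theta> (Suc i))" using i' by (simp del: upt_Suc)
    then have "?as ! i \<otimes>\<^bsub>R\<^esub> r = h (\<theta> (Suc i) * t)"
      using h.hom_mult[OF theta_closed[OF si(1)] t(1)] t(2) by simp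
    then have "h (\<theta> (Suc i) * t) \<in> Idl\<^bsub>R\<^esub> (h ` \<theta> ` {1..i})"
      using prod set[of i] i' by simp
    moreover have "\<theta> (Suc i) * t \<in> carrier T"
      by (rule poly_ring_closed(5)[OF theta_closed[OF si(1)] t(1)])
    ultimately have "\<theta> (Suc i) * t \<in> rel_ideal {1..i}" using preimage_ideal[OF sub] by blast
    then have "t \<in> rel_ideal {1..i}" by (rule theta_regular[OF si t(1)])
    then show "r \<in> Idl\<^bsub>R\<^esub> (set (take i ?as))"
      using preimage_ideal[OF sub t(1)] set[of i] i' t(2) by simp
  next
    have "1 \<in> carrier T" by (rule poly_ring_closed)
    moreover have "h 1 \<in> carrier R" using h.hom_closed[of 1] by (simp add: poly_ring_closed)
    ultimately show "Idl\<^bsub>R\<^esub> (set ?as) \<noteq> carrier R"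
      using preimage_ideal[OF order_refl, of 1] one_notin_rel_ideal unfolding full by auto
  qed
qed

text \<open>The substitution $y_i \mapsto x_i$, a retraction of $S[z_F]$ onto $Q$.\<close>

definition subst_yx :: "'k mpoly \<Rightarrow> 'k mpoly" where
  "subst_yx t = push (collapse full) t"

lemma subst_yx:
  assumes t: "t \<in> carrier T"
  shows "subst_yx t \<in> carrier (poly_ring (VQ n \<Delta>))" "t - subst_yx t \<in> rel_ideal full"
    and "homog e t \<Longrightarrow> homog e (subst_yx t)"
proof -
  have "collapse full m \<in> mons (VQ n \<Delta>)" if "m \<in> kys t" for m
    using collapse_closed[of m n \<Delta> full] t that by (auto simp: VQ_reduced carrier_poly_ring)
  then show Q: "subst_yx t \<in> carrier (poly_ring (VQ n \<Delta>))"
    using keys_push[of "collapse full" t] by (auto simp: subst_yx_def carrier_poly_ring)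
  have "push (nf n full) (t - subst_yx t) = 0"
    by (simp add: push_diff subst_yx_def push_push comp_def nf_collapse)
  moreover have "t - subst_yx t \<in> carrier T"
    by (rule poly_ring_closed(4)[OF t]) (use Q carrier_mono[OF V_sub(2)] in blast)
  ultimately show "t - subst_yx t \<in> rel_ideal full" by (simp add: rel_ideal_def)
  show "homog e (subst_yx t)" if "homog e t"
    using that keys_push[of "collapse full" t]
    by (auto simp: homog_def subst_yx_def collapse_degree)
qed

text \<open>Every element of $S[z_F]$ is congruent to a polynomial in $Q$ modulo the elements
  $y_i - x_i$, so that $Q$ already maps onto the quotient. The kernel is the annihilator of $f_\Delta$
  by \<open>annihilator_rel_ideal\<close>.\<close>

lemma annihilator_quotient:
  defines "J \<equiv> Idl\<^bsub>R\<^esub> (h ` \<theta> ` {1..n})"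
  shows "\<exists>\<phi> \<in> ring_iso (ring_A n \<Delta>) (R Quot J).
    (\<forall>q \<in> carrier (poly_ring (VQ n \<Delta>)). \<phi> (class_A n \<Delta> q) = J +>\<^bsub>R\<^esub> h q) \<and>
    (\<forall>j. \<phi> ` A_grade n \<Delta> j = (\<lambda>t. J +>\<^bsub>R\<^esub> h t) ` {t \<in> carrier T. homog j t})"
proof -
  let ?Q = "poly_ring (VQ n \<Delta>) :: 'k mpoly ring"
  have QT: "carrier ?Q \<subseteq> carrier T" by (rule carrier_mono[OF V_sub(2)])
  have "h ` \<theta> ` {1..n} \<subseteq> carrier R" using theta_closed h.hom_closed by blast
  then have J: "ideal J R" unfolding J_def by (rule h.S.genideal_ideal)
  interpret J: ideal J R by (rule J)
  define c where "c t = J +>\<^bsub>R\<^esub> h t" for t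
  have c_hom: "ring_hom_ring T (R Quot J) c"
  proof (rule ring_hom_ringI2[OF ring_poly_ring J.quotient_is_ring])
    have "c = (+>\<^bsub>R\<^esub>) J \<circ> h" by (auto simp: c_def)
    then show "c \<in> Ring.ring_hom T (R Quot J)"
      using ring_hom_trans[OF h.homh J.rcos_ring_hom] by simp
  qed
  interpret c: ring_hom_ring T "R Quot J" c by (rule c_hom)
  have q_hom: "ring_hom_ring ?Q (R Quot J) c"
  proof (rule ring_hom_ringI[OF ring_poly_ring J.quotient_is_ring])
    fix x y assume "x \<in> carrier ?Q" "y \<in> carrier ?Q"
    then have xy: "x \<in> carrier T" "y \<in> carrier T" using QT by blast+
    show "c x \<in> carrier (R Quot J)" by (rule c.hom_closed[OF xy(1)])
    show "c (x \<otimes>\<^bsub>?Q\<^esub> y) = c x \<otimes>\<^bsub>R Quot J\<^esub> c y" using c.hom_mult[OF xy] by simp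
    show "c (x \<oplus>\<^bsub>?Q\<^esub> y) = c x \<oplus>\<^bsub>R Quot J\<^esub> c y" using c.hom_add[OF xy] by simp
  next
    show "c \<one>\<^bsub>?Q\<^esub> = \<one>\<^bsub>R Quot J\<^esub>" using c.hom_one by simp
  qed
  interpret q: ring_hom_ring ?Q "R Quot J" c by (rule q_hom)
  have c_eq0: "c t = \<zero>\<^bsub>R Quot J\<^esub> \<longleftrightarrow> t \<in> rel_ideal full" if t: "t \<in> carrier T" for t
  proof -
    have "c t = \<zero>\<^bsub>R Quot J\<^esub> \<longleftrightarrow> h t \<in> J"
      using J.rcos_const_imp_mem[OF h.hom_closed[OF t]] J.a_rcos_const[of "h t"]
      by (auto simp: c_def FactRing_def)
    then show ?thesis unfolding J_def using preimage_ideal[OF order_refl t] by simp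
  qed
  have c_cong: "c s = c t" if "s \<in> carrier T" "t \<in> carrier T" "s - t \<in> rel_ideal full" for s t
  proof -
    have d: "s - t \<in> carrier T" by (rule poly_ring_closed(4)[OF that(1,2)])
    have "c ((s - t) \<oplus>\<^bsub>T\<^esub> t) = c (s - t) \<oplus>\<^bsub>R Quot J\<^esub> c t" by (rule c.hom_add[OF d that(2)])
    also have "c (s - t) = \<zero>\<^bsub>R Quot J\<^esub>" using c_eq0[OF d] that(3) by simp
    finally show ?thesis using c.S.l_zero[OF c.hom_closed[OF that(2)]] by simp
  qed
  have c_subst: "c t = c (subst_yx t)" if "t \<in> carrier T" for t
    by (rule c_cong) (use that subst_yx[OF that] QT in auto)
  have surj_q: "c ` carrier ?Q = carrier (R Quot J)"
  proof -
    have "carrier (R Quot J) = (\<lambda>r. J +>\<^bsub>R\<^esub> r) ` carrier R"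
      by (auto simp: FactRing_def A_RCOSETS_def')
    also have "\<dots> = c ` carrier T" by (simp add: surj[symmetric] image_image c_def)
    also have "\<dots> = c ` carrier ?Q"
    proof
      show "c ` carrier T \<subseteq> c ` carrier ?Q" using c_subst subst_yx(1) by blast
    qed (use QT in blast)
    finally show ?thesis by simp
  qed
  have ker_q: "a_kernel ?Q (R Quot J) c = Ann_Q n \<Delta> (f_\<Delta> \<Delta>)"
    unfolding a_kernel_def'[of ?Q "R Quot J" c] Ann_Q_def rings
  proof (rule Collect_cong, rule conj_cong[OF refl])
    fix q assume q: "q \<in> carrier ?Q"
    show "c q = \<zero>\<^bsub>R Quot J\<^esub> \<longleftrightarrow> apply_operator q (f_\<Delta> \<Delta>) = 0"
      using c_eq0[OF subsetD[OF QT q]] annihilator_rel_ideal[OF q] by blast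
  qed
  define g where "g = (\<lambda>Y. the_elem (c ` Y))"
  have A: "ring_A n \<Delta> = ?Q Quot Ann_Q n \<Delta> (f_\<Delta> \<Delta>)" by (simp add: ring_A_def rings)
  have iso: "g \<in> ring_iso (ring_A n \<Delta>) (R Quot J)"
    using q.FactRing_iso_set[OF surj_q] by (simp only: ker_q A g_def)
  have val: "g (class_A n \<Delta> q) = c q" if "q \<in> carrier ?Q" for q
    using q.the_elem_simp[OF that] by (simp only: g_def ker_q class_A_def rings)
  have grade: "g ` A_grade n \<Delta> j = c ` {t \<in> carrier T. homog j t}" for j
  proof -
    have "g ` A_grade n \<Delta> j = c ` {q \<in> carrier ?Q. homog j q}"
      unfolding A_grade_def image_image rings by (rule image_cong[OF refl]) (rule val, blast)
    also have "\<dots> = c ` {t \<in> carrier T. homog j t}"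
    proof
      show "c ` {t \<in> carrier T. homog j t} \<subseteq> c ` {q \<in> carrier ?Q. homog j q}"
        using c_subst subst_yx(1,3) by blast
    qed (use QT in blast)
    finally show ?thesis .
  qed
  show ?thesis
  proof (rule bexI[OF _ iso], intro conjI ballI allI)
    fix q assume "q \<in> carrier ?Q"
    then show "g (class_A n \<Delta> q) = J +>\<^bsub>R\<^esub> h q" by (simp only: val c_def)
  next
    fix j
    have "c = (\<lambda>t. J +>\<^bsub>R\<^esub> h t)" by (simp add: fun_eq_iff c_def)
    then show "g ` A_grade n \<Delta> j = (\<lambda>t. J +>\<^bsub>R\<^esub> h t) ` {t \<in> carrier T. homog j t}"
      using grade[of j] by (simp only:)
  qed
qed

end

end

section \<open>The canonical module as a colon ideal\<close>

subsection \<open>Resolutions given by matrices\<close>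

text \<open>Extension by zero, as the cochains of the previous part are functions on all natural numbers.\<close>

definition vec_fun :: "'k::comm_ring_1 mpoly vec \<Rightarrow> nat \<Rightarrow> 'k mpoly" where
  "vec_fun v j = (if j < dim_vec v then v $ j else 0)"

definition diff_fun :: "'k::comm_ring_1 resolution \<Rightarrow> nat \<Rightarrow> nat \<Rightarrow> nat \<Rightarrow> 'k mpoly" where
  "diff_fun P i j k = (if j < res_rank P i \<and> k < res_rank P (Suc i) then res_diff P i $$ (j, k) else 0)"

lemma mult_mat_vec_index:
  "M \<in> carrier_mat p q \<Longrightarrow> v \<in> carrier_vec q \<Longrightarrow> j < p \<Longrightarrow> (M *\<^sub>v v) $ j = (\<Sum>k<q. M $$ (j, k) * v $ k)"
  by (auto simp: scalar_prod_def lessThan_atLeast0 intro!: sum.cong)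

lemma carrier_free_module:
  "v \<in> carrier (free_module n r) \<longleftrightarrow> v \<in> carrier_vec r \<and> (\<forall>j<r. v $ j \<in> carrier (poly_ring (VS n)))"
  by (auto simp: free_module_def vec_set_def rings)

lemma resolution_as_functions:
  fixes P :: "'k::comm_ring_1 resolution"
  assumes P: "graded_free_resolution n I P" and I: "I \<subseteq> carrier (poly_ring (VS n))"
  shows "graded_resolution (VS n) I (res_rank P) (res_deg P) (diff_fun P)"
proof -
  let ?r = "res_rank P" and ?D = "res_diff P" and ?C = "carrier (poly_ring (VS n)) :: 'k mpoly set"
  have r0: "?r 0 = 1" and a0: "res_deg P 0 0 = 0"
    and Dm: "\<And>i. ?D i \<in> carrier_mat (?r i) (?r (Suc i))"
    and De: "\<And>i. elements_mat (?D i) \<subseteq> ?C"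
    and Dh: "\<And>i j k. j < ?r i \<Longrightarrow> k < ?r (Suc i) \<Longrightarrow> homog (res_deg P (Suc i) k - res_deg P i j) (?D i $$ (j, k))"
    and aug: "(\<lambda>v. ?D 0 *\<^sub>v v) ` carrier (free_module n (?r 1)) = {v \<in> carrier (free_module n 1). v $ 0 \<in> I}"
    and ex: "\<And>i. (\<lambda>v. ?D (Suc i) *\<^sub>v v) ` carrier (free_module n (?r (Suc (Suc i)))) =
          {v \<in> carrier (free_module n (?r (Suc i))). ?D i *\<^sub>v v = 0\<^sub>v (?r i)}"
    using P unfolding graded_free_resolution_def rings by auto
  have Dc: "diff_fun P i j k \<in> ?C" for i j k
    using De[of i] Dm[of i] by (auto simp: diff_fun_def poly_ring_closed subset_iff)
  have mv: "(?D i *\<^sub>v v) $ j = (\<Sum>k<?r (Suc i). diff_fun P i j k * v $ k)"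
    if "v \<in> carrier_vec (?r (Suc i))" "j < ?r i" for i v j
    using mult_mat_vec_index[OF Dm that] that(2) by (simp add: diff_fun_def)
  have fnC: "vec_fun v j \<in> ?C" if "v \<in> carrier (free_module n m)" for v j m
    using that by (auto simp: carrier_free_module vec_fun_def poly_ring_closed)
  have fnv: "vec_fun v j = v $ j" if "v \<in> carrier (free_module n m)" "j < m" for v j m
    using that by (auto simp: carrier_free_module vec_fun_def)
  have vecC: "vec m u \<in> carrier (free_module n m)" if "\<And>j. u j \<in> ?C" for m u
    using that by (simp add: carrier_free_module)
  show ?thesis
  proof
    fix p
    show "p \<in> I \<longleftrightarrow> (\<exists>v. (\<forall>k. v k \<in> ?C) \<and> p = (\<Sum>k<?r 1. diff_fun P 0 0 k * v k))"
    proof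
      assume p: "p \<in> I"
      then have "vec 1 (\<lambda>_. p) \<in> (\<lambda>v. ?D 0 *\<^sub>v v) ` carrier (free_module n (?r 1))"
        unfolding aug using I by (auto intro!: vecC)
      then obtain v where v: "v \<in> carrier (free_module n (?r 1))" "vec 1 (\<lambda>_. p) = ?D 0 *\<^sub>v v" by blast
      have "p = (?D 0 *\<^sub>v v) $ 0" by (simp flip: v(2))
      also have "\<dots> = (\<Sum>k<?r 1. diff_fun P 0 0 k * v $ k)"
        using mv[of v 0 0] v(1) r0 by (simp add: carrier_free_module)
      also have "\<dots> = (\<Sum>k<?r 1. diff_fun P 0 0 k * vec_fun v k)"
        by (rule sum.cong) (use fnv[OF v(1)] in auto)
      finally show "\<exists>v. (\<forall>k. v k \<in> ?C) \<and> p = (\<Sum>k<?r 1. diff_fun P 0 0 k * v k)"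
        using fnC[OF v(1)] by blast
    next
      assume "\<exists>v. (\<forall>k. v k \<in> ?C) \<and> p = (\<Sum>k<?r 1. diff_fun P 0 0 k * v k)"
      then obtain v where v: "\<And>k. v k \<in> ?C" "p = (\<Sum>k<?r 1. diff_fun P 0 0 k * v k)" by blast
      have "?D 0 *\<^sub>v vec (?r 1) v \<in> {v \<in> carrier (free_module n 1). v $ 0 \<in> I}"
        unfolding aug[symmetric] by (rule imageI) (rule vecC[OF v(1)])
      then have "(?D 0 *\<^sub>v vec (?r 1) v) $ 0 \<in> I" by blast
      then show "p \<in> I" using mv[of "vec (?r 1) v" 0 0] r0 v(2) by simp
    qed
  next
    fix i j l
    show "(\<Sum>k<?r (Suc i). diff_fun P i j k * diff_fun P (Suc i) k l) = 0"
    proof (cases "j < ?r i \<and> l < ?r (Suc (Suc i))")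
      case True
      define u where "u = vec (?r (Suc (Suc i))) (\<lambda>x. if x = l then 1 else (0 :: 'k mpoly))"
      have "u \<in> carrier (free_module n (?r (Suc (Suc i))))"
        unfolding u_def by (rule vecC) (simp add: poly_ring_closed)
      then have *: "?D (Suc i) *\<^sub>v u \<in> carrier (free_module n (?r (Suc i)))"
        "?D i *\<^sub>v (?D (Suc i) *\<^sub>v u) = 0\<^sub>v (?r i)"
        using ex[of i] by blast+
      have col: "(?D (Suc i) *\<^sub>v u) $ k = diff_fun P (Suc i) k l" if "k < ?r (Suc i)" for k
      proof -
        have "(?D (Suc i) *\<^sub>v u) $ k = (\<Sum>x<?r (Suc (Suc i)). diff_fun P (Suc i) k x * (if x = l then 1 else 0))"
          using mv[of u "Suc i" k] that by (simp add: u_def)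
        also have "\<dots> = (\<Sum>x<?r (Suc (Suc i)). if l = x then diff_fun P (Suc i) k x else 0)"
          by (rule sum.cong) auto
        finally show ?thesis using True by simp
      qed
      have "0 = (?D i *\<^sub>v (?D (Suc i) *\<^sub>v u)) $ j" using *(2) True by simp
      also have "\<dots> = (\<Sum>k<?r (Suc i). diff_fun P i j k * (?D (Suc i) *\<^sub>v u) $ k)"
        by (rule mv) (use *(1) True in \<open>auto simp: carrier_free_module\<close>)
      finally show ?thesis using col by simp
    qed (auto simp: diff_fun_def)
  next
    fix v i
    assume v: "\<And>k. v k \<in> ?C"
      and cyc: "\<And>j. j < ?r i \<Longrightarrow> (\<Sum>k<?r (Suc i). diff_fun P i j k * v k) = 0"
    have "?D i *\<^sub>v vec (?r (Suc i)) v = 0\<^sub>v (?r i)"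
    proof (rule eq_vecI)
      fix j assume "j < dim_vec (0\<^sub>v (?r i) :: 'k mpoly vec)"
      then have j: "j < ?r i" by simp
      then show "(?D i *\<^sub>v vec (?r (Suc i)) v) $ j = 0\<^sub>v (?r i) $ j"
        using mv[of "vec (?r (Suc i)) v" i j] cyc[OF j] by simp
    qed (use Dm[of i] in auto)
    then have "vec (?r (Suc i)) v \<in> (\<lambda>v. ?D (Suc i) *\<^sub>v v) ` carrier (free_module n (?r (Suc (Suc i))))"
      unfolding ex using vecC[of v, OF v] by blast
    then obtain u where u: "u \<in> carrier (free_module n (?r (Suc (Suc i))))"
      "vec (?r (Suc i)) v = ?D (Suc i) *\<^sub>v u" by blast
    have "v k = (\<Sum>l<?r (Suc (Suc i)). diff_fun P (Suc i) k l * vec_fun u l)" if k: "k < ?r (Suc i)" for k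
    proof -
      have "v k = vec (?r (Suc i)) v $ k" using k by simp
      also have "\<dots> = (\<Sum>l<?r (Suc (Suc i)). diff_fun P (Suc i) k l * u $ l)"
        unfolding u(2) by (rule mv[OF _ k]) (use u(1) in \<open>simp add: carrier_free_module\<close>)
      also have "\<dots> = (\<Sum>l<?r (Suc (Suc i)). diff_fun P (Suc i) k l * vec_fun u l)"
        by (rule sum.cong) (use fnv[OF u(1)] in auto)
      finally show ?thesis .
    qed
    then show "\<exists>u. (\<forall>l. u l \<in> ?C) \<and>
        (\<forall>k<?r (Suc i). v k = (\<Sum>l<?r (Suc (Suc i)). diff_fun P (Suc i) k l * u l))"
      using fnC[OF u(1)] by blast
  qed (use r0 a0 Dc Dh in \<open>simp_all add: diff_fun_def\<close>)
qed

lemma cocycles_as_functions: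
  fixes P :: "'k::comm_ring_1 resolution"
  assumes P: "graded_free_resolution n I P" and I: "I \<subseteq> carrier (poly_ring (VS n))"
    and v: "v \<in> carrier_vec (res_rank P i)"
  shows "v \<in> cocycles n P i \<longleftrightarrow> graded_resolution.cocycle (VS n) (res_rank P) (diff_fun P) {0} i (vec_fun v)"
    and "v \<in> coboundaries n P i \<longleftrightarrow> graded_resolution.cobound (VS n) (res_rank P) (diff_fun P) {0} i (vec_fun v)"
proof -
  interpret R: graded_resolution "VS n" I "res_rank P" "res_deg P" "diff_fun P"
    by (rule resolution_as_functions[OF P I])
  have Dm: "res_diff P i \<in> carrier_mat (res_rank P i) (res_rank P (Suc i))" for i
    using P by (simp add: graded_free_resolution_def)
  have Dt: "transpose_mat (res_diff P i) \<in> carrier_mat (res_rank P (Suc i)) (res_rank P i)" for i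
    using Dm[of i] by simp
  have tr: "(transpose_mat (res_diff P i) *\<^sub>v w) $ k = R.dT i (vec_fun w) k"
    if "w \<in> carrier_vec (res_rank P i)" "k < res_rank P (Suc i)" for i w k
    using mult_mat_vec_index[OF Dt that] that Dm[of i]
    by (auto simp: R.dT_def diff_fun_def vec_fun_def intro!: sum.cong)
  have "transpose_mat (res_diff P i) *\<^sub>v v = 0\<^sub>v (res_rank P (Suc i)) \<longleftrightarrow> (\<forall>k. R.dT i (vec_fun v) k = 0)"
  proof
    assume *: "transpose_mat (res_diff P i) *\<^sub>v v = 0\<^sub>v (res_rank P (Suc i))"
    show "\<forall>k. R.dT i (vec_fun v) k = 0"
    proof
      fix k
      show "R.dT i (vec_fun v) k = 0"
        using tr[OF v, of k] * R.dT_out[of i k] by (cases "k < res_rank P (Suc i)") auto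
    qed
  next
    assume "\<forall>k. R.dT i (vec_fun v) k = 0"
    then show "transpose_mat (res_diff P i) *\<^sub>v v = 0\<^sub>v (res_rank P (Suc i))"
      using tr[OF v] Dm[of i] by (intro eq_vecI) auto
  qed
  then show "v \<in> cocycles n P i \<longleftrightarrow> R.cocycle {0} i (vec_fun v)"
    using v by (auto simp: cocycles_def R.cocycle_def carrier_free_module vec_fun_def poly_ring_closed)
  show "v \<in> coboundaries n P i \<longleftrightarrow> R.cobound {0} i (vec_fun v)"
  proof (cases i)
    case 0
    have "v = 0\<^sub>v (res_rank P 0) \<longleftrightarrow> (\<forall>j<res_rank P 0. vec_fun v j = 0)"
      using v 0 by (auto simp: vec_fun_def)
    then show ?thesis using 0 by (auto simp: R.cobound_def intro!: exI[of _ "\<lambda>_. 0"] poly_ring_closed)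
  next
    case (Suc i')
    show ?thesis
    proof
      assume "v \<in> coboundaries n P i"
      then obtain w where w: "w \<in> carrier (free_module n (res_rank P i'))"
        "v = transpose_mat (res_diff P i') *\<^sub>v w" by (auto simp: Suc)
      have wc: "w \<in> carrier_vec (res_rank P i')" using w(1) by (simp add: carrier_free_module)
      have "vec_fun v j = R.dT i' (vec_fun w) j" if "j < res_rank P i" for j
        using tr[OF wc, of j] that v Suc by (simp add: vec_fun_def flip: w(2))
      moreover have "vec_fun w j \<in> R.C" for j
        using w(1) by (auto simp: carrier_free_module vec_fun_def poly_ring_closed)
      ultimately show "R.cobound {0} i (vec_fun v)"
        unfolding R.cobound_def by (intro exI[of _ "vec_fun w"]) (simp add: Suc)
    next
      assume "R.cobound {0} i (vec_fun v)"
      then obtain u where u: "\<And>j. u j \<in> R.C" "\<And>j. j < res_rank P i \<Longrightarrow> vec_fun v j = R.dT i' u j"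
        by (auto simp: R.cobound_def Suc)
      let ?w = "vec (res_rank P i') u"
      have "v = transpose_mat (res_diff P i') *\<^sub>v ?w"
      proof (rule eq_vecI)
        fix j assume "j < dim_vec (transpose_mat (res_diff P i') *\<^sub>v ?w)"
        then have j: "j < res_rank P i" using Dm[of i'] Suc by simp
        have "R.dT i' (vec_fun ?w) j = R.dT i' u j" by (simp add: R.dT_def vec_fun_def)
        then show "v $ j = (transpose_mat (res_diff P i') *\<^sub>v ?w) $ j"
          using tr[of ?w i' j] u(2)[OF j] j v Suc by (simp add: vec_fun_def)
      qed (use v Dm[of i'] Suc in auto)
      moreover have "?w \<in> carrier (free_module n (res_rank P i'))"
        using u(1) by (simp add: carrier_free_module)
      ultimately show "v \<in> coboundaries n P i" by (auto simp: Suc)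
    qed
  qed
qed

lemma vec_fun_add: "dim_vec v = dim_vec w \<Longrightarrow> vec_fun (v + w) = (\<lambda>j. vec_fun v j + vec_fun w j)"
  by (auto simp: vec_fun_def fun_eq_iff)

lemma vec_fun_smult: "vec_fun (c \<cdot>\<^sub>v v) = (\<lambda>j. c * vec_fun v j)"
  by (auto simp: vec_fun_def fun_eq_iff)

subsection \<open>The regular sequence $x_1 y_1, \dots, x_n y_n$\<close>

lemma push_shift:
  fixes p :: "'a::cancel_comm_monoid_add \<Rightarrow>\<^sub>0 'k::comm_ring_1"
  shows "mono1 a * push N p = push (\<lambda>m. a + N m) p"
  by (induction p rule: poly_induct) (auto simp: mult_single distrib_left push_add)

context simplicial
begin

text \<open>The elements of the regular sequence are counted from 0: the \<open>k\<close>-th one is $x_{k+1} y_{k+1}$,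
  while \<open>xy_ideal k\<close> is generated by $x_1 y_1, \dots, x_k y_k$.\<close>

definition xy :: "nat \<Rightarrow> var \<Rightarrow>\<^sub>0 nat" where
  "xy k = sgl (Xv (Suc k)) 1 + sgl (Yv (Suc k)) 1"

definition xy_multiples :: "nat \<Rightarrow> (var \<Rightarrow>\<^sub>0 nat) set" where
  "xy_multiples k = {m. \<exists>j\<in>{1..k}. lkp m (Xv j) \<noteq> 0 \<and> lkp m (Yv j) \<noteq> 0}"

definition xy_ideal :: "nat \<Rightarrow> 'k::comm_ring_1 mpoly set" where
  "xy_ideal k = {p \<in> carrier (poly_ring (VS n)). kys p \<subseteq> xy_multiples k}"

lemma bad_xy: "bad {} m \<longleftrightarrow> m \<in> xy_multiples n"
  by (simp add: bad_def xy_multiples_def)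

lemma xy_multiples_Suc: "m \<in> xy_multiples (Suc k) \<longleftrightarrow> m \<in> xy_multiples k \<or> (\<exists>c. m = xy k + c)"
proof -
  have "(\<exists>c. m = xy k + c) \<longleftrightarrow> lkp m (Xv (Suc k)) \<noteq> 0 \<and> lkp m (Yv (Suc k)) \<noteq> 0"
  proof
    assume "\<exists>c. m = xy k + c"
    then show "lkp m (Xv (Suc k)) \<noteq> 0 \<and> lkp m (Yv (Suc k)) \<noteq> 0"
      by (auto simp: xy_def lookup_add)
  next
    assume "lkp m (Xv (Suc k)) \<noteq> 0 \<and> lkp m (Yv (Suc k)) \<noteq> 0"
    then show "\<exists>c. m = xy k + c"
      unfolding xy_def by (intro le_two_vars) auto
  qed
  then show ?thesis unfolding xy_multiples_def by (auto simp: atLeastAtMostSuc_conv)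
qed

lemma xy_multiples_add: "m \<in> xy_multiples k \<Longrightarrow> m + m' \<in> xy_multiples k"
  by (auto simp: xy_multiples_def lookup_add)

lemma xy_closed: "k < n \<Longrightarrow> xy k \<in> mons (VS n)"
  by (simp add: xy_def mons_add mons_single)

text \<open>The $x_j y_j$ involve disjoint sets of variables. Hence a monomial \<open>m\<close> is divisible by one of
  $x_1 y_1, \dots, x_k y_k$ if $x_{k+1} y_{k+1} m$ is.\<close>

lemma xy_regular_chain:
  assumes "graded_resolution (VS n) (ideal_\<Gamma> n \<Delta> :: 'k::comm_ring_1 mpoly set) r a D"
  shows "regular_chain (VS n) (ideal_\<Gamma> n \<Delta> :: 'k mpoly set) r a D (\<lambda>k. mono1 (xy k)) xy_ideal n 2"
proof -
  interpret graded_resolution "VS n" "ideal_\<Gamma> n \<Delta> :: 'k mpoly set" r a D by fact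
  have id: "ideal (xy_ideal k :: 'k mpoly set) (poly_ring (VS n))" for k
    unfolding xy_ideal_def by (rule ideal_of_monomials) (rule xy_multiples_add)
  show ?thesis
  proof (intro regular_chain.intro regular_chain_axioms.intro)
    show "graded_resolution (VS n) (ideal_\<Gamma> n \<Delta> :: 'k mpoly set) r a D" by fact
  next
    show "ideal (xy_ideal k :: 'k mpoly set) (poly_ring (VS n))" for k by (rule id)
  next
    fix k and x :: "'k mpoly" assume k: "k < n"
    show "x \<in> xy_ideal (Suc k) \<longleftrightarrow> (\<exists>c\<in>C. x - mono1 (xy k) * c \<in> xy_ideal k)"
    proof
      assume x: "x \<in> xy_ideal (Suc k)"
      let ?U = "xy_multiples k"
      define y where "y = restr (- ?U) x"
      define c where "c = push (\<lambda>m. m - xy k) y"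
      have ym: "m = xy k + (m - xy k)" if my: "m \<in> kys y" for m
      proof -
        have "m \<in> xy_multiples (Suc k)" "m \<notin> ?U"
          using my x by (auto simp: y_def keys_restr xy_ideal_def)
        then obtain d where "m = xy k + d" by (auto simp: xy_multiples_Suc)
        then show ?thesis by simp
      qed
      have "mono1 (xy k) * c = push (\<lambda>m. xy k + (m - xy k)) y"
        by (simp add: c_def push_shift)
      also have "\<dots> = y" by (rule push_id) (use ym in auto)
      finally have "mono1 (xy k) * c = y" .
      moreover have "x - y = restr ?U x"
        unfolding diff_eq_eq y_def by (rule restr_compl)
      ultimately have "x - mono1 (xy k) * c = restr ?U x" by simp
      moreover have "restr ?U x \<in> xy_ideal k"
        using x by (auto simp: xy_ideal_def keys_restr carrier_poly_ring)
      moreover have "c \<in> C"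
      proof -
        have "m - xy k \<in> mons (VS n)" if m: "m \<in> kys y" for m
        proof -
          have "m \<in> mons (VS n)" using m x by (auto simp: y_def keys_restr xy_ideal_def carrier_poly_ring)
          then have "xy k + (m - xy k) \<in> mons (VS n)" using ym[OF m] by simp
          then show ?thesis by (simp only: mons_add)
        qed
        then show ?thesis
          using keys_push[of "\<lambda>m. m - xy k" y] by (auto simp: c_def carrier_poly_ring)
      qed
      ultimately show "\<exists>c\<in>C. x - mono1 (xy k) * c \<in> xy_ideal k"
        by (intro bexI[of _ c]) simp_all
    next
      assume "\<exists>c\<in>C. x - mono1 (xy k) * c \<in> xy_ideal k"
      then obtain c where c: "c \<in> C" "x - mono1 (xy k) * c \<in> xy_ideal k" by blast
      note I = ideal_poly_ringD[OF id]
      have 1: "x - mono1 (xy k) * c \<in> xy_ideal (Suc k)"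
        using c(2) by (auto simp: xy_ideal_def xy_multiples_Suc)
      have "mono1 (xy k) \<in> xy_ideal (Suc k)"
        using xy_closed[OF k] by (auto simp: xy_ideal_def xy_multiples_Suc poly_ring_closed intro!: exI[of _ 0])
      from I(4)[OF this c(1)] have 2: "mono1 (xy k) * c \<in> xy_ideal (Suc k)" by (simp add: mult.commute)
      show "x \<in> xy_ideal (Suc k)" using I(3)[OF 1 2] by simp
    qed
  next
    fix k and c :: "'k mpoly" assume c: "c \<in> C" "mono1 (xy k) * c \<in> xy_ideal k"
    have "m \<in> xy_multiples k" if m: "m \<in> kys c" for m
    proof -
      have "xy k + m \<in> kys (mono1 (xy k) * c)"
        using m by (simp add: in_kys lookup_monomial_mult)
      then have "xy k + m \<in> xy_multiples k" using c(2) by (auto simp: xy_ideal_def)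
      then show ?thesis
        by (auto simp: xy_multiples_def xy_def lookup_add lookup_single when_def split: if_splits)
    qed
    then show "c \<in> xy_ideal k" using c(1) by (auto simp: xy_ideal_def)
  next
    fix k assume k: "k < n"
    show "(mono1 (xy k) :: 'k mpoly) \<in> ideal_\<Gamma> n \<Delta>"
      unfolding xy_def by (rule ideal_\<Gamma>_props(3)) (use k in auto)
    show "(mono1 (xy k) :: 'k mpoly) \<in> C"
      by (rule poly_ring_closed) (rule xy_closed[OF k])
    show "homog 2 (mono1 (xy k) :: 'k mpoly)"
      by (rule homog_single) (simp add: xy_def mon_degree_add)
  qed
qed

definition colon :: "'k::comm_ring_1 mpoly set" where
  "colon = {s \<in> carrier (poly_ring (VS n)). \<forall>q\<in>ideal_\<Gamma> n \<Delta>. q * s \<in> xy_ideal n}"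

end

subsection \<open>The isomorphism with the canonical module\<close>

context simplicial
begin

text \<open>The cochains of degree \<open>e\<close> with values in $S(-2n)$. Each of the \<open>n\<close> shifts along $x_k y_k$
  raises degrees by 2, which cancels the twist.\<close>

definition homog_cochain :: "'k::comm_ring_1 resolution \<Rightarrow> int \<Rightarrow> 'k mpoly vec \<Rightarrow> bool" where
  "homog_cochain P e v \<longleftrightarrow> (\<forall>j<res_rank P n. homog (res_deg P n j + - 2 * int n + e) (v $ j))"

text \<open>On classes, \<open>\<Psi>\<close> is a graded isomorphism from $\omega$ to the colon ideal modulo
  $(x_1 y_1, \dots, x_n y_n)$.\<close>

definition ext_iso :: "'k::comm_ring_1 resolution \<Rightarrow> ('k mpoly vec \<Rightarrow> 'k mpoly) \<Rightarrow> bool" where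
  "ext_iso P \<Psi> \<longleftrightarrow>
     (\<forall>v\<in>cocycles n P n. v \<in> carrier_vec (res_rank P n) \<and> \<Psi> v \<in> colon) \<and>
     (\<forall>v\<in>cocycles n P n. \<forall>w\<in>cocycles n P n. v + w \<in> cocycles n P n \<and> \<Psi> (v + w) = \<Psi> v + \<Psi> w) \<and>
     (\<forall>c\<in>carrier (poly_ring (VS n)). \<forall>v\<in>cocycles n P n.
        c \<cdot>\<^sub>v v \<in> cocycles n P n \<and> \<Psi> (c \<cdot>\<^sub>v v) = c * \<Psi> v) \<and>
     coboundaries n P n = {v\<in>cocycles n P n. \<Psi> v \<in> xy_ideal n} \<and>
     (\<forall>e. \<forall>v\<in>cocycles n P n. homog_cochain P e v \<longrightarrow> homog e (\<Psi> v)) \<and>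
     (\<forall>s\<in>colon. \<exists>v\<in>cocycles n P n. \<Psi> v - s \<in> xy_ideal n) \<and>
     (\<forall>e. \<forall>s\<in>colon. homog e s \<longrightarrow>
        (\<exists>v\<in>cocycles n P n. homog_cochain P e v \<and> \<Psi> v - s \<in> xy_ideal n))"

lemma xy_ideal_ideal: "ideal (xy_ideal k :: 'k::comm_ring_1 mpoly set) (poly_ring (VS n))"
  unfolding xy_ideal_def by (rule ideal_of_monomials) (rule xy_multiples_add)

lemma hcomp_xy_ideal: "p \<in> xy_ideal k \<Longrightarrow> hcomp e p \<in> xy_ideal k"
  using keys_hcomp[of e p] by (auto simp: xy_ideal_def carrier_poly_ring)

theorem ext_iso_exists:
  fixes P :: "'k::comm_ring_1 resolution"
  assumes P: "graded_free_resolution n (ideal_\<Gamma> n \<Delta>) P"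
  shows "\<exists>\<Psi>. ext_iso P \<Psi>"
proof -
  have \<Gamma>: "(ideal_\<Gamma> n \<Delta> :: 'k mpoly set) \<subseteq> carrier (poly_ring (VS n))"
    by (rule ideal_poly_ringD(1)[OF ideal_\<Gamma>_props(1)])
  interpret regular_chain "VS n" "ideal_\<Gamma> n \<Delta> :: 'k mpoly set" "res_rank P" "res_deg P" "diff_fun P"
    "\<lambda>k. mono1 (xy k)" xy_ideal n 2
    by (rule xy_regular_chain[OF resolution_as_functions[OF P \<Gamma>]])
  let ?r = "res_rank P n" and ?Coc = "cocycles n P n"
  have 0: "(xy_ideal 0 :: 'k mpoly set) = {0}"
    by (auto simp: xy_ideal_def xy_multiples_def carrier_poly_ring)
  obtain \<Psi> where "ext_colon_map \<Psi>" using ext_colon[OF 0] by (rule exE)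
  note \<Psi> = ext_colon_mapD[OF this]
  note X = ideal_poly_ringD[OF xy_ideal_ideal[of n]]
  have vec: "v \<in> carrier_vec ?r" if "v \<in> ?Coc" for v
    using that by (simp add: cocycles_def carrier_free_module)
  have coc: "v \<in> ?Coc \<longleftrightarrow> cocycle {0} n (vec_fun v)" if "v \<in> carrier_vec ?r" for v
    by (rule cocycles_as_functions(1)[OF P \<Gamma> that])
  have cob: "v \<in> coboundaries n P n \<longleftrightarrow> cobound {0} n (vec_fun v)" if "v \<in> carrier_vec ?r" for v
    by (rule cocycles_as_functions(2)[OF P \<Gamma> that])
  have cfn: "cocycle {0} n (vec_fun v)" if "v \<in> ?Coc" for v
    using coc[OF vec[OF that]] that by simp
  have cob_coc: "cocycle {0} n w" if w: "cobound {0} n w" "\<And>j. w j \<in> C" for w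
  proof -
    obtain u where u: "\<And>j. u j \<in> C" "\<And>j. j < ?r \<Longrightarrow> w j = bd n u j"
      using w(1) by (auto simp: cobound_def)
    have "dT n w k = dT n (bd n u) k" for k unfolding dT_def by (rule sum.cong) (simp_all add: u(2))
    then show ?thesis using w(2) by (simp add: cocycle_def dT_bd)
  qed
  have cob_vec: "v \<in> carrier_vec ?r \<and> v \<in> ?Coc" if vb: "v \<in> coboundaries n P n" for v
  proof -
    have v: "v \<in> carrier_vec ?r"
    proof (cases n)
      case 0 then show ?thesis using vb by simp
    next
      case (Suc i)
      have "res_diff P i \<in> carrier_mat (res_rank P i) (res_rank P (Suc i))"
        using P by (simp add: graded_free_resolution_def)
      then show ?thesis using vb Suc by (auto simp: carrier_free_module)
    qed
    have "vec_fun v j \<in> C" for j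
    proof (cases "j < ?r")
      case True
      obtain u where u: "\<And>j. u j \<in> C" "\<And>j. j < ?r \<Longrightarrow> vec_fun v j = bd n u j"
        using vb cob[OF v] by (auto simp: cobound_def)
      show ?thesis using u(2)[OF True] bd_closed[OF u(1)] by simp
    qed (use v in \<open>simp add: vec_fun_def C_closed\<close>)
    then show ?thesis using v cob_coc coc[OF v] cob[OF v] vb by blast
  qed
  \<comment> \<open>A cochain with entries only beyond the rank is a coboundary, so these entries change \<open>\<Psi>\<close> only
    by elements of the ideal.\<close>
  have trunc: "vec ?r w \<in> ?Coc \<and> \<Psi> (vec_fun (vec ?r w)) - \<Psi> w \<in> xy_ideal n" if w: "cocycle {0} n w" for w
  proof -
    have fv: "vec_fun (vec ?r w) j = (if j < ?r then w j else 0)" for j by (simp add: vec_fun_def)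
    have "dT n (vec_fun (vec ?r w)) k = dT n w k" for k
      unfolding dT_def by (rule sum.cong) (simp_all add: fv)
    then have c: "cocycle {0} n (vec_fun (vec ?r w))"
      using w by (simp add: cocycle_def fv C_closed)
    define d where "d j = vec_fun (vec ?r w) j + (- 1) * w j" for j
    have "cocycle {0} n d"
      using c w unfolding cocycle_def d_def by (simp add: dT_diff C_closed)
    moreover have "cobound {0} n d"
      unfolding cobound_def
      by (intro exI[of _ "\<lambda>_. 0"])
         (simp add: C_closed d_def fv bd_def dT_def split: nat.splits)
    ultimately have "\<Psi> d \<in> xy_ideal n" using \<Psi>(6) by blast
    also have "\<Psi> d = \<Psi> (vec_fun (vec ?r w)) + \<Psi> (\<lambda>j. (- 1) * w j)" unfolding d_def by (rule \<Psi>(1))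
    also have "\<Psi> (\<lambda>j. (- 1) * w j) = (- 1) * \<Psi> w" by (rule \<Psi>(2))
    finally show ?thesis using c coc[of "vec ?r w"] by simp
  qed
  have colon: "\<exists>w. cocycle {0} n w \<and> s - \<Psi> w \<in> xy_ideal n" if "s \<in> colon" for s
    using \<Psi>(7)[of s] that by (simp add: colon_def)
  show ?thesis
    unfolding ext_iso_def
  proof (intro exI[of _ "\<lambda>v. \<Psi> (vec_fun v)"] conjI ballI allI impI)
    fix v assume v: "v \<in> ?Coc"
    show "v \<in> carrier_vec ?r" by (rule vec[OF v])
    show "\<Psi> (vec_fun v) \<in> colon"
      using \<Psi>(3)[of "vec_fun v"] \<Psi>(5)[OF cfn[OF v]] cfn[OF v] by (simp add: colon_def cocycle_def)
    {
      fix w assume w: "w \<in> ?Coc"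
      have dims: "dim_vec v = dim_vec w" using vec[OF v] vec[OF w] by simp
      show "v + w \<in> ?Coc"
        using cfn[OF v] cfn[OF w] vec[OF v] vec[OF w] coc[of "v + w"]
        by (simp add: cocycle_def vec_fun_add dT_add C_closed)
      show "\<Psi> (vec_fun (v + w)) = \<Psi> (vec_fun v) + \<Psi> (vec_fun w)" unfolding vec_fun_add[OF dims] by (rule \<Psi>(1))
    }
    fix e assume hv: "homog_cochain P e v"
    have "(\<lambda>j. hcomp (res_deg P n j + (- 2 * int n + e)) (vec_fun v j)) = vec_fun v"
      using hv vec[OF v]
      by (auto simp: fun_eq_iff vec_fun_def homog_cochain_def algebra_simps hcomp_homog)
    then have "\<Psi> (vec_fun v) = hcomp e (\<Psi> (vec_fun v))"
      using \<Psi>(4)[of "- 2 * int n + e" "vec_fun v"] by simp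
    then show "homog e (\<Psi> (vec_fun v))" using homog_hcomp[of e "\<Psi> (vec_fun v)"] by simp
  next
    fix c v assume c: "c \<in> C" and v: "v \<in> ?Coc"
    show "c \<cdot>\<^sub>v v \<in> ?Coc"
      using cfn[OF v] vec[OF v] coc[of "c \<cdot>\<^sub>v v"] c
      by (simp add: cocycle_def vec_fun_smult dT_smult C_closed)
    show "\<Psi> (vec_fun (c \<cdot>\<^sub>v v)) = c * \<Psi> (vec_fun v)" unfolding vec_fun_smult by (rule \<Psi>(2))
  next
    show "coboundaries n P n = {v \<in> ?Coc. \<Psi> (vec_fun v) \<in> xy_ideal n}"
    proof (intro equalityI subsetI)
      fix v assume v: "v \<in> coboundaries n P n"
      then show "v \<in> {v \<in> ?Coc. \<Psi> (vec_fun v) \<in> xy_ideal n}"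
        using cob_vec[OF v] \<Psi>(6)[OF cfn] cob by blast
    next
      fix v assume "v \<in> {v \<in> ?Coc. \<Psi> (vec_fun v) \<in> xy_ideal n}"
      then show "v \<in> coboundaries n P n"
        using \<Psi>(6)[OF cfn] cob vec by blast
    qed
  next
    fix s :: "'k mpoly" assume s: "s \<in> colon"
    obtain w where w: "cocycle {0} n w" "s - \<Psi> w \<in> xy_ideal n" using colon[OF s] by blast
    have "\<Psi> (vec_fun (vec ?r w)) - s \<in> xy_ideal n"
      using X(5)[OF conjunct2[OF trunc[OF w(1)]] w(2)] by simp
    then show "\<exists>v\<in>?Coc. \<Psi> (vec_fun v) - s \<in> xy_ideal n"
      using trunc[OF w(1)] by blast
  next
    fix e and s :: "'k mpoly" assume s: "s \<in> colon" and hs: "homog e s"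
    obtain w where w: "cocycle {0} n w" "s - \<Psi> w \<in> xy_ideal n" using colon[OF s] by blast
    let ?e = "- 2 * int n + e"
    define w' where "w' j = hcomp (res_deg P n j + ?e) (w j)" for j
    have w': "cocycle {0} n w'" unfolding w'_def by (rule cocycle_hcomp[OF w(1)])
    have "\<Psi> w' = hcomp e (\<Psi> w)" unfolding w'_def \<Psi>(4) by simp
    then have "s - \<Psi> w' = hcomp e (s - \<Psi> w)" using hs by (simp add: hcomp_diff hcomp_homog)
    then have "s - \<Psi> w' \<in> xy_ideal n" using hcomp_xy_ideal[OF w(2)] by simp
    from X(5)[OF conjunct2[OF trunc[OF w']] this]
    have "\<Psi> (vec_fun (vec ?r w')) - s \<in> xy_ideal n" by simp
    moreover have "homog_cochain P e (vec ?r w')"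
      unfolding homog_cochain_def
    proof (intro allI impI)
      fix j assume "j < ?r"
      moreover have "homog (res_deg P n j + ?e) (w' j)" unfolding w'_def by (rule homog_hcomp)
      ultimately show "homog (res_deg P n j + - 2 * int n + e) (vec ?r w' $ j)"
        by (simp only: index_vec add.assoc)
    qed
    ultimately show "\<exists>v\<in>?Coc. homog_cochain P e v \<and> \<Psi> (vec_fun v) - s \<in> xy_ideal n"
      using trunc[OF w'] by blast
  qed
qed

end

definition part :: "nat \<Rightarrow> (nat \<times> (var \<Rightarrow>\<^sub>0 nat) \<Rightarrow>\<^sub>0 'k::comm_ring_1) \<Rightarrow> 'k mpoly" where
  "part e P = push snd (restr {w. fst w = e} P)"

lemma part_add: "part e (P + Q) = part e P + part e Q"
  by (simp add: part_def restr_add push_add)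

lemma part_0 [simp]: "part e 0 = 0" by (simp add: part_def)

lemma part_single: "part e (sgl (e', u) c) = (if e' = e then sgl u c else 0)"
  by (simp add: part_def restr_single)

lemma lookup_part: "lkp (part e P) u = lkp P (e, u)"
proof (induction P rule: poly_induct)
  case (single w c)
  then show ?case by (cases w) (auto simp: part_single lookup_single when_def)
qed (simp_all add: part_add lookup_add)

lemma part_mult:
  "part 0 (P * Q) = part 0 P * part 0 Q"
  "part 1 (P * Q) = part 0 P * part 1 Q + part 1 P * part 0 Q"
proof -
  have "part 0 (P * Q) = part 0 P * part 0 Q \<and>
      part 1 (P * Q) = part 0 P * part 1 Q + part 1 P * part 0 Q"
  proof (induction P rule: poly_induct)
    case (single w c)
    show ?case
    proof (induction Q rule: poly_induct)
      case (single w' c')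
      then show ?case by (cases w; cases w') (auto simp: mult_single part_single)
    qed (simp_all add: distrib_left part_add algebra_simps)
  qed (simp_all add: distrib_right part_add algebra_simps)
  then show "part 0 (P * Q) = part 0 P * part 0 Q"
    "part 1 (P * Q) = part 0 P * part 1 Q + part 1 P * part 0 Q" by simp_all
qed

lemma keys_part: "u \<in> kys (part e P) \<longleftrightarrow> (e, u) \<in> kys P"
  by (simp add: in_kys lookup_part)

text \<open>The components of a polynomial of degree 0 and 1 in the $z_F$, with
  $\mathbf{y}^{[n] \setminus F}$ substituted for $z_F$ in the latter.\<close>

definition ev0 :: "nat \<Rightarrow> 'k::comm_ring_1 mpoly \<Rightarrow> 'k mpoly" where
  "ev0 n p = part 0 (push (nf n {}) p)"

definition lin :: "nat \<Rightarrow> 'k::comm_ring_1 mpoly \<Rightarrow> 'k mpoly" where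
  "lin n p = part 1 (push (nf n {}) p)"

lemma ev0_add: "ev0 n (p + q) = ev0 n p + ev0 n q"
  and lin_add: "lin n (p + q) = lin n p + lin n q"
  by (simp_all add: ev0_def lin_def push_add part_add)

lemma ev0_mult: "ev0 n (p * q) = ev0 n p * ev0 n q"
  and lin_mult: "lin n (p * q) = ev0 n p * lin n q + lin n p * ev0 n q"
  unfolding ev0_def lin_def push_mult[of "nf n {}", OF nf_add] part_mult by (rule refl)+

lemma nf_VS: "m \<in> mons (VS n) \<Longrightarrow> nf n {} m = (0, m)"
  by (rule nf_reduced) (simp add: VS_K_sub(2)[symmetric])

lemma ev0_lin_S:
  assumes "p \<in> carrier (poly_ring (VS n))"
  shows "ev0 n p = p" "lin n p = 0"
proof -
  have "push (nf n {}) p = push (\<lambda>m. (0, m)) p"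
    by (rule push_cong) (use assms in \<open>auto simp: carrier_poly_ring intro!: nf_VS\<close>)
  moreover have "part 0 (push (\<lambda>m. (0::nat, m)) p) = p \<and> part 1 (push (\<lambda>m. (0::nat, m)) p) = 0"
    by (induction p rule: poly_induct) (auto simp: push_add part_add part_single)
  ultimately show "ev0 n p = p" "lin n p = 0" by (simp_all add: ev0_def lin_def)
qed

lemma nf_closed: "m \<in> mons (VT n \<Delta>) \<Longrightarrow> snd (nf n {} m) \<in> mons (VS n)"
proof (induction m rule: mon_induct)
  case (var v)
  then show ?case
    by (cases v) (auto simp: mons_single tv_def intro!: vmon_closed)
qed (simp_all add: nf_add mons_add)

lemma part_closed:
  assumes "p \<in> carrier (poly_ring (VT n \<Delta>))"
  shows "part e (push (nf n {}) p) \<in> carrier (poly_ring (VS n))"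
proof -
  have "u \<in> mons (VS n)" if u: "u \<in> kys (part e (push (nf n {}) p))" for u
  proof -
    have "(e, u) \<in> nf n {} ` kys p"
      using u keys_push[of "nf n {}" p] by (auto simp: keys_part)
    then obtain m where "m \<in> kys p" "nf n {} m = (e, u)" by auto
    then show ?thesis using nf_closed[of m n \<Delta>] assms by (auto simp: carrier_poly_ring)
  qed
  then show ?thesis by (auto simp: carrier_poly_ring)
qed

context simplicial
begin

lemma ev0_closed: "p \<in> carrier T \<Longrightarrow> ev0 n p \<in> carrier (poly_ring (VS n))"
  and lin_closed: "p \<in> carrier T \<Longrightarrow> lin n p \<in> carrier (poly_ring (VS n))"
  unfolding ev0_def lin_def by (rule part_closed; assumption)+

text \<open>The condition on the normal form splits according to the degree in the $z_F$. In degree 0 it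
  describes $I_\Gamma$, in degree 1 the ideal $(x_1 y_1, \dots, x_n y_n)$.\<close>

lemma rel_ideal_empty_iff:
  fixes p :: "'k::comm_ring_1 mpoly"
  assumes p: "p \<in> carrier T"
  shows "p \<in> rel_ideal {} \<longleftrightarrow> ev0 n p \<in> ideal_\<Gamma> n \<Delta> \<and> lin n p \<in> xy_ideal n"
proof -
  have d0: "ev0 n p \<in> ideal_\<Gamma> n \<Delta> \<longleftrightarrow> (\<forall>u. (0, u) \<in> kys (push (nf n {}) p) \<longrightarrow> (0, u) \<in> dead {})"
    unfolding ideal_\<Gamma>_monomial using ev0_closed[OF p]
    by (simp add: subset_iff ev0_def keys_part)
  have d1: "lin n p \<in> xy_ideal n \<longleftrightarrow> (\<forall>u. (1, u) \<in> kys (push (nf n {}) p) \<longrightarrow> (1, u) \<in> dead {})"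
    unfolding xy_ideal_def using lin_closed[OF p]
    by (simp add: subset_iff lin_def keys_part dead_def bad_xy)
  have "kys (push (nf n {}) p) \<subseteq> dead {} \<longleftrightarrow>
      (\<forall>u. (0, u) \<in> kys (push (nf n {}) p) \<longrightarrow> (0, u) \<in> dead {}) \<and>
      (\<forall>u. (1, u) \<in> kys (push (nf n {}) p) \<longrightarrow> (1, u) \<in> dead {})"
  proof (intro iffI conjI allI impI subsetI)
    fix w
    assume *: "(\<forall>u. (0, u) \<in> kys (push (nf n {}) p) \<longrightarrow> (0, u) \<in> dead {}) \<and>
      (\<forall>u. (1, u) \<in> kys (push (nf n {}) p) \<longrightarrow> (1, u) \<in> dead {})"
      and w: "w \<in> kys (push (nf n {}) p)"
    obtain e u where [simp]: "w = (e, u)" by (cases w)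
    consider "e = 0" | "e = 1" | "2 \<le> e" by linarith
    then show "w \<in> dead {}"
      by cases (use * w in \<open>auto simp: dead_def\<close>)
  qed auto
  then show ?thesis using d0 d1 p by (simp add: rel_ideal_def)
qed

subsection \<open>The colon ideal is spanned by the multiples of $\mathbf{y}^{[n] \setminus F}$\<close>

text \<open>The normal form of $q\, z_F$ vanishes for $q \in I_\Gamma$, since multiples of vanishing normal
  forms vanish.\<close>

lemma lin_colon:
  fixes p :: "'k::comm_ring_1 mpoly"
  assumes p: "p \<in> carrier T"
  shows "lin n p \<in> colon"
  unfolding colon_def
proof (intro CollectI conjI ballI)
  show "lin n p \<in> carrier (poly_ring (VS n))" by (rule lin_closed[OF p])
  fix q :: "'k mpoly" assume q: "q \<in> ideal_\<Gamma> n \<Delta>"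
  have qS: "q \<in> carrier (poly_ring (VS n))" and qd: "kys q \<subseteq> {m. (0, m) \<in> dead {}}"
    using q unfolding ideal_\<Gamma>_monomial by auto
  have "kys (q * lin n p) \<subseteq> xy_multiples n"
  proof (rule keys_mult_sub[OF qd order_refl])
    fix a u assume a: "a \<in> {m. (0, m) \<in> dead {}}" and u: "u \<in> kys (lin n p)"
    have "(1, u) \<in> nf n {} ` kys p"
      using u keys_push[of "nf n {}" p] by (auto simp: lin_def keys_part)
    then obtain m where m: "m \<in> kys p" "nf n {} m = (1, u)" by auto
    have "(0, a) + nf n {} m \<in> dead {}"
      by (rule dead_add) (use a m(1) p in \<open>auto simp: carrier_poly_ring\<close>)
    then show "a + u \<in> xy_multiples n" by (simp add: m(2) dead_def bad_xy)
  qed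
  then show "q * lin n p \<in> xy_ideal n"
    unfolding xy_ideal_def using poly_ring_closed(5)[OF qS lin_closed[OF p]] by simp
qed

text \<open>A monomial \<open>u\<close> of an element of the colon ideal that is divisible by no $x_j y_j$ is killed by
  all non-faces. So the indices $j$ for which $y_j$ does not divide \<open>u\<close> form a face, and \<open>u\<close> is a
  multiple of $\mathbf{y}^{[n] \setminus F}$ for every facet \<open>F\<close> containing it.\<close>

lemma colon_monomial:
  fixes s :: "'k::comm_ring_1 mpoly"
  assumes s: "s \<in> colon" and u: "u \<in> kys s" and nu: "u \<notin> xy_multiples n"
  shows "\<exists>m\<in>mons (VT n \<Delta>). nf n {} m = (1, u)"
proof -
  define G where "G = {j \<in> {1..n}. lkp u (Yv j) = 0}"
  have G: "G \<subseteq> {1..n}" "finite G" by (auto simp: G_def)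
  have "G \<in> \<Delta>"
  proof (rule ccontr)
    assume "G \<notin> \<Delta>"
    then have "(mono1 (vmon Xv G) :: 'k mpoly) \<in> ideal_\<Gamma> n \<Delta>" by (rule ideal_\<Gamma>_props(2)[OF G(1)])
    then have "mono1 (vmon Xv G) * s \<in> xy_ideal n" using s by (simp add: colon_def)
    moreover have "vmon Xv G + u \<in> kys (mono1 (vmon Xv G) * s)"
      using u by (simp add: in_kys lookup_monomial_mult)
    ultimately have "vmon Xv G + u \<in> xy_multiples n" by (auto simp: xy_ideal_def)
    then obtain j where j: "j \<in> {1..n}" "lkp (vmon Xv G + u) (Xv j) \<noteq> 0" "lkp (vmon Xv G + u) (Yv j) \<noteq> 0"
      unfolding xy_multiples_def by blast
    have y: "lkp u (Yv j) \<noteq> 0" using j(3) G(2) by (simp add: lookup_add lookup_vmon)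
    then have "j \<notin> G" by (simp add: G_def)
    then have "lkp u (Xv j) \<noteq> 0" using j(2) G(2) by (simp add: lookup_add lookup_vmon)
    then show False using nu y j(1) unfolding xy_multiples_def by blast
  qed
  then obtain F where F: "F \<in> facets \<Delta>" "G \<subseteq> F" using face_in_facet by blast
  have "\<exists>m1. u = vmon Yv ({1..n} - F) + m1"
  proof (rule le_monomial)
    fix v
    show "lkp (vmon Yv ({1..n} - F)) v \<le> lkp u v"
    proof (cases v)
      case (Yv j)
      show ?thesis
      proof (cases "j \<in> {1..n} - F")
        case True
        then have "lkp u (Yv j) \<noteq> 0" using F(2) by (auto simp: G_def)
        then show ?thesis using True by (simp add: Yv lookup_vmon)
      next
        case False
        then have "lkp (vmon Yv ({1..n} - F)) (Yv j) = 0"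
          by (subst lookup_vmon(3)) simp_all
        then show ?thesis by (simp add: Yv)
      qed
    qed (simp_all add: lookup_vmon)
  qed
  then obtain m1 where m1: "u = vmon Yv ({1..n} - F) + m1" by (rule exE)
  have "u \<in> mons (VS n)" using s u by (auto simp: colon_def carrier_poly_ring)
  then have m1S: "m1 \<in> mons (VS n)" by (simp add: m1 mons_add)
  have tv0: "vmon (tv {}) H = vmon Yv H" for H by (simp add: vmon_def tv_def)
  have "nf n {} (sgl (Zv F) 1 + m1) = (1, u)"
    unfolding nf_add nf_VS[OF m1S] by (simp add: tv0[simplified] m1[simplified])
  moreover have "sgl (Zv F) 1 + m1 \<in> mons (VT n \<Delta>)"
    using F(1) mons_mono[OF V_sub(1) m1S] by (simp add: mons_add mons_single)
  ultimately show ?thesis by blast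
qed

definition zlift :: "(var \<Rightarrow>\<^sub>0 nat) \<Rightarrow> var \<Rightarrow>\<^sub>0 nat" where
  "zlift u = (SOME m. m \<in> mons (VT n \<Delta>) \<and> nf n {} m = (1, u))"

text \<open>The monomials outside the domain of \<open>zlift\<close> are dropped; they lie in
  $(x_1 y_1, \dots, x_n y_n)$.\<close>

definition lift :: "'k::comm_ring_1 mpoly \<Rightarrow> 'k mpoly" where
  "lift s = push zlift (restr (- xy_multiples n) s)"

lemma zlift:
  fixes s :: "'k::comm_ring_1 mpoly"
  assumes "s \<in> colon" "u \<in> kys (restr (- xy_multiples n) s)"
  shows "zlift u \<in> mons (VT n \<Delta>)" "nf n {} (zlift u) = (1, u)"
proof -
  have "\<exists>m. m \<in> mons (VT n \<Delta>) \<and> nf n {} m = (1, u)"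
    using colon_monomial[OF assms(1), of u] assms(2) by (auto simp: keys_restr)
  from someI_ex[OF this] show "zlift u \<in> mons (VT n \<Delta>)" "nf n {} (zlift u) = (1, u)"
    unfolding zlift_def by simp_all
qed

lemma lift_props:
  fixes s :: "'k::comm_ring_1 mpoly"
  assumes s: "s \<in> colon"
  shows "lift s \<in> carrier T" "ev0 n (lift s) = 0" "lin n (lift s) - s \<in> xy_ideal n"
proof -
  let ?s = "restr (- xy_multiples n) s"
  show "lift s \<in> carrier T"
    using keys_push[of zlift ?s] zlift(1)[OF s] by (auto simp: lift_def carrier_poly_ring)
  have "push (nf n {}) (lift s) = push (\<lambda>u. (1, u)) ?s"
    unfolding lift_def push_push by (rule push_cong) (use zlift(2)[OF s] in simp)
  moreover have "part 0 (push (\<lambda>u. (1::nat, u)) p) = 0 \<and> part 1 (push (\<lambda>u. (1::nat, u)) p) = p" for p :: "'k mpoly"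
    by (induction p rule: poly_induct) (auto simp: push_add part_add part_single)
  ultimately have "ev0 n (lift s) = 0" and l: "lin n (lift s) = ?s" by (simp_all add: ev0_def lin_def)
  then show "ev0 n (lift s) = 0" by simp
  have sS: "s \<in> carrier (poly_ring (VS n))" using s by (simp add: colon_def)
  have "?s - s \<in> carrier (poly_ring (VS n))"
    by (rule poly_ring_closed(4)[OF _ sS]) (use sS in \<open>auto simp: carrier_poly_ring keys_restr\<close>)
  moreover have "kys (?s - s) \<subseteq> xy_multiples n"
    by (auto simp: in_kys lookup_minus lookup_restr split: if_splits)
  ultimately show "lin n (lift s) - s \<in> xy_ideal n" by (simp add: l xy_ideal_def)
qed

subsection \<open>Degrees\<close>

lemma nf_degree_0:
  assumes "m \<in> mons (VT n \<Delta>)" "nf n {} m = (0, u)"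
  shows "mon_degree u = mon_degree m"
proof -
  have "m \<in> mons (VS n \<union> zvars \<Delta>)" using assms(1) by (simp add: VT_def VS_def)
  then show ?thesis
  proof (cases rule: monomial_cases)
    case 0
    then show ?thesis using nf_VS[OF 0] assms(2) by simp
  next
    case (1 F m1)
    then show ?thesis using assms(2) by (simp add: nf_add plus_prod_def prod_eq_iff)
  next
    case (2 F F' m2)
    then show ?thesis using assms(2) by (simp add: nf_add plus_prod_def prod_eq_iff)
  qed
qed

lemma facet_card:
  assumes pure: "pure_complex \<Delta>" and F: "F \<in> facets \<Delta>"
  shows "int (card F) = complex_dim \<Delta> + 1"
proof -
  have "face_dim G \<le> face_dim F" if GD: "G \<in> \<Delta>" for G
  proof -
    obtain F' where F': "F' \<in> facets \<Delta>" "G \<subseteq> F'" using face_in_facet[OF GD] by blast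
    have "card G \<le> card F'" by (rule card_mono[OF facet_finite[OF F'(1)] F'(2)])
    then have "face_dim G \<le> face_dim F'" by (simp add: face_dim_def)
    also have "face_dim F' = face_dim F" using pure F F'(1) unfolding pure_complex_def by blast
    finally show ?thesis .
  qed
  then have "complex_dim \<Delta> = face_dim F"
    unfolding complex_dim_def using finite_\<Delta> facet_face[OF F] by (intro Max_eqI) auto
  then show ?thesis by (simp add: face_dim_def)
qed

text \<open>Every facet has $d$ elements, so replacing $z_F$ by $\mathbf{y}^{[n] \setminus F}$ raises the
  degree by $n - d - 1$, the twist of $\omega$ in $R_\Delta$.\<close>

lemma nf_degree_1:
  assumes pure: "pure_complex \<Delta>" and m: "m \<in> mons (VT n \<Delta>)" "nf n {} m = (1, u)"
  shows "int (mon_degree u) = int (mon_degree m) + (int n - (complex_dim \<Delta> + 1) - 1)"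
proof -
  have "m \<in> mons (VS n \<union> zvars \<Delta>)" using m(1) by (simp add: VT_def VS_def)
  then show ?thesis
  proof (cases rule: monomial_cases)
    case 0
    then show ?thesis using nf_VS[OF 0] m(2) by simp
  next
    case (1 F m1)
    have "nf n {} m = (1, vmon (tv {}) ({1..n} - F) + m1)"
      unfolding 1(3) nf_add nf_VS[OF 1(2)] by simp
    then have u: "u = vmon (tv {}) ({1..n} - F) + m1" using m(2) by (simp only: prod.inject)
    have "card ({1..n} - F) = n - card F" "card F \<le> n"
      using facet_sub[OF 1(1)] facet_finite[OF 1(1)] card_mono[of "{1..n}" F]
      by (simp_all add: card_Diff_subset)
    then have "int (card ({1..n} - F)) = int n - (complex_dim \<Delta> + 1)"
      using facet_card[OF pure 1(1)] by simp
    then show ?thesis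
      unfolding u 1(3) mon_degree_add mon_degree_vmon mon_degree_single by simp
  next
    case (2 F F' m2)
    then show ?thesis using m(2) by (simp add: nf_add plus_prod_def prod_eq_iff)
  qed
qed

lemma homog_ev0:
  assumes p: "p \<in> carrier T" "homog j p"
  shows "homog j (ev0 n p)"
  unfolding homog_def
proof
  fix u assume "u \<in> kys (ev0 n p)"
  then have "(0, u) \<in> nf n {} ` kys p"
    using keys_push[of "nf n {}" p] by (auto simp: ev0_def keys_part)
  then obtain m where "m \<in> kys p" "nf n {} m = (0, u)" by auto
  then show "int (mon_degree u) = j"
    using nf_degree_0[of m u] p by (auto simp: homog_def carrier_poly_ring)
qed

lemma homog_lin:
  assumes pure: "pure_complex \<Delta>" and p: "p \<in> carrier T" "homog j p"
  shows "homog (j + (int n - (complex_dim \<Delta> + 1) - 1)) (lin n p)"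
  unfolding homog_def
proof
  fix u assume "u \<in> kys (lin n p)"
  then have "(1, u) \<in> nf n {} ` kys p"
    using keys_push[of "nf n {}" p] by (auto simp: lin_def keys_part)
  then obtain m where "m \<in> kys p" "nf n {} m = (1, u)" by auto
  then show "int (mon_degree u) = j + (int n - (complex_dim \<Delta> + 1) - 1)"
    using nf_degree_1[OF pure, of m u] p by (auto simp: homog_def carrier_poly_ring)
qed

lemma homog_lift:
  fixes s :: "'k::comm_ring_1 mpoly"
  assumes pure: "pure_complex \<Delta>" and s: "s \<in> colon" "homog (j + (int n - (complex_dim \<Delta> + 1) - 1)) s"
  shows "homog j (lift s)"
  unfolding homog_def
proof
  fix m assume "m \<in> kys (lift s)"
  then obtain u where u: "u \<in> kys (restr (- xy_multiples n) s)" "m = zlift u"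
    using keys_push[of zlift "restr (- xy_multiples n) s"] by (auto simp: lift_def)
  have "u \<in> kys s" using u(1) by (simp add: keys_restr)
  then have "int (mon_degree u) = j + (int n - (complex_dim \<Delta> + 1) - 1)"
    using s(2) by (simp add: homog_def)
  then show "int (mon_degree m) = j"
    using nf_degree_1[OF pure zlift[OF s(1) u(1)]] u(2) by simp
qed

end

section \<open>The presentation of $R_\Delta$\<close>

lemma cocycle_module_simps:
  "carrier (cocycle_module n P i) = cocycles n P i"
  "v \<oplus>\<^bsub>cocycle_module n P i\<^esub> w = v + w"
  "c \<odot>\<^bsub>cocycle_module n P i\<^esub> v = c \<cdot>\<^sub>v v"
  by (simp_all add: cocycle_module_def free_module_def module_vec_simps)

lemma omega_simps:
  "carrier (\<omega>_module n P) = (\<Union>v\<in>cocycles n P n. {coboundaries n P n +>\<^bsub>cocycle_module n P n\<^esub> v})"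
  "\<zero>\<^bsub>\<omega>_module n P\<^esub> = coboundaries n P n"
  "B \<oplus>\<^bsub>\<omega>_module n P\<^esub> B' = (\<Union>v\<in>B. \<Union>w\<in>B'. {v + w})"
  "A \<odot>\<^bsub>\<omega>_module n P\<^esub> B =
     (\<Union>a\<in>A. \<Union>v\<in>B. coboundaries n P n +>\<^bsub>cocycle_module n P n\<^esub> (a \<cdot>\<^sub>v v))"
  by (simp_all add: \<omega>_module_def module_over_quotient_def Ext_module_def quotient_module_def
      A_RCOSETS_def' set_add_def' cocycle_module_simps)

context simplicial
begin

lemma ext_isoD:
  assumes "ext_iso P \<Psi>"
  shows "v \<in> cocycles n P n \<Longrightarrow> v \<in> carrier_vec (res_rank P n)"
    and "v \<in> cocycles n P n \<Longrightarrow> \<Psi> v \<in> colon"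
    and "v \<in> cocycles n P n \<Longrightarrow> w \<in> cocycles n P n \<Longrightarrow> v + w \<in> cocycles n P n"
    and "v \<in> cocycles n P n \<Longrightarrow> w \<in> cocycles n P n \<Longrightarrow> \<Psi> (v + w) = \<Psi> v + \<Psi> w"
    and "c \<in> carrier (poly_ring (VS n)) \<Longrightarrow> v \<in> cocycles n P n \<Longrightarrow> c \<cdot>\<^sub>v v \<in> cocycles n P n"
    and "c \<in> carrier (poly_ring (VS n)) \<Longrightarrow> v \<in> cocycles n P n \<Longrightarrow> \<Psi> (c \<cdot>\<^sub>v v) = c * \<Psi> v"
    and "v \<in> coboundaries n P n \<longleftrightarrow> v \<in> cocycles n P n \<and> \<Psi> v \<in> xy_ideal n"
    and "v \<in> cocycles n P n \<Longrightarrow> homog_cochain P e v \<Longrightarrow> homog e (\<Psi> v)"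
    and "s \<in> colon \<Longrightarrow> \<exists>v\<in>cocycles n P n. \<Psi> v - s \<in> xy_ideal n"
    and "s \<in> colon \<Longrightarrow> homog e s \<Longrightarrow>
      \<exists>v\<in>cocycles n P n. homog_cochain P e v \<and> \<Psi> v - s \<in> xy_ideal n"
  using assms unfolding ext_iso_def by simp_all

lemma colon_ideal: "ideal (colon :: 'k::comm_ring_1 mpoly set) (poly_ring (VS n))"
proof (rule ideal_poly_ringI)
  note X = ideal_poly_ringD[OF xy_ideal_ideal[of n]]
  fix p q :: "'k mpoly"
  {
    assume pq: "p \<in> colon" "q \<in> colon"
    show "p + q \<in> colon"
      unfolding colon_def mem_Collect_eq
    proof (intro conjI ballI)
      fix c :: "'k mpoly" assume c: "c \<in> ideal_\<Gamma> n \<Delta>"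
      have "c * p + c * q \<in> xy_ideal n" by (rule X(3)) (use pq c in \<open>simp_all add: colon_def\<close>)
      then show "c * (p + q) \<in> xy_ideal n" by (simp add: distrib_left)
    qed (use pq in \<open>simp add: colon_def poly_ring_closed\<close>)
  }
  assume p: "p \<in> colon" and q: "q \<in> carrier (poly_ring (VS n))"
  show "q * p \<in> colon"
    unfolding colon_def mem_Collect_eq
  proof (intro conjI ballI)
    fix c :: "'k mpoly" assume c: "c \<in> ideal_\<Gamma> n \<Delta>"
    have "q * (c * p) \<in> xy_ideal n" by (rule X(4)[OF _ q]) (use p c in \<open>simp add: colon_def\<close>)
    then show "c * (q * p) \<in> xy_ideal n" by (simp add: mult.left_commute)
  qed (use p q in \<open>simp add: colon_def poly_ring_closed\<close>)
qed (auto simp: colon_def poly_ring_closed ideal_poly_ringD(2)[OF xy_ideal_ideal])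

lemma class_\<Gamma>_eq: "class_\<Gamma> n \<Delta> p = (\<Union>i\<in>ideal_\<Gamma> n \<Delta>. {i + p})"
  by (simp add: class_\<Gamma>_def a_r_coset_def' rings)

lemma one_S: "(1 :: 'k::comm_ring_1 mpoly) \<in> carrier (poly_ring (VS n))" "(0 :: 'k mpoly) \<in> carrier (poly_ring (VS n))"
  by (simp_all add: poly_ring_closed)

lemma ring_\<Gamma>_eq: "ring_\<Gamma> n \<Delta> = poly_ring (VS n) Quot ideal_\<Gamma> n \<Delta>"
  by (simp add: ring_\<Gamma>_def rings)

lemma class_\<Gamma>_fun: "class_\<Gamma> n \<Delta> = (\<lambda>p. ideal_\<Gamma> n \<Delta> +>\<^bsub>poly_ring (VS n)\<^esub> p)"
  by (simp add: fun_eq_iff class_\<Gamma>_def rings)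

lemma class_\<Gamma>_hom:
  fixes p q :: "'k::comm_ring_1 mpoly"
  assumes "p \<in> carrier (poly_ring (VS n))" "q \<in> carrier (poly_ring (VS n))"
  shows "class_\<Gamma> n \<Delta> p \<otimes>\<^bsub>ring_\<Gamma> n \<Delta>\<^esub> class_\<Gamma> n \<Delta> q = class_\<Gamma> n \<Delta> (p * q)"
    "class_\<Gamma> n \<Delta> p \<oplus>\<^bsub>ring_\<Gamma> n \<Delta>\<^esub> class_\<Gamma> n \<Delta> q = class_\<Gamma> n \<Delta> (p + q)"
    "\<one>\<^bsub>ring_\<Gamma> n \<Delta>\<^esub> = class_\<Gamma> n \<Delta> (1 :: 'k mpoly)"
    "\<zero>\<^bsub>ring_\<Gamma> n \<Delta>\<^esub> = class_\<Gamma> n \<Delta> (0 :: 'k mpoly)"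
    "carrier (ring_\<Gamma> n \<Delta>) = class_\<Gamma> n \<Delta> ` carrier (poly_ring (VS n) :: 'k mpoly ring)"
    "class_\<Gamma> n \<Delta> p = class_\<Gamma> n \<Delta> (0 :: 'k mpoly) \<longleftrightarrow> p \<in> ideal_\<Gamma> n \<Delta>"
proof -
  interpret G: ideal "ideal_\<Gamma> n \<Delta> :: 'k mpoly set" "poly_ring (VS n)" by (rule ideal_\<Gamma>_props(1))
  note hom = ring_hom_memE[OF G.rcos_ring_hom]
  show "class_\<Gamma> n \<Delta> p \<otimes>\<^bsub>ring_\<Gamma> n \<Delta>\<^esub> class_\<Gamma> n \<Delta> q = class_\<Gamma> n \<Delta> (p * q)"
    unfolding ring_\<Gamma>_eq class_\<Gamma>_fun using hom(2)[OF assms] by simp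
  show "class_\<Gamma> n \<Delta> p \<oplus>\<^bsub>ring_\<Gamma> n \<Delta>\<^esub> class_\<Gamma> n \<Delta> q = class_\<Gamma> n \<Delta> (p + q)"
    unfolding ring_\<Gamma>_eq class_\<Gamma>_fun using hom(3)[OF assms] by simp
  show "\<one>\<^bsub>ring_\<Gamma> n \<Delta>\<^esub> = class_\<Gamma> n \<Delta> (1 :: 'k mpoly)"
    unfolding ring_\<Gamma>_eq class_\<Gamma>_fun using hom(4) by simp
  have z: "ideal_\<Gamma> n \<Delta> = class_\<Gamma> n \<Delta> (0 :: 'k mpoly)"
    unfolding class_\<Gamma>_eq by simp
  then show "\<zero>\<^bsub>ring_\<Gamma> n \<Delta>\<^esub> = class_\<Gamma> n \<Delta> (0 :: 'k mpoly)"
    by (simp add: ring_\<Gamma>_eq FactRing_def)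
  show "carrier (ring_\<Gamma> n \<Delta>) = class_\<Gamma> n \<Delta> ` carrier (poly_ring (VS n) :: 'k mpoly ring)"
    unfolding ring_\<Gamma>_eq class_\<Gamma>_fun by (auto simp: FactRing_def A_RCOSETS_def')
  show "class_\<Gamma> n \<Delta> p = class_\<Gamma> n \<Delta> (0 :: 'k mpoly) \<longleftrightarrow> p \<in> ideal_\<Gamma> n \<Delta>"
    unfolding z[symmetric] unfolding class_\<Gamma>_fun
    using G.rcos_const_imp_mem[OF assms(1)] G.a_rcos_const[of p] by blast
qed

lemma ring_R_simps:
  "carrier (ring_R n \<Delta> P) = carrier (ring_\<Gamma> n \<Delta>) \<times> carrier (\<omega>_module n P)"
  "(a, v) \<otimes>\<^bsub>ring_R n \<Delta> P\<^esub> (b, w) = (a \<otimes>\<^bsub>ring_\<Gamma> n \<Delta>\<^esub> b,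
     (a \<odot>\<^bsub>\<omega>_module n P\<^esub> w) \<oplus>\<^bsub>\<omega>_module n P\<^esub> (b \<odot>\<^bsub>\<omega>_module n P\<^esub> v))"
  "(a, v) \<oplus>\<^bsub>ring_R n \<Delta> P\<^esub> (b, w) = (a \<oplus>\<^bsub>ring_\<Gamma> n \<Delta>\<^esub> b, v \<oplus>\<^bsub>\<omega>_module n P\<^esub> w)"
  "\<one>\<^bsub>ring_R n \<Delta> P\<^esub> = (\<one>\<^bsub>ring_\<Gamma> n \<Delta>\<^esub>, \<zero>\<^bsub>\<omega>_module n P\<^esub>)"
  "\<zero>\<^bsub>ring_R n \<Delta> P\<^esub> = (\<zero>\<^bsub>ring_\<Gamma> n \<Delta>\<^esub>, \<zero>\<^bsub>\<omega>_module n P\<^esub>)"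
  by (simp_all add: ring_R_def idealization_def)

context
  fixes P :: "'k::comm_ring_1 resolution" and \<Psi>
  assumes E: "ext_iso P \<Psi>"
begin

abbreviation Coc where "Coc \<equiv> cocycles n P n"

text \<open>The element of $\omega$ that corresponds to the element \<open>s\<close> of the colon ideal.\<close>

definition \<Theta> :: "'k mpoly \<Rightarrow> 'k mpoly vec set" where
  "\<Theta> s = {v \<in> Coc. \<Psi> v - s \<in> xy_ideal n}"

lemmas X = ideal_poly_ringD[OF xy_ideal_ideal[of n, where 'k = 'k]]
lemmas E' = ext_isoD[OF E]

lemma minus_coc: "w \<in> Coc \<Longrightarrow> v \<in> Coc \<Longrightarrow> \<exists>b\<in>Coc. b + v = w \<and> \<Psi> b = \<Psi> w - \<Psi> v"
proof (intro bexI conjI)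
  assume w: "w \<in> Coc" and v: "v \<in> Coc"
  have m1: "(- 1 :: 'k mpoly) \<in> carrier (poly_ring (VS n))" by (intro poly_ring_closed)
  note mv = E'(5)[OF m1 v]
  show "w + (- 1) \<cdot>\<^sub>v v \<in> Coc" by (rule E'(3)[OF w mv])
  show "\<Psi> (w + (- 1) \<cdot>\<^sub>v v) = \<Psi> w - \<Psi> v" using E'(4)[OF w mv] E'(6)[OF m1 v] by simp
  show "w + (- 1) \<cdot>\<^sub>v v + v = w" using E'(1)[OF w] E'(1)[OF v] by (intro eq_vecI) auto
qed

lemma \<Theta>_cong: "s - s' \<in> xy_ideal n \<Longrightarrow> \<Theta> s = \<Theta> s'"
proof -
  assume s: "s - s' \<in> xy_ideal n"
  have "\<Psi> v - s \<in> xy_ideal n \<longleftrightarrow> \<Psi> v - s' \<in> xy_ideal n" for v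
  proof
    assume "\<Psi> v - s \<in> xy_ideal n"
    from X(3)[OF this s] show "\<Psi> v - s' \<in> xy_ideal n" by simp
  next
    assume "\<Psi> v - s' \<in> xy_ideal n"
    from X(5)[OF this s] show "\<Psi> v - s \<in> xy_ideal n" by simp
  qed
  then show ?thesis by (simp only: \<Theta>_def)
qed

lemma \<Theta>_nonempty: "s \<in> colon \<Longrightarrow> \<exists>v\<in>Coc. v \<in> \<Theta> s"
  using E'(9)[of s] by (auto simp: \<Theta>_def)

lemma \<Theta>_eq_0_iff:
  assumes "s \<in> colon"
  shows "\<Theta> s = \<Theta> 0 \<longleftrightarrow> s \<in> xy_ideal n"
proof
  assume eq: "\<Theta> s = \<Theta> 0"
  obtain v where v: "v \<in> \<Theta> s" using \<Theta>_nonempty[OF assms] by blast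
  then have "\<Psi> v - s \<in> xy_ideal n" by (simp add: \<Theta>_def)
  moreover have "\<Psi> v - 0 \<in> xy_ideal n" using v unfolding eq by (simp add: \<Theta>_def)
  ultimately show "s \<in> xy_ideal n" using X(5)[of "\<Psi> v - 0" "\<Psi> v - s"] by simp
next
  assume "s \<in> xy_ideal n"
  then show "\<Theta> s = \<Theta> 0" by (intro \<Theta>_cong) simp
qed

lemma coset_\<Theta>:
  assumes v: "v \<in> Coc"
  shows "coboundaries n P n +>\<^bsub>cocycle_module n P n\<^esub> v = \<Theta> (\<Psi> v)"
proof (intro equalityI subsetI)
  fix w assume "w \<in> coboundaries n P n +>\<^bsub>cocycle_module n P n\<^esub> v"
  then obtain b where b: "b \<in> coboundaries n P n" "w = b + v"
    unfolding a_r_coset_def' cocycle_module_simps by blast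
  have bc: "b \<in> Coc" "\<Psi> b \<in> xy_ideal n" using b(1) E'(7) by auto
  show "w \<in> \<Theta> (\<Psi> v)"
    using E'(3)[OF bc(1) v] E'(4)[OF bc(1) v] bc(2) by (simp add: \<Theta>_def b(2))
next
  fix w assume "w \<in> \<Theta> (\<Psi> v)"
  then have w: "w \<in> Coc" "\<Psi> w - \<Psi> v \<in> xy_ideal n" by (auto simp: \<Theta>_def)
  obtain b where b: "b \<in> Coc" "b + v = w" "\<Psi> b = \<Psi> w - \<Psi> v" using minus_coc[OF w(1) v] by blast
  have "b \<in> coboundaries n P n" using E'(7) b(1,3) w(2) by simp
  then show "w \<in> coboundaries n P n +>\<^bsub>cocycle_module n P n\<^esub> v"
    unfolding a_r_coset_def' cocycle_module_simps using b(2) by blast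
qed

lemma omega_carrier: "carrier (\<omega>_module n P) = \<Theta> ` colon"
proof (intro equalityI subsetI)
  fix Y assume "Y \<in> carrier (\<omega>_module n P)"
  then obtain v where v: "v \<in> Coc" "Y = \<Theta> (\<Psi> v)" unfolding omega_simps using coset_\<Theta> by auto
  then show "Y \<in> \<Theta> ` colon" using E'(2) by blast
next
  fix Y assume "Y \<in> \<Theta> ` colon"
  then obtain s where s: "s \<in> colon" "Y = \<Theta> s" by blast
  obtain v where v: "v \<in> Coc" "\<Psi> v - s \<in> xy_ideal n" using E'(9)[OF s(1)] by blast
  have "Y = coboundaries n P n +>\<^bsub>cocycle_module n P n\<^esub> v"
    unfolding s(2) coset_\<Theta>[OF v(1)] using \<Theta>_cong[OF v(2)] by simp
  then show "Y \<in> carrier (\<omega>_module n P)" unfolding omega_simps using v(1) by blast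
qed

lemma omega_zero: "\<zero>\<^bsub>\<omega>_module n P\<^esub> = \<Theta> 0"
  unfolding omega_simps \<Theta>_def using E'(7) by auto

lemma omega_add:
  assumes s: "s \<in> colon" and t: "t \<in> colon"
  shows "\<Theta> s \<oplus>\<^bsub>\<omega>_module n P\<^esub> \<Theta> t = \<Theta> (s + t)"
  unfolding omega_simps
proof (intro equalityI subsetI)
  fix w assume "w \<in> (\<Union>v\<in>\<Theta> s. \<Union>w\<in>\<Theta> t. {v + w})"
  then obtain v u where "v \<in> \<Theta> s" "u \<in> \<Theta> t" and w: "w = v + u" by blast
  then have vu: "v \<in> Coc" "u \<in> Coc" "\<Psi> v - s \<in> xy_ideal n" "\<Psi> u - t \<in> xy_ideal n"
    by (auto simp: \<Theta>_def)
  have "\<Psi> v - s + (\<Psi> u - t) \<in> xy_ideal n" by (rule X(3)[OF vu(3,4)])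
  then show "w \<in> \<Theta> (s + t)"
    using E'(3,4)[OF vu(1,2)] by (simp add: \<Theta>_def w algebra_simps)
next
  fix w assume "w \<in> \<Theta> (s + t)"
  then have w: "w \<in> Coc" "\<Psi> w - (s + t) \<in> xy_ideal n" by (auto simp: \<Theta>_def)
  obtain u where u: "u \<in> \<Theta> t" using \<Theta>_nonempty[OF t] by blast
  then have uc: "u \<in> Coc" "\<Psi> u - t \<in> xy_ideal n" by (auto simp: \<Theta>_def)
  obtain b where b: "b \<in> Coc" "b + u = w" "\<Psi> b = \<Psi> w - \<Psi> u" using minus_coc[OF w(1) uc(1)] by blast
  have "\<Psi> w - (s + t) - (\<Psi> u - t) \<in> xy_ideal n" by (rule X(5)[OF w(2) uc(2)])
  also have "\<Psi> w - (s + t) - (\<Psi> u - t) = \<Psi> b - s" unfolding b(3) by simp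
  finally have "b \<in> \<Theta> s" using b(1) by (simp add: \<Theta>_def)
  then show "w \<in> (\<Union>v\<in>\<Theta> s. \<Union>w\<in>\<Theta> t. {v + w})" using u b(2) by blast
qed

text \<open>A coset of $I_\Gamma$ acts through any of its members, since $I_\Gamma$ maps the colon ideal
  into $(x_1 y_1, \dots, x_n y_n)$.\<close>

lemma omega_smult:
  assumes p: "p \<in> carrier (poly_ring (VS n))" and s: "s \<in> colon"
  shows "class_\<Gamma> n \<Delta> p \<odot>\<^bsub>\<omega>_module n P\<^esub> \<Theta> s = \<Theta> (p * s)"
proof -
  note G = ideal_poly_ringD[OF ideal_\<Gamma>_props(1)]
  have val: "coboundaries n P n +>\<^bsub>cocycle_module n P n\<^esub> (a \<cdot>\<^sub>v v) = \<Theta> (p * s)"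
    if a: "a \<in> class_\<Gamma> n \<Delta> p" and v: "v \<in> \<Theta> s" for a v
  proof -
    obtain i where i: "i \<in> ideal_\<Gamma> n \<Delta>" "a = i + p" using a unfolding class_\<Gamma>_eq by blast
    have aS: "a \<in> carrier (poly_ring (VS n))"
      unfolding i(2) by (rule poly_ring_closed(3)[OF subsetD[OF G(1) i(1)] p])
    have v': "v \<in> Coc" "\<Psi> v - s \<in> xy_ideal n" using v by (auto simp: \<Theta>_def)
    have "a * (\<Psi> v - s) \<in> xy_ideal n" by (rule X(4)[OF v'(2) aS])
    moreover have "i * s \<in> xy_ideal n" using s i(1) by (simp add: colon_def)
    ultimately have "a * (\<Psi> v - s) + i * s \<in> xy_ideal n" by (rule X(3))
    also have "a * (\<Psi> v - s) + i * s = a * \<Psi> v - p * s" by (simp add: i(2) algebra_simps)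
    finally have "\<Theta> (a * \<Psi> v) = \<Theta> (p * s)" by (rule \<Theta>_cong)
    then show ?thesis using coset_\<Theta>[OF E'(5)[OF aS v'(1)]] E'(6)[OF aS v'(1)] by simp
  qed
  have "p \<in> class_\<Gamma> n \<Delta> p" unfolding class_\<Gamma>_eq using G(2) by force
  moreover obtain v where "v \<in> \<Theta> s" using \<Theta>_nonempty[OF s] by blast
  ultimately have "(\<Union>a\<in>class_\<Gamma> n \<Delta> p. \<Union>v\<in>\<Theta> s.
      coboundaries n P n +>\<^bsub>cocycle_module n P n\<^esub> (a \<cdot>\<^sub>v v)) = \<Theta> (p * s)"
    using val by (intro equalityI subsetI) blast+
  then show ?thesis unfolding omega_simps .
qed

lemma omega_grade: "\<omega>_grade n P e = \<Theta> ` {s \<in> colon. homog e s}"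
proof -
  have "\<omega>_grade n P e =
      (\<lambda>v. coboundaries n P n +>\<^bsub>cocycle_module n P n\<^esub> v) ` {v \<in> Coc. homog_cochain P e v}"
    by (simp add: \<omega>_grade_def Ext_grade_def homog_cochain_def)
  also have "\<dots> = (\<lambda>v. \<Theta> (\<Psi> v)) ` {v \<in> Coc. homog_cochain P e v}"
    by (rule image_cong) (simp_all add: coset_\<Theta>)
  also have "\<dots> = \<Theta> ` {s \<in> colon. homog e s}"
  proof (intro equalityI subsetI)
    fix Y assume "Y \<in> (\<lambda>v. \<Theta> (\<Psi> v)) ` {v \<in> Coc. homog_cochain P e v}"
    then obtain v where v: "v \<in> Coc" "homog_cochain P e v" "Y = \<Theta> (\<Psi> v)" by blast
    then show "Y \<in> \<Theta> ` {s \<in> colon. homog e s}" using E'(2)[OF v(1)] E'(8)[OF v(1,2)] by blast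
  next
    fix Y assume "Y \<in> \<Theta> ` {s \<in> colon. homog e s}"
    then obtain s where s: "s \<in> colon" "homog e s" "Y = \<Theta> s" by blast
    obtain v where v: "v \<in> Coc" "homog_cochain P e v" "\<Psi> v - s \<in> xy_ideal n"
      using E'(10)[OF s(1,2)] by blast
    have "Y = \<Theta> (\<Psi> v)" using \<Theta>_cong[OF v(3)] s(3) by simp
    then show "Y \<in> (\<lambda>v. \<Theta> (\<Psi> v)) ` {v \<in> Coc. homog_cochain P e v}" using v(1,2) by blast
  qed
  finally show ?thesis .
qed

text \<open>The square of the summand $\omega$ is zero, so the part of degree at least 2 in the $z_F$ is
  ignored.\<close>

definition pres :: "'k mpoly \<Rightarrow> 'k mpoly set \<times> 'k mpoly vec set" where
  "pres p = (class_\<Gamma> n \<Delta> (ev0 n p), \<Theta> (lin n p))"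

lemma pres_ring_hom: "pres \<in> Ring.ring_hom T (ring_R n \<Delta> P)"
proof (rule ring_hom_memI)
  fix p :: "'k mpoly" assume p: "p \<in> carrier T"
  show "pres p \<in> carrier (ring_R n \<Delta> P)"
    using ev0_closed[OF p] lin_colon[OF p]
    by (simp add: pres_def ring_R_simps class_\<Gamma>_hom(5)[OF one_S] omega_carrier)
  fix q :: "'k mpoly" assume q: "q \<in> carrier T"
  note e = ev0_closed[OF p] ev0_closed[OF q] and l = lin_colon[OF p] lin_colon[OF q]
  note c = ideal_poly_ringD(4)[OF colon_ideal l(2) e(1)] ideal_poly_ringD(4)[OF colon_ideal l(1) e(2)]
  show "pres (p \<otimes>\<^bsub>T\<^esub> q) = pres p \<otimes>\<^bsub>ring_R n \<Delta> P\<^esub> pres q"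
    by (simp add: pres_def ring_R_simps ev0_mult lin_mult class_\<Gamma>_hom(1)[OF e] omega_smult e l
        omega_add[OF c] mult.commute[of "lin n p"])
  show "pres (p \<oplus>\<^bsub>T\<^esub> q) = pres p \<oplus>\<^bsub>ring_R n \<Delta> P\<^esub> pres q"
    by (simp add: pres_def ring_R_simps ev0_add lin_add class_\<Gamma>_hom(2)[OF e] omega_add[OF l])
next
  show "pres \<one>\<^bsub>T\<^esub> = \<one>\<^bsub>ring_R n \<Delta> P\<^esub>"
    by (simp add: ev0_lin_S[OF one_S(1)] pres_def ring_R_simps class_\<Gamma>_hom(3)[OF one_S] omega_zero)
qed

lemma pres_embed: "p \<in> carrier (poly_ring (VS n)) \<Longrightarrow> pres p = embed_R n \<Delta> P p"
  using ev0_lin_S[of p n] by (simp add: pres_def embed_R_def omega_zero)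

text \<open>Every pair of an element of \<open>S\<close> and an element of the colon ideal comes from a polynomial of
  degree at most 1 in the $z_F$.\<close>

lemma pres_pair:
  assumes p: "p \<in> carrier (poly_ring (VS n))" and s: "s \<in> colon"
  shows "p + lift s \<in> carrier T" "pres (p + lift s) = (class_\<Gamma> n \<Delta> p, \<Theta> s)"
proof -
  show "p + lift s \<in> carrier T"
    by (rule poly_ring_closed(3)[OF subsetD[OF carrier_mono[OF V_sub(1)] p] lift_props(1)[OF s]])
  show "pres (p + lift s) = (class_\<Gamma> n \<Delta> p, \<Theta> s)"
    using ev0_lin_S[OF p] lift_props(2)[OF s] \<Theta>_cong[OF lift_props(3)[OF s]]
    by (simp add: pres_def ev0_add lin_add)
qed

lemma pres_surj: "pres ` carrier T = carrier (ring_R n \<Delta> P)"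
proof (intro equalityI subsetI)
  fix y assume "y \<in> pres ` carrier T"
  then show "y \<in> carrier (ring_R n \<Delta> P)" using ring_hom_memE(1)[OF pres_ring_hom] by blast
next
  fix y assume "y \<in> carrier (ring_R n \<Delta> P)"
  then obtain p s where "p \<in> carrier (poly_ring (VS n))" "s \<in> colon" "y = (class_\<Gamma> n \<Delta> p, \<Theta> s)"
    unfolding ring_R_simps class_\<Gamma>_hom(5)[OF one_S] omega_carrier by blast
  then show "y \<in> pres ` carrier T" using pres_pair by (metis imageI)
qed

lemma pres_kernel: "a_kernel T (ring_R n \<Delta> P) pres = relations_R n \<Delta>"
proof -
  have "pres p = \<zero>\<^bsub>ring_R n \<Delta> P\<^esub> \<longleftrightarrow> p \<in> rel_ideal {}" if p: "p \<in> carrier T" for p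
    unfolding pres_def ring_R_simps omega_zero class_\<Gamma>_hom(4)[OF one_S] prod.inject
      class_\<Gamma>_hom(6)[OF ev0_closed[OF p] one_S(1)] \<Theta>_eq_0_iff[OF lin_colon[OF p]]
    by (simp only: rel_ideal_empty_iff[OF p])
  then have "a_kernel T (ring_R n \<Delta> P) pres = {p \<in> carrier T. p \<in> rel_ideal {}}"
    unfolding a_kernel_def'[of T "ring_R n \<Delta> P" pres] by (intro Collect_cong conj_cong refl)
  also have "\<dots> = rel_ideal {}" using ideal_poly_ringD(1)[OF ideal_rel_ideal[of "{}"]] by blast
  finally show ?thesis by (simp only: relations_rel_ideal)
qed

lemma pres_grade:
  assumes pure: "pure_complex \<Delta>"
  shows "pres ` {p \<in> carrier T. homog j p} = R_grade n \<Delta> P j"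
proof -
  let ?e = "j + (int n - (complex_dim \<Delta> + 1) - 1)"
  have R: "R_grade n \<Delta> P j =
      class_\<Gamma> n \<Delta> ` {p \<in> carrier (poly_ring (VS n)). homog j p} \<times> \<Theta> ` {s \<in> colon. homog ?e s}"
    by (simp only: R_grade_def Let_def omega_grade rings)
  show ?thesis
    unfolding R
  proof (intro equalityI subsetI)
    fix y assume "y \<in> pres ` {p \<in> carrier T. homog j p}"
    then obtain p where p: "p \<in> carrier T" "homog j p" "y = pres p" by blast
    show "y \<in> class_\<Gamma> n \<Delta> ` {p \<in> carrier (poly_ring (VS n)). homog j p} \<times> \<Theta> ` {s \<in> colon. homog ?e s}"
      unfolding p(3) pres_def
      using ev0_closed[OF p(1)] homog_ev0[OF p(1,2)] lin_colon[OF p(1)] homog_lin[OF pure p(1,2)]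
      by blast
  next
    fix y :: "'k mpoly set \<times> 'k mpoly vec set"
    assume "y \<in> class_\<Gamma> n \<Delta> ` {p \<in> carrier (poly_ring (VS n)). homog j p} \<times> \<Theta> ` {s \<in> colon. homog ?e s}"
    then obtain p s :: "'k mpoly" where ps: "p \<in> carrier (poly_ring (VS n))" "homog j p" "s \<in> colon" "homog ?e s"
      "y = (class_\<Gamma> n \<Delta> p, \<Theta> s)" by blast
    have "homog j (p + lift s)" by (rule homog_add[OF ps(2) homog_lift[OF pure ps(3,4)]])
    then show "y \<in> pres ` {p \<in> carrier T. homog j p}"
      unfolding ps(5) pres_pair(2)[OF ps(1,3), symmetric] using pres_pair(1)[OF ps(1,3)] by blast
  qed
qed

lemma pres_presentation:
  assumes pure: "pure_complex \<Delta>"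
  shows "presentation_R n \<Delta> P pres"
  unfolding presentation_R_def rings
proof (intro conjI ballI allI)
  fix F assume "F \<in> facets \<Delta>"
  have "ev0 n (pvar (Zv F)) = (0 :: 'k mpoly)"
    by (simp add: ev0_def pvar_mono part_single)
  then show "fst (pres (pvar (Zv F))) = \<zero>\<^bsub>ring_\<Gamma> n \<Delta>\<^esub>"
    by (simp only: pres_def fst_conv class_\<Gamma>_hom(4)[OF one_S])
qed (rule pres_ring_hom pres_embed pres_surj pres_kernel pres_grade[OF pure]; assumption?)+

end

text \<open>The ring axioms carry over along the surjection \<open>pres\<close> from $S[z_F]$.\<close>

lemma ring_R_ring:
  fixes P :: "'k::comm_ring_1 resolution"
  assumes E: "ext_iso P \<Psi>"
  shows "ring (ring_R n \<Delta> P)"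
proof -
  have "pres P \<Psi> 0 = \<zero>\<^bsub>ring_R n \<Delta> P\<^esub>"
    by (simp add: ev0_lin_S[OF one_S(2)] pres_def[OF E] ring_R_simps class_\<Gamma>_hom(4)[OF one_S] omega_zero[OF E])
  then have "ring_R n \<Delta> P \<lparr>carrier := pres P \<Psi> ` carrier T, zero := pres P \<Psi> \<zero>\<^bsub>T\<^esub>\<rparr> = ring_R n \<Delta> P"
    unfolding pres_surj[OF E] by simp
  then show ?thesis
    using ring.ring_hom_imp_img_ring[OF ring_poly_ring pres_ring_hom[OF E]] by simp
qed

end

context simplicial
begin

lemma presentation_hom:
  fixes P :: "'k::comm_ring_1 resolution"
  assumes R: "ring (ring_R n \<Delta> P)" and \<pi>: "presentation_R n \<Delta> P \<pi>"
  shows "ring_hom_ring T (ring_R n \<Delta> P) \<pi>" "\<pi> ` carrier T = carrier (ring_R n \<Delta> P)"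
    "a_kernel T (ring_R n \<Delta> P) \<pi> = relations_R n \<Delta>"
    "p \<in> carrier (poly_ring (VS n)) \<Longrightarrow> \<pi> p = embed_R n \<Delta> P p"
    "R_grade n \<Delta> P j = \<pi> ` {p \<in> carrier T. homog j p}"
proof -
  note p = \<pi>[unfolded presentation_R_def rings]
  show "ring_hom_ring T (ring_R n \<Delta> P) \<pi>"
    using p by (intro ring_hom_ringI2[OF ring_poly_ring R]) simp
qed (use \<pi> in \<open>simp_all add: presentation_R_def rings\<close>)

lemma y_minus_x_image:
  fixes P :: "'k::comm_ring_1 resolution"
  assumes R: "ring (ring_R n \<Delta> P)" and \<pi>: "presentation_R n \<Delta> P \<pi>"
  shows "y_minus_x n \<Delta> P = map (\<lambda>i. \<pi> (\<theta> i)) [1..<Suc n]"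
    and "ideal_yx n \<Delta> P = Idl\<^bsub>ring_R n \<Delta> P\<^esub> (\<pi> ` \<theta> ` {1..n})"
proof -
  note h = presentation_hom[OF R \<pi>]
  interpret h: ring_hom_ring T "ring_R n \<Delta> P" \<pi> by (rule h(1))
  have *: "embed_R n \<Delta> P (pvar (Yv i)) \<ominus>\<^bsub>ring_R n \<Delta> P\<^esub> embed_R n \<Delta> P (pvar (Xv i)) = \<pi> (\<theta> i)"
    if i: "i \<in> {1..n}" for i
  proof -
    let ?y = "pvar (Yv i) :: 'k mpoly" and ?x = "pvar (Xv i) :: 'k mpoly"
    have S: "?y \<in> carrier (poly_ring (VS n))" "?x \<in> carrier (poly_ring (VS n))"
      using i by (auto intro: pvar_closed)
    have xT: "?y \<in> carrier T" "?x \<in> carrier T" using i by (auto intro: pvar_closed)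
    have mT: "- ?x \<in> carrier T" by (rule poly_ring_closed(6)[OF xT(2)])
    have "\<theta> i = ?y \<oplus>\<^bsub>T\<^esub> (\<ominus>\<^bsub>T\<^esub> ?x)" 
      unfolding uminus_poly_ring[OF xT(2)] by (simp add: pvar_mono)
    then have "\<pi> (\<theta> i) = \<pi> (?y \<oplus>\<^bsub>T\<^esub> (\<ominus>\<^bsub>T\<^esub> ?x))" by (rule arg_cong)
    also have "\<dots> = \<pi> ?y \<oplus>\<^bsub>ring_R n \<Delta> P\<^esub> \<pi> (\<ominus>\<^bsub>T\<^esub> ?x)"
      by (rule h.hom_add[OF xT(1) h.R.a_inv_closed[OF xT(2)]])
    also have "\<pi> (\<ominus>\<^bsub>T\<^esub> ?x) = \<ominus>\<^bsub>ring_R n \<Delta> P\<^esub> \<pi> ?x" by (rule h.hom_a_inv[OF xT(2)])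
    finally show ?thesis unfolding a_minus_def h(4)[OF S(1)] h(4)[OF S(2)] by (rule sym)
  qed
  show eq: "y_minus_x n \<Delta> P = map (\<lambda>i. \<pi> (\<theta> i)) [1..<Suc n]"
    unfolding y_minus_x_def by (rule map_cong[OF refl]) (rule *, simp only: set_upt atLeastLessThanSuc_atLeastAtMost)
  have "set [1..<Suc n] = {1..n}"
    by (simp only: set_upt atLeastLessThanSuc_atLeastAtMost)
  then show "ideal_yx n \<Delta> P = Idl\<^bsub>ring_R n \<Delta> P\<^esub> (\<pi> ` \<theta> ` {1..n})"
    unfolding ideal_yx_def eq set_map by (simp only: image_image)
qed

end

theorem proposition8p1:
  fixes n :: nat and \<Delta> :: "nat set set" and P :: "'k::field_char_0 resolution"
  assumes "simplicial_complex n \<Delta>"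
    and "pure_complex \<Delta>"
    and "graded_free_resolution n (ideal_\<Gamma> n \<Delta>) P"
  shows "(\<exists>\<pi>. presentation_R n \<Delta> P \<pi>) \<and>
    (\<forall>\<pi>. presentation_R n \<Delta> P \<pi> \<longrightarrow>
      (\<exists>\<phi> \<in> ring_iso (ring_A n \<Delta>) (ring_R n \<Delta> P Quot ideal_yx n \<Delta> P).
         (\<forall>c. \<phi> (class_A n \<Delta> (pconst c)) = class_R_mod_yx n \<Delta> P (embed_R n \<Delta> P (pconst c))) \<and>
         (\<forall>i \<in> {1..n}. \<phi> (class_A n \<Delta> (pvar (Xv i))) =
            class_R_mod_yx n \<Delta> P (embed_R n \<Delta> P (pvar (Xv i)))) \<and>
         (\<forall>F \<in> facets \<Delta>. \<phi> (class_A n \<Delta> (pvar (Zv F))) =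
            class_R_mod_yx n \<Delta> P (\<pi> (pvar (Zv F)))) \<and>
         (\<forall>j. \<phi> ` A_grade n \<Delta> j = class_R_mod_yx n \<Delta> P ` R_grade n \<Delta> P j))) \<and>
    regular_sequence (ring_R n \<Delta> P) (y_minus_x n \<Delta> P) \<and>
    set (y_minus_x n \<Delta> P) \<subseteq> R_grade n \<Delta> P 1"
proof -
  interpret simplicial n \<Delta> by unfold_locales (rule assms(1))
  obtain \<Psi> where E: "ext_iso P \<Psi>" using ext_iso_exists[OF assms(3)] by (rule exE)
  have R: "ring (ring_R n \<Delta> P)" by (rule ring_R_ring[OF E])
  obtain \<pi>0 where \<pi>0: "presentation_R n \<Delta> P \<pi>0" using pres_presentation[OF E assms(2)] by blast
  note h0 = presentation_hom[OF R \<pi>0] and yx0 = y_minus_x_image[OF R \<pi>0]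
  show ?thesis
  proof (intro conjI allI impI)
    show "\<exists>\<pi>. presentation_R n \<Delta> P \<pi>" by (rule exI[of _ \<pi>0]) (rule \<pi>0)
    show "regular_sequence (ring_R n \<Delta> P) (y_minus_x n \<Delta> P)"
      unfolding yx0(1) by (rule regular_sequence_theta[OF h0(1-3)])
    show "set (y_minus_x n \<Delta> P) \<subseteq> R_grade n \<Delta> P 1"
    proof
      fix r assume "r \<in> set (y_minus_x n \<Delta> P)"
      then have "r \<in> (\<lambda>i. \<pi>0 (\<theta> i)) ` {1..n}"
        by (simp only: yx0(1) set_map set_upt atLeastLessThanSuc_atLeastAtMost)
      then obtain i where i: "i \<in> {1..n}" "r = \<pi>0 (\<theta> i)" by (elim imageE)
      have "homog 1 (\<theta> i :: 'k mpoly)" by (intro homog_diff homog_single) simp_all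
      then show "r \<in> R_grade n \<Delta> P 1" unfolding h0(5) i(2) using theta_closed[OF i(1)] by blast
    qed
  next
    fix \<pi> assume \<pi>: "presentation_R n \<Delta> P \<pi>"
    note h = presentation_hom[OF R \<pi>] and yx = y_minus_x_image[OF R \<pi>]
    obtain \<phi> where iso: "\<phi> \<in> ring_iso (ring_A n \<Delta>) (ring_R n \<Delta> P Quot ideal_yx n \<Delta> P)"
      and val: "\<forall>q \<in> carrier (poly_ring (VQ n \<Delta>)).
        \<phi> (class_A n \<Delta> q) = ideal_yx n \<Delta> P +>\<^bsub>ring_R n \<Delta> P\<^esub> \<pi> q"
      and grade: "\<forall>j. \<phi> ` A_grade n \<Delta> j =
        (\<lambda>t. ideal_yx n \<Delta> P +>\<^bsub>ring_R n \<Delta> P\<^esub> \<pi> t) ` {t \<in> carrier T. homog j t}"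
      using annihilator_quotient[OF h(1-3), folded yx(2)] by (elim bexE conjE)
    have val': "\<phi> (class_A n \<Delta> q) = class_R_mod_yx n \<Delta> P (\<pi> q)"
      if "q \<in> carrier (poly_ring (VQ n \<Delta>))" for q
      unfolding class_R_mod_yx_def using val that by (rule bspec)
    show "\<exists>\<phi> \<in> ring_iso (ring_A n \<Delta>) (ring_R n \<Delta> P Quot ideal_yx n \<Delta> P).
         (\<forall>c. \<phi> (class_A n \<Delta> (pconst c)) = class_R_mod_yx n \<Delta> P (embed_R n \<Delta> P (pconst c))) \<and>
         (\<forall>i \<in> {1..n}. \<phi> (class_A n \<Delta> (pvar (Xv i))) =
            class_R_mod_yx n \<Delta> P (embed_R n \<Delta> P (pvar (Xv i)))) \<and>
         (\<forall>F \<in> facets \<Delta>. \<phi> (class_A n \<Delta> (pvar (Zv F))) =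
            class_R_mod_yx n \<Delta> P (\<pi> (pvar (Zv F)))) \<and>
         (\<forall>j. \<phi> ` A_grade n \<Delta> j = class_R_mod_yx n \<Delta> P ` R_grade n \<Delta> P j)"
    proof (rule bexI[OF _ iso], intro conjI allI ballI)
      fix c :: 'k
      have "pconst c \<in> carrier (poly_ring V)" for V
        unfolding pconst_def by (rule poly_ring_closed) simp
      then show "\<phi> (class_A n \<Delta> (pconst c)) = class_R_mod_yx n \<Delta> P (embed_R n \<Delta> P (pconst c))"
        using val' h(4) by simp
    next
      fix i assume "i \<in> {1..n}"
      then have "(pvar (Xv i) :: 'k mpoly) \<in> carrier (poly_ring (VQ n \<Delta>))"
        "(pvar (Xv i) :: 'k mpoly) \<in> carrier (poly_ring (VS n))"
        by (simp_all add: pvar_closed)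
      then show "\<phi> (class_A n \<Delta> (pvar (Xv i))) = class_R_mod_yx n \<Delta> P (embed_R n \<Delta> P (pvar (Xv i)))"
        using val' h(4) by simp
    next
      fix F assume "F \<in> facets \<Delta>"
      then show "\<phi> (class_A n \<Delta> (pvar (Zv F))) = class_R_mod_yx n \<Delta> P (\<pi> (pvar (Zv F)))"
        by (intro val') (simp add: pvar_closed)
    next
      fix j
      show "\<phi> ` A_grade n \<Delta> j = class_R_mod_yx n \<Delta> P ` R_grade n \<Delta> P j"
        unfolding h(5) class_R_mod_yx_def image_image using grade by (rule spec)
    qed
  qed
qed



end
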